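(* Suppose $\rho_0:\mathbb{T}^d\to[0,\infty)$ is continuous. Let $v(N)=N$ if $m\neq 0$ and $v(N)=N^2$ if $m=0$. Then, starting the system of independent random walks on $\mathbb{T}^d_N$ from the sequence of measures $\nu^N_{\rho_0(\cdot)}$, for all $t\ge 0$ and $u\in\mathbb{T}^d$, the mean occupation number $\psi_{N,v(N)t}(\lfloor Nu\rfloor)=\mathbb{E}_{\nu^N_{\rho_0(\cdot)}}\big[\eta_{v(N)t}(\lfloor Nu\rfloor)\big]$ at location $\lfloor Nu\rfloor$ and time $v(N)t$ converges, as $N\to\infty$, to $\rho(t,u)$, which solves $$\partial_t\rho+m\cdot\nabla\rho=0,\qquad \rho(0,u)=\rho_0(u),$$ if $m\ne 0$, and solves $$\partial_t\rho=\tfrac12\sum_{1\le i,j\le d}C_{i,j}\,\partial^2_{u_i,u_j}\rho,\qquad \rho(0,u)=\rho_0(u),$$ if $m=0$. Explicitly, $\rho(t,u)=\rho_0(u-mt)$ if $m\ne0$, and for $t>0$, $\rho(t,u)=\int_{\mathbb{R}^d}\bar\rho_0(x)G_t(u-x)\,dx$ if $m=0$.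
   Context: $\mathbb{T}=\mathbb{R}/\mathbb{Z}$ and $\mathbb{T}^d_N=(\mathbb{Z}/N\mathbb{Z})^d$, with $x\in\mathbb{T}^d_N$ identified with $x/N\in\mathbb{T}^d$; $\lfloor Nu\rfloor$ is taken coordinatewise. $p(\cdot)$ is a fixed finite-range, translation-invariant, irreducible jump probability, $p(x,y)=p(y-x)$, not depending on $N$ (viewed on $\mathbb{Z}^d$ and projected to $\mathbb{T}^d_N$). Put $m=\sum_x x\,p(x)\in\mathbb{R}^d$ and $C_{i,j}=\sum_x x_ix_jp(x)$, sums over $\mathbb{Z}^d$. Each particle performs an independent rate-$1$ continuous time random walk on $\mathbb{T}^d_N$ with jump probability $p$; $\eta_t(x)$ is the number of particles at $x$ at time $t$. The measure $\nu^N_{\rho_0(\cdot)}$ on $\{0,1,2,\ldots\}^{\mathbb{T}^d_N}$ is the product measure whose marginal at $x$ is Poisson with mean $\rho_0(x/N)$, and $\mathbb{E}_{\nu^N_{\rho_0(\cdot)}}$ is the process expectation started from it. Equivalently $\psi_{N,t}(x)=E[\rho_0(N^{-1}(x-Z^N_t))]$ where $Z^N$ is such a random walk started at the origin. $\bar\rho_0$ is the periodic extension of $\rho_0$ to $\mathbb{R}^d$ and $G_t$ is the centered Gaussian density with covariance matrix $Ct$. When $\rho_0$ is not differentiable, "solves" in the case $m\neq0$ is understood in the weak (distributional) sense. *)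

theory Defs
  imports "HOL-Probability.Probability"
begin

text \<open>A translation-invariant jump probability is given by the law \<open>p\<close> of a single increment:
  the probability of jumping from \<open>x\<close> to \<open>y\<close> is \<open>pmf p (y - x)\<close>.\<close>

definition jump_kernel :: "(int^'d) pmf \<Rightarrow> int^'d \<Rightarrow> (int^'d) pmf" where
  "jump_kernel p x = map_pmf (\<lambda>z. x + z) p"

primrec n_step :: "(int^'d) pmf \<Rightarrow> nat \<Rightarrow> int^'d \<Rightarrow> (int^'d) pmf" where
  "n_step p 0 x = return_pmf x"
| "n_step p (Suc n) x = bind_pmf (n_step p n x) (jump_kernel p)"

definition irreducible_jump :: "(int^'d) pmf \<Rightarrow> bool" where
  "irreducible_jump p \<longleftrightarrow> (\<forall>x y. \<exists>n. pmf (n_step p n x) y > 0)"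

definition finite_range_jump :: "(int^'d) pmf \<Rightarrow> bool" where
  "finite_range_jump p \<longleftrightarrow> finite (set_pmf p)"

definition jump_mean :: "(int^'d) pmf \<Rightarrow> real^'d" where
  "jump_mean p = (\<chi> i. \<Sum>x\<in>set_pmf p. of_int (x $ i) * pmf p x)"

definition jump_cov :: "(int^'d) pmf \<Rightarrow> real^'d^'d" where
  "jump_cov p = (\<chi> i j. \<Sum>x\<in>set_pmf p. of_int (x $ i) * of_int (x $ j) * pmf p x)"

definition time_scale :: "(int^'d) pmf \<Rightarrow> nat \<Rightarrow> real" where
  "time_scale p N = (if jump_mean p \<noteq> 0 then real N else (real N)\<^sup>2)"

text \<open>Points of the discrete torus are represented by their coordinates in \<open>{0..<N}\<close>;
  \<open>torus_proj N\<close> is the quotient map from the integer lattice.\<close>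

definition torus_sites :: "nat \<Rightarrow> (int^'d) set" where
  "torus_sites N = {x. \<forall>i. 0 \<le> x $ i \<and> x $ i < int N}"

definition torus_proj :: "nat \<Rightarrow> int^'d \<Rightarrow> int^'d" where
  "torus_proj N x = (\<chi> i. x $ i mod int N)"

definition macro_point :: "nat \<Rightarrow> int^'d \<Rightarrow> real^'d" where
  "macro_point N x = (\<chi> i. of_int (x $ i) / real N)"

definition micro_site :: "nat \<Rightarrow> real^'d \<Rightarrow> int^'d" where
  "micro_site N u = torus_proj N (\<chi> i. \<lfloor>real N * u $ i\<rfloor>)"

text \<open>Functions on the continuous torus are represented by their periodic extensions.  As the
  quotient map is open, continuity on the torus is continuity of the extension.  The cube
  \<open>cbox 0 1\<close> serves as a fundamental domain for integration.\<close>

definition torus_fun :: "(real^'d \<Rightarrow> 'b) \<Rightarrow> bool" where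
  "torus_fun f \<longleftrightarrow> (\<forall>u. \<forall>k :: int^'d. f (u + (\<chi> i. of_int (k $ i))) = f u)"

text \<open>The randomness driving one particle is a pair of independent sequences: the waiting times
  between jumps (i.i.d. exponential of rate 1) and the increments (i.i.d. with law \<open>p\<close>).\<close>

type_synonym 'd path_seed = "(nat \<Rightarrow> real) \<times> (nat \<Rightarrow> int^'d)"

definition path_measure :: "(int^'d) pmf \<Rightarrow> 'd path_seed measure" where
  "path_measure p =
     (\<Pi>\<^sub>M i\<in>(UNIV :: nat set). density lborel (\<lambda>x. ennreal (exponential_density 1 x)))
     \<Otimes>\<^sub>M (\<Pi>\<^sub>M i\<in>(UNIV :: nat set). measure_pmf p)"

text \<open>The \<open>n\<close>-th jump, counted from 0, takes place at time \<open>\<Sum>i\<le>n. fst s i\<close>.  The set below is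
  almost surely finite.\<close>

definition num_jumps :: "'d path_seed \<Rightarrow> real \<Rightarrow> nat" where
  "num_jumps s t = card {n. (\<Sum>i\<le>n. fst s i) \<le> t}"

definition walk_pos :: "nat \<Rightarrow> int^'d \<Rightarrow> 'd path_seed \<Rightarrow> real \<Rightarrow> int^'d" where
  "walk_pos N x s t = torus_proj N (x + (\<Sum>i<num_jumps s t. snd s i))"

text \<open>The library's \<open>poisson_pmf\<close> is specified for positive rates only.\<close>

definition poisson_law :: "real \<Rightarrow> nat pmf" where
  "poisson_law r = (if r > 0 then poisson_pmf r else return_pmf 0)"

definition init_measure :: "(real^'d \<Rightarrow> real) \<Rightarrow> nat \<Rightarrow> (int^'d \<Rightarrow> nat) measure" where
  "init_measure \<rho>\<^sub>0 N = (\<Pi>\<^sub>M x\<in>torus_sites N. measure_pmf (poisson_law (\<rho>\<^sub>0 (macro_point N x))))"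

text \<open>Every site carries an unlimited supply of independent particle seeds, labelled by natural
  numbers; only the labels below the initial occupation number of the site are used.\<close>

definition system_measure ::
  "(int^'d) pmf \<Rightarrow> (real^'d \<Rightarrow> real) \<Rightarrow> nat \<Rightarrow>
     ((int^'d \<Rightarrow> nat) \<times> ((int^'d) \<times> nat \<Rightarrow> 'd path_seed)) measure" where
  "system_measure p \<rho>\<^sub>0 N =
     init_measure \<rho>\<^sub>0 N \<Otimes>\<^sub>M (\<Pi>\<^sub>M a\<in>torus_sites N \<times> UNIV. path_measure p)"

definition occupation ::
  "nat \<Rightarrow> (int^'d \<Rightarrow> nat) \<times> ((int^'d) \<times> nat \<Rightarrow> 'd path_seed) \<Rightarrow> real \<Rightarrow> int^'d \<Rightarrow> nat" where
  "occupation N \<omega> t y =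
     (\<Sum>x\<in>torus_sites N. card {k. k < fst \<omega> x \<and> walk_pos N x (snd \<omega> (x, k)) t = y})"

definition mean_occupation ::
  "(int^'d) pmf \<Rightarrow> (real^'d \<Rightarrow> real) \<Rightarrow> nat \<Rightarrow> real \<Rightarrow> int^'d \<Rightarrow> real" where
  "mean_occupation p \<rho>\<^sub>0 N t y = (\<integral>\<omega>. real (occupation N \<omega> t y) \<partial>system_measure p \<rho>\<^sub>0 N)"

primrec C_k :: "nat \<Rightarrow> ('a::real_normed_vector \<Rightarrow> real) \<Rightarrow> bool" where
  "C_k 0 f \<longleftrightarrow> continuous_on UNIV f"
| "C_k (Suc k) f \<longleftrightarrow>
     (\<exists>f'. (\<forall>x. (f has_derivative f' x) (at x)) \<and> (\<forall>v. C_k k (\<lambda>x. f' x v)))"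

definition smooth_fun :: "('a::real_normed_vector \<Rightarrow> real) \<Rightarrow> bool" where
  "smooth_fun f \<longleftrightarrow> (\<forall>k. C_k k f)"

definition has_partial :: "'d \<Rightarrow> (real^'d \<Rightarrow> real) \<Rightarrow> real \<Rightarrow> real^'d \<Rightarrow> bool" where
  "has_partial i f D u \<longleftrightarrow> ((\<lambda>h. f (u + h *\<^sub>R axis i 1)) has_real_derivative D) (at 0)"

text \<open>The value at \<open>D\<close> of \<open>\<partial>\<^sub>t + m \<bullet> \<nabla>\<close>, where \<open>D\<close> is the total derivative of a
  function of time and space.\<close>

definition transport_op :: "real^'d \<Rightarrow> (real \<times> (real^'d) \<Rightarrow> real) \<Rightarrow> real" where
  "transport_op m D = D (1, 0) + (\<Sum>i\<in>UNIV. m $ i * D (0, axis i 1))"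

definition transport_classical ::
  "real^'d \<Rightarrow> (real^'d \<Rightarrow> real) \<Rightarrow> (real \<Rightarrow> real^'d \<Rightarrow> real) \<Rightarrow> bool" where
  "transport_classical m f \<rho> \<longleftrightarrow>
     (\<forall>t\<ge>0. torus_fun (\<rho> t)) \<and>
     (\<forall>u. \<rho> 0 u = f u) \<and>
     (\<forall>t\<ge>0. \<forall>u. \<exists>D.
        ((\<lambda>(s, v). \<rho> s v) has_derivative D) (at (t, u) within {0..} \<times> UNIV) \<and>
        transport_op m D = 0)"

text \<open>Test functions on \<open>[0, \<infinity>)\<close> times the torus: restrictions of smooth functions that
  are periodic in space and compactly supported in time.  They need not vanish at time 0, so
  that the weak formulation below contains the initial condition.\<close>

definition test_fun :: "(real \<times> (real^'d) \<Rightarrow> real) \<Rightarrow> bool" where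
  "test_fun \<phi> \<longleftrightarrow> smooth_fun \<phi> \<and> (\<forall>t. torus_fun (\<lambda>u. \<phi> (t, u))) \<and>
     (\<exists>T. \<forall>t u. \<bar>t\<bar> > T \<longrightarrow> \<phi> (t, u) = 0)"

definition transport_weak ::
  "real^'d \<Rightarrow> (real^'d \<Rightarrow> real) \<Rightarrow> (real \<Rightarrow> real^'d \<Rightarrow> real) \<Rightarrow> bool" where
  "transport_weak m f \<rho> \<longleftrightarrow>
     (\<forall>t\<ge>0. torus_fun (\<rho> t)) \<and>
     (\<forall>u. \<rho> 0 u = f u) \<and>
     (\<forall>T. set_integrable lborel ({0..T} \<times> cbox 0 1) (\<lambda>(t, u). \<rho> t u)) \<and>
     (\<forall>\<phi>. test_fun \<phi> \<longrightarrow>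
        (LINT z:{0..} \<times> cbox 0 1|lborel.
           \<rho> (fst z) (snd z) * transport_op m (frechet_derivative \<phi> (at z)))
        + (LINT u:cbox 0 1|lborel. f u * \<phi> (0, u)) = 0)"

text \<open>Classical solutions of the heat equation: of class \<open>C\<^sup>1\<^sup>,\<^sup>2\<close> at positive times and
  continuous up to time 0.\<close>

definition heat_solution ::
  "real^'d^'d \<Rightarrow> (real^'d \<Rightarrow> real) \<Rightarrow> (real \<Rightarrow> real^'d \<Rightarrow> real) \<Rightarrow> bool" where
  "heat_solution C f \<rho> \<longleftrightarrow>
     (\<forall>t\<ge>0. torus_fun (\<rho> t)) \<and>
     (\<forall>u. \<rho> 0 u = f u) \<and>
     continuous_on ({0..} \<times> UNIV) (\<lambda>(t, u). \<rho> t u) \<and>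
     (\<exists>\<rho>t \<rho>i \<rho>ij.
        continuous_on ({0<..} \<times> UNIV) (\<lambda>(t, u). \<rho>t t u) \<and>
        (\<forall>i. continuous_on ({0<..} \<times> UNIV) (\<lambda>(t, u). \<rho>i i t u)) \<and>
        (\<forall>i j. continuous_on ({0<..} \<times> UNIV) (\<lambda>(t, u). \<rho>ij i j t u)) \<and>
        (\<forall>t>0. \<forall>u.
           ((\<lambda>s. \<rho> s u) has_real_derivative \<rho>t t u) (at t) \<and>
           (\<forall>i. has_partial i (\<rho> t) (\<rho>i i t u) u) \<and>
           (\<forall>i j. has_partial i (\<rho>i j t) (\<rho>ij i j t u) u) \<and>
           \<rho>t t u = (1 / 2) * (\<Sum>i\<in>UNIV. \<Sum>j\<in>UNIV. C $ i $ j * \<rho>ij i j t u)))"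

definition gaussian_density :: "real^'d^'d \<Rightarrow> real^'d \<Rightarrow> real" where
  "gaussian_density S x =
     exp (- (x \<bullet> (matrix_inv S *v x)) / 2) / sqrt ((2 * pi) ^ CARD('d) * det S)"

end

theory Submission
  imports Defs "HOL-Real_Asymp.Real_Asymp"
begin

text \<open>A continuous periodic function is a uniform limit of trigonometric polynomials, and both the
  expectation along the walk and the limiting evolution are contractions for the supremum norm.
  Hence it suffices to follow a character of frequency \<open>\<theta>\<close>.  The number of jumps before time
  \<open>s\<close> is Poisson distributed, so the walk multiplies the character by exactly
  \<open>exp (s * (\<phi> (- \<theta> / N) - 1))\<close> with \<open>\<phi>\<close> the characteristic function of one jump,
  and a Taylor expansion of \<open>\<phi>\<close> at 0 gives the limit in both scalings.  No central limit theorem is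
  needed.  The mean occupation number itself is an expectation of the initial density along the
  walk started backwards from the site, by linearity in the independent Poisson particles.

  If the mean vanishes, irreducibility makes the covariance matrix positive definite, hence of the
  form \<open>A ** transpose A\<close>, and its Gaussian density is the image of a product of standard normal
  densities under \<open>A\<close>.  The heat equation follows by differentiating under the integral, and
  continuity down to time 0 again by uniform approximation.  For the weak transport equation the
  cell integral at time \<open>t\<close> is shifted by \<open>t *\<^sub>R m\<close>, which turns the integrand into a total time
  derivative along the characteristics.\<close>

section \<open>Lattice and torus\<close>

text \<open>Density is approximated before \<open>N\<close> tends to infinity, at a cost independent
  of \<open>N\<close> and of time, so the two limits may be interchanged and only one complex
  exponential per frequency has to converge. The frequencies are \<open>2 * pi\<close> times integer
  vectors: exactly those for which reduction modulo the torus goes unnoticed. The time scale is read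
  off from \<open>step_char\<close> near 0. Linear terms survive multiplication by \<open>N\<close>;
  when the drift vanishes they cancel exactly, for each \<open>N\<close>, and the quadratic terms
  survive multiplication by \<open>N^2\<close>. The frequency carries a minus sign because a
  particle found at \<open>y\<close> has started at \<open>y\<close> minus its displacement.

  Two degenerate spots shape the details. The number of jumps is the cardinality of a set that may
  be infinite on a null set, so non-explosion comes before the Poisson law. And at time 0 the
  Gaussian kernel concentrates, so bounds on it give nothing there; on a character, however, the
  heat flow is an explicit factor that is continuous down to time 0, and the supremum norm bound
  carries this over to every continuous density.\<close>

definition lat :: "int^'d \<Rightarrow> real^'d" where
  "lat z = (\<chi> i. of_int (z $ i))"

lemma lat_add: "lat (x + y) = lat x + lat y"
  and lat_diff: "lat (x - y) = lat x - lat y"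
  and lat_0: "lat 0 = 0"
  and lat_uminus: "lat (- x) = - lat x"
  by (simp_all add: lat_def vec_eq_iff)

lemma lat_sum: "lat (sum f A) = (\<Sum>a\<in>A. lat (f a))"
  by (induction A rule: infinite_finite_induct) (auto simp: lat_0 lat_add)

lemma macro_point_eq: "macro_point N x = lat x /\<^sub>R real N"
  by (simp add: macro_point_def lat_def vec_eq_iff divide_inverse mult.commute)

lemma torus_fun_lat: "torus_fun f \<Longrightarrow> f (u + lat k) = f u"
  by (simp add: torus_fun_def lat_def)

lemma torus_fun_lat_diff: "torus_fun f \<Longrightarrow> f (u - lat k) = f u"
  using torus_fun_lat[of f u "- k"] by (simp add: lat_uminus)

lemma torus_funI: "(\<And>u k. f (u + lat k) = f u) \<Longrightarrow> torus_fun f"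
  by (simp add: torus_fun_def lat_def)

definition floor_vec :: "real^'d \<Rightarrow> int^'d" where
  "floor_vec u = (\<chi> i. \<lfloor>u $ i\<rfloor>)"

lemma diff_floor_vec_in_cbox: "u - lat (floor_vec u) \<in> cbox 0 1"
  by (auto simp: mem_box_cart lat_def floor_vec_def less_imp_le) linarith+

lemma cis_sum: "cis (sum f A) = (\<Prod>a\<in>A. cis (f a))"
  by (induction A rule: infinite_finite_induct) (simp_all add: cis_mult[symmetric])

lemma finite_int_vec_box: "finite {k :: int^'n. \<forall>i. l i \<le> k $ i \<and> k $ i \<le> u i}"
proof -
  have "{k :: int^'n. \<forall>i. l i \<le> k $ i \<and> k $ i \<le> u i} \<subseteq> vec_lambda ` (\<Pi>\<^sub>E i\<in>UNIV. {l i..u i})"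
  proof
    fix k :: "int^'n" assume "k \<in> {k. \<forall>i. l i \<le> k $ i \<and> k $ i \<le> u i}"
    then show "k \<in> vec_lambda ` (\<Pi>\<^sub>E i\<in>UNIV. {l i..u i})"
      by (intro image_eqI[of _ _ "\<lambda>i. k $ i"]) auto
  qed
  then show ?thesis by (rule finite_subset) (intro finite_imageI finite_PiE, auto)
qed

section \<open>Density of trigonometric polynomials\<close>

text \<open>The phase \<open>b\<close> brings in the sines. Products are left out of the rules and
  derived instead, so that inductions over this class meet only cosines and linear
  operations.\<close>

inductive trig_poly :: "(real^'d \<Rightarrow> real) \<Rightarrow> bool" where
  trig_cos: "trig_poly (\<lambda>x. cos ((2 * pi) *\<^sub>R lat k \<bullet> x + b))"
| trig_add: "trig_poly f \<Longrightarrow> trig_poly g \<Longrightarrow> trig_poly (\<lambda>x. f x + g x)"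
| trig_scale: "trig_poly f \<Longrightarrow> trig_poly (\<lambda>x. c * f x)"

lemma trig_const: "trig_poly (\<lambda>x. c)"
  using trig_scale[OF trig_cos[of 0 0], of c] by (simp add: lat_0)

lemma trig_sum: "(\<And>i. i \<in> A \<Longrightarrow> trig_poly (f i)) \<Longrightarrow> trig_poly (\<lambda>x. \<Sum>i\<in>A. f i x)"
  by (induction A rule: infinite_finite_induct) (auto intro: trig_const trig_add)

text \<open>The product-to-sum formula replaces the frequencies \<open>k\<close> and
  \<open>l\<close> by \<open>k - l\<close> and \<open>k + l\<close>, which are integer vectors
  again.\<close>

lemma trig_mult_cos:
  assumes "trig_poly g"
  shows "trig_poly (\<lambda>x. cos ((2 * pi) *\<^sub>R lat k \<bullet> x + b) * g x)"
  using assms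
proof induction
  case (trig_cos l c)
  have "cos ((2 * pi) *\<^sub>R lat k \<bullet> x + b) * cos ((2 * pi) *\<^sub>R lat l \<bullet> x + c)
     = (1/2) * (cos ((2 * pi) *\<^sub>R lat (k - l) \<bullet> x + (b - c)) + cos ((2 * pi) *\<^sub>R lat (k + l) \<bullet> x + (b + c)))" for x
    by (simp add: cos_times_cos lat_add lat_diff algebra_simps)
  then show ?case
    by (simp only:) (intro trig_scale trig_add trig_poly.trig_cos)
next
  case (trig_add f g)
  from trig_poly.trig_add[OF trig_add.IH] show ?case by (simp add: algebra_simps)
next
  case (trig_scale f c)
  from trig_poly.trig_scale[OF trig_scale.IH, of c] show ?case by (simp add: algebra_simps)
qed

lemma trig_mult:
  assumes "trig_poly f" "trig_poly g"
  shows "trig_poly (\<lambda>x. f x * g x)"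
  using assms(1)
proof induction
  case (trig_cos k b)
  show ?case by (rule trig_mult_cos[OF assms(2)])
next
  case (trig_add f f')
  from trig_poly.trig_add[OF trig_add.IH] show ?case by (simp add: algebra_simps)
next
  case (trig_scale f c)
  from trig_poly.trig_scale[OF trig_scale.IH, of c] show ?case by (simp add: algebra_simps)
qed

text \<open>The torus as a compact set of tuples of unit complex numbers: there the
  Stone-Weierstrass theorem for polynomials applies, and its fibres are the cosets of the integer
  lattice.\<close>

definition torus_embedding :: "real^'d \<Rightarrow> complex^'d" where
  "torus_embedding x = (\<chi> i. cis (2 * pi * x $ i))"

lemma continuous_torus_embedding: "continuous_on S torus_embedding"
  unfolding torus_embedding_def cis_conv_exp
  by (intro continuous_intros)

lemma torus_embedding_eqD:
  assumes "torus_embedding x = torus_embedding y"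
  obtains k where "x = y + lat k"
proof -
  have "\<exists>n::int. x $ i = y $ i + n" for i
  proof -
    have "cis (2 * pi * x $ i) = cis (2 * pi * y $ i)"
      using assms by (simp add: torus_embedding_def vec_eq_iff)
    then have "sin (2 * pi * x $ i) = sin (2 * pi * y $ i) \<and> cos (2 * pi * x $ i) = cos (2 * pi * y $ i)"
      by (simp add: complex_eq_iff)
    then obtain n :: int where "2 * pi * x $ i = 2 * pi * y $ i + 2 * pi * n"
      unfolding sin_cos_eq_iff by auto
    then have "2 * pi * x $ i = 2 * pi * (y $ i + n)" by (simp add: algebra_simps)
    then have "x $ i = y $ i + n" by simp
    then show ?thesis ..
  qed
  then obtain k where "\<And>i. x $ i = y $ i + of_int (k i)" by metis
  then have "x = y + lat (\<chi> i. k i)" by (simp add: vec_eq_iff lat_def)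
  then show ?thesis by (rule that)
qed

lemma torus_embedding_periodic: "torus_embedding (x + lat k) = torus_embedding x"
proof -
  have "cis (2 * pi * (x $ i + of_int (k $ i))) = cis (2 * pi * x $ i)" for i
    by (simp add: distrib_left cis_mult[symmetric] cis_multiple_2pi)
  then show ?thesis by (simp add: torus_embedding_def vec_eq_iff lat_def)
qed

lemma trig_poly_real_polynomial:
  assumes "real_polynomial_function g"
  shows "trig_poly (\<lambda>x::real^'d. g (torus_embedding x))"
  using assms
proof induction
  case (linear f)
  interpret bounded_linear f by fact
  have ax: "axis i z = Re z *\<^sub>R axis i 1 + Im z *\<^sub>R axis i \<i>" for i :: 'd and z
    by (auto simp: axis_def vec_eq_iff complex_eq_iff)
  have latax: "lat (axis i 1) \<bullet> x = x $ i" for i :: 'd and x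
  proof -
    have "lat (axis i 1 :: int^'d) = axis i 1" by (auto simp: lat_def axis_def vec_eq_iff)
    then show ?thesis by (simp add: inner_axis')
  qed
  \<comment> \<open>A real-linear functional sees the real and imaginary part of each coordinate,
    that is a cosine and a sine; the sine is the cosine with phase
    \<open>- (pi / 2)\<close>.\<close>
  have "f (torus_embedding x) = (\<Sum>i\<in>UNIV. f (axis i 1) * cos ((2 * pi) *\<^sub>R lat (axis i 1) \<bullet> x + 0)
      + f (axis i \<i>) * cos ((2 * pi) *\<^sub>R lat (axis i 1) \<bullet> x + (- (pi / 2))))" for x :: "real^'d"
  proof -
    have "torus_embedding x = (\<Sum>i\<in>UNIV. axis i (torus_embedding x $ i))"
      by (simp add: vec_eq_iff axis_def if_distrib cong: if_cong)
    then have "f (torus_embedding x) = (\<Sum>i\<in>UNIV. f (axis i (torus_embedding x $ i)))"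
      by (metis sum)
    also have "\<dots> = (\<Sum>i\<in>UNIV. f (axis i 1) * cos (2 * pi * x $ i) + f (axis i \<i>) * sin (2 * pi * x $ i))"
      by (subst ax) (simp add: add scaleR torus_embedding_def mult.commute)
    finally show ?thesis by (simp add: latax cos_diff)
  qed
  then show ?case
    by (simp only:) (intro trig_sum trig_add trig_scale trig_cos)
qed (auto intro: trig_const trig_add trig_mult)

theorem trig_poly_dense:
  fixes f :: "real^'d \<Rightarrow> real"
  assumes per: "torus_fun f" and cont: "continuous_on UNIV f" and "e > 0"
  obtains g where "trig_poly g" "\<And>x. \<bar>f x - g x\<bar> < e"
proof -
  let ?C = "cbox 0 1 :: (real^'d) set" and ?T = "torus_embedding ` (cbox 0 1 :: (real^'d) set)"
  \<comment> \<open>The choice of a preimage is harmless: two preimages differ by a lattice vector,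
    and \<open>f\<close> is periodic.\<close>
  define h where "h z = f (SOME x. torus_embedding x = z)" for z
  have h: "h (torus_embedding x) = f x" for x
  proof -
    have "torus_embedding (SOME y. torus_embedding y = torus_embedding x) = torus_embedding x"
      by (rule someI) (rule refl)
    then show ?thesis unfolding h_def
      by (rule torus_embedding_eqD) (simp add: torus_fun_lat[OF per])
  qed
  have emb: "torus_embedding x \<in> ?T" for x :: "real^'d"
  proof -
    have "torus_embedding x = torus_embedding (x - lat (floor_vec x))"
      using torus_embedding_periodic[of "x - lat (floor_vec x)" "floor_vec x"] by simp
    then show ?thesis using diff_floor_vec_in_cbox by blast
  qed
  \<comment> \<open>A continuous map from a compact space onto a Hausdorff space is a quotient map;
    hence \<open>h\<close> inherits continuity from its composition with the embedding, which is
    \<open>f\<close>.\<close>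
  have "quotient_map (top_of_set ?C) (top_of_set ?T) torus_embedding"
    by (rule T1_Spaces.continuous_imp_quotient_map)
       (auto simp: continuous_map_in_subtopology continuous_torus_embedding
          compact_space_subtopology Hausdorff_space_subtopology)
  moreover have "continuous_map (top_of_set ?C) euclidean (h \<circ> torus_embedding)"
    using continuous_on_subset[OF cont] by (simp add: o_def h)
  ultimately have "continuous_map (top_of_set ?T) euclidean h"
    by (rule continuous_compose_quotient_map)
  then have "continuous_on ?T h" by simp
  moreover have "compact ?T"
    by (intro compact_continuous_image continuous_torus_embedding compact_cbox)
  ultimately obtain g where g: "real_polynomial_function g" "\<And>z. z \<in> ?T \<Longrightarrow> \<bar>h z - g z\<bar> < e"
    using Stone_Weierstrass_real_polynomial_function[of ?T h e] \<open>e > 0\<close> by blast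
  show ?thesis
  proof (rule that)
    show "trig_poly (\<lambda>x::real^'d. g (torus_embedding x))" by (rule trig_poly_real_polynomial[OF g(1)])
    show "\<bar>f x - g (torus_embedding x)\<bar> < e" for x
      using g(2)[OF emb[of x]] by (simp add: h)
  qed
qed

lemma trig_poly_continuous: "trig_poly f \<Longrightarrow> continuous_on S f"
  by (induction rule: trig_poly.induct) (auto intro!: continuous_intros)

section \<open>The law of the walk\<close>

text \<open>The joint law of all coordinates under a product measure is that measure itself, which
  is the criterion for independence. It serves both the waiting times and the increments.\<close>

lemma indep_vars_PiM_components:
  assumes "\<And>i. prob_space (M i)" and "I \<noteq> {}"
  shows "prob_space.indep_vars (\<Pi>\<^sub>M i\<in>I. M i) M (\<lambda>i \<omega>. \<omega> i) I"
proof -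
  interpret product_prob_space M I
    using assms by (simp add: product_prob_space_def product_sigma_finite_def prob_space_imp_sigma_finite product_prob_space_axioms_def)
  have "distr (PiM I M) (PiM I M) (\<lambda>x. \<lambda>i\<in>I. x i) = PiM I (\<lambda>i. distr (PiM I M) (M i) (\<lambda>\<omega>. \<omega> i))"
  proof -
    have "distr (PiM I M) (PiM I M) (\<lambda>x. \<lambda>i\<in>I. x i) = distr (PiM I M) (PiM I M) (\<lambda>x. x)"
      by (intro distr_cong) (auto simp: space_PiM restrict_PiE_iff PiE_restrict)
    also have "\<dots> = PiM I M" by (simp add: distr_id2)
    also have "\<dots> = PiM I (\<lambda>i. distr (PiM I M) (M i) (\<lambda>\<omega>. \<omega> i))"
      by (intro PiM_cong refl PiM_component[symmetric])
    finally show ?thesis .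
  qed
  then show ?thesis
    by (subst P.indep_vars_iff_distr_eq_PiM'[OF assms(2)]) auto
qed

section \<open>Waiting times and the Poisson law of the number of jumps\<close>

definition jump_count :: "(nat \<Rightarrow> real) \<Rightarrow> real \<Rightarrow> nat" where
  "jump_count w t = card {n. (\<Sum>i\<le>n. w i) \<le> t}"

abbreviation waiting_measure :: "(nat \<Rightarrow> real) measure" where
  "waiting_measure \<equiv> \<Pi>\<^sub>M i\<in>(UNIV :: nat set). density lborel (\<lambda>x. ennreal (exponential_density 1 x))"

lemma prob_space_exp1: "prob_space (density lborel (\<lambda>x. ennreal (exponential_density 1 x)))"
  by (rule prob_space_exponential_density) simp

lemma prob_space_waiting_measure: "prob_space waiting_measure"
  by (intro prob_space_PiM prob_space_exp1)

lemma sets_waiting_measure: "sets waiting_measure = sets (\<Pi>\<^sub>M i\<in>(UNIV :: nat set). borel)"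
  by (intro sets_PiM_cong) auto

lemma measurable_jump_count [measurable]:
  "(\<lambda>w. jump_count w t) \<in> measurable waiting_measure (count_space UNIV)"
  unfolding jump_count_def
proof (rule measurable_card)
  fix i
  have [measurable]: "(\<lambda>x. x j) \<in> borel_measurable waiting_measure" for j
    by (subst measurable_cong_sets[OF sets_waiting_measure refl]) measurable
  show "{x \<in> space waiting_measure. i \<in> {n. sum x {..n} \<le> t}} \<in> sets waiting_measure"
    by simp
qed

lemma measure_waiting_sum_le:
  assumes "t \<ge> 0"
  shows "measure waiting_measure {w \<in> space waiting_measure. (\<Sum>i\<le>n. w i) \<le> t} = erlang_CDF n 1 t"
proof -
  interpret W: prob_space waiting_measure by (rule prob_space_waiting_measure)
  have iv: "W.indep_vars (\<lambda>_. borel) (\<lambda>i \<omega>. \<omega> i) {..n}"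
  proof -
    have "W.indep_vars (\<lambda>i. density lborel (\<lambda>x. ennreal (exponential_density 1 x))) (\<lambda>i \<omega>. \<omega> i) UNIV"
      by (rule indep_vars_PiM_components) (auto intro: prob_space_exp1)
    then have "W.indep_vars (\<lambda>i. borel) (\<lambda>i \<omega>. \<omega> i) UNIV"
      unfolding W.indep_vars_def2 by (auto cong: measurable_cong_sets)
    then show ?thesis by (rule W.indep_vars_subset) auto
  qed
  have d: "distributed waiting_measure lborel (\<lambda>w. w i) (exponential_density 1)" for i
  proof -
    have "distr waiting_measure lborel (\<lambda>w. w i) = distr waiting_measure (density lborel (\<lambda>x. ennreal (exponential_density 1 x))) (\<lambda>w. w i)"
      by (intro distr_cong) auto
    also have "\<dots> = density lborel (\<lambda>x. ennreal (exponential_density 1 x))"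
      by (rule distr_PiM_component) (auto intro: prob_space_exp1)
    finally have "distr waiting_measure lborel (\<lambda>w. w i) = density lborel (\<lambda>x. ennreal (exponential_density 1 x))" .
    moreover have "(\<lambda>w. w i) \<in> borel_measurable waiting_measure"
      by (subst measurable_cong_sets[OF sets_waiting_measure refl]) measurable
    ultimately show ?thesis
      by (simp add: distributed_def)
  qed
  \<comment> \<open>The index of \<open>erlang_density\<close> is one less than the number of
    summands, and \<open>{..n}\<close> has \<open>n + 1\<close> elements.\<close>
  have "distributed waiting_measure lborel (\<lambda>w. \<Sum>i\<in>{..n}. w i) (erlang_density (card {..n} - 1) 1)"
    by (rule W.exponential_distributed_sum) (use d iv in auto)
  then have D: "distributed waiting_measure lborel (\<lambda>w. \<Sum>i\<le>n. w i) (erlang_density n 1)" by simp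
  show ?thesis using W.erlang_distributed_le[OF D _ assms] by simp
qed

lemma AE_waiting_pos: "AE w in waiting_measure. \<forall>i. 0 \<le> w i"
proof -
  have "AE w in waiting_measure. 0 \<le> w i" for i
  proof (rule AE_PiM_component)
    show "AE x in density lborel (\<lambda>x. ennreal (exponential_density 1 x)). 0 \<le> x"
      by (subst AE_density) (auto simp: exponential_density_def)
  qed (auto intro: prob_space_exp1)
  then show ?thesis by (simp add: AE_all_countable)
qed

lemma erlang_CDF_tendsto_0: 
  assumes "t \<ge> 0" shows "(\<lambda>n. erlang_CDF n 1 t) \<longlonglongrightarrow> 0"
proof -
  have "(\<lambda>n. \<Sum>k\<le>n. t^k / fact k) \<longlonglongrightarrow> exp t"
    using exp_converges[of t] by (simp add: sums_def_le divide_inverse mult.commute)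
  then have "(\<lambda>n. 1 - (\<Sum>k\<le>n. t^k / fact k) * exp (-t)) \<longlonglongrightarrow> 1 - exp t * exp (-t)"
    by (intro tendsto_intros)
  moreover have "erlang_CDF n 1 t = 1 - (\<Sum>k\<le>n. t^k / fact k) * exp (-t)" for n
    using assms by (simp add: erlang_CDF_def sum_distrib_right)
  ultimately show ?thesis by (simp add: exp_minus)
qed

text \<open>Non-explosion: staying below \<open>t\<close> forever is at most as likely as each
  \<open>erlang_CDF n 1 t\<close>, and these tend to 0. It excludes the case where
  \<open>card\<close> in \<open>jump_count\<close> meets an infinite set and returns 0.\<close>

lemma AE_waiting_unbounded:
  assumes "t \<ge> 0"
  shows "AE w in waiting_measure. \<exists>n. (\<Sum>i\<le>n. w i) > t"
proof -
  interpret W: prob_space waiting_measure by (rule prob_space_waiting_measure)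
  have [measurable]: "(\<lambda>x. x j) \<in> borel_measurable waiting_measure" for j
    by (subst measurable_cong_sets[OF sets_waiting_measure refl]) measurable
  let ?B = "{w \<in> space waiting_measure. \<forall>n. (\<Sum>i\<le>n. w i) \<le> t}"
  have [measurable]: "?B \<in> sets waiting_measure" by measurable
  have "measure waiting_measure ?B \<le> erlang_CDF n 1 t" for n
    by (subst measure_waiting_sum_le[OF assms, symmetric], rule W.finite_measure_mono) auto
  then have "measure waiting_measure ?B \<le> 0"
    by (intro LIMSEQ_le_const[OF erlang_CDF_tendsto_0[OF assms]]) auto
  then have "measure waiting_measure ?B = 0" by (simp add: measure_le_0_iff)
  then have "emeasure waiting_measure ?B = 0" by (simp add: W.emeasure_eq_measure)
  then show ?thesis
    by (subst AE_iff_null) (auto simp: null_sets_def not_less)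
qed

text \<open>Nonnegative waiting times make the set of jump indices downward closed, non-explosion
  makes it finite; so it is an initial segment, and its cardinality is its first missing
  index.\<close>

lemma AE_jump_count_gt_iff:
  assumes "t \<ge> 0"
  shows "AE w in waiting_measure. \<forall>n. n < jump_count w t \<longleftrightarrow> (\<Sum>i\<le>n. w i) \<le> t"
  using AE_waiting_pos AE_waiting_unbounded[OF assms]
proof eventually_elim
  case (elim w)
  let ?A = "{n. (\<Sum>i\<le>n. w i) \<le> t}"
  have down: "m \<in> ?A" if "n \<in> ?A" "m \<le> n" for m n
    using that sum_mono2[of "{..n}" "{..m}" w] elim(1) by auto
  obtain K where K: "K \<notin> ?A" using elim(2) by (auto simp: not_le)
  have fin: "?A \<subseteq> {..<K}" using down K by (meson lessThan_iff not_le subsetI)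
  define k where "k = (LEAST n. n \<notin> ?A)"
  have k1: "k \<notin> ?A" unfolding k_def using K by (rule LeastI)
  have "n \<in> ?A" if "n < k" for n using not_less_Least[of n "\<lambda>n. n \<notin> ?A"] that by (auto simp: k_def)
  moreover have "n < k" if "n \<in> ?A" for n using k1 down[OF that] by (meson not_le)
  ultimately have "?A = {..<k}" by blast
  then show ?case unfolding jump_count_def by (metis card_lessThan lessThan_iff mem_Collect_eq)
qed

text \<open>The event is the difference of two nested events of the form
  \<open>n < jump_count w t\<close>; subtracting consecutive Erlang distribution functions leaves a
  single Poisson weight.\<close>

lemma measure_jump_count_eq:
  assumes "t \<ge> 0"
  shows "measure waiting_measure {w \<in> space waiting_measure. jump_count w t = n} = t ^ n / fact n * exp (- t)"
proof -
  interpret W: prob_space waiting_measure by (rule prob_space_waiting_measure)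
  have [measurable]: "(\<lambda>x. x j) \<in> borel_measurable waiting_measure" for j
    by (subst measurable_cong_sets[OF sets_waiting_measure refl]) measurable
  have gt: "measure waiting_measure {w \<in> space waiting_measure. n < jump_count w t} = erlang_CDF n 1 t" for n
    unfolding measure_waiting_sum_le[OF assms, symmetric]
    by (rule W.finite_measure_eq_AE) (use AE_jump_count_gt_iff[OF assms] in auto)
  show ?thesis
  proof (cases n)
    case 0
    have "measure waiting_measure {w \<in> space waiting_measure. jump_count w t = 0}
       = 1 - measure waiting_measure {w \<in> space waiting_measure. 0 < jump_count w t}"
      by (subst W.prob_compl[symmetric]) (auto intro!: arg_cong[where f="measure waiting_measure"])
    then show ?thesis using assms by (simp add: gt 0 erlang_CDF_def)
  next
    case (Suc m)
    have "measure waiting_measure {w \<in> space waiting_measure. jump_count w t = n}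
      = measure waiting_measure ({w \<in> space waiting_measure. m < jump_count w t} - {w \<in> space waiting_measure. n < jump_count w t})"
      by (rule arg_cong[where f="measure waiting_measure"]) (auto simp: Suc)
    also have "\<dots> = erlang_CDF m 1 t - erlang_CDF n 1 t"
      by (subst W.finite_measure_Diff) (auto simp: gt Suc)
    also have "\<dots> = t ^ n / fact n * exp (- t)" using assms by (simp add: Suc erlang_CDF_def)
    finally show ?thesis .
  qed
qed

lemma distr_jump_count:
  assumes "t \<ge> 0"
  shows "distr waiting_measure (count_space UNIV) (\<lambda>w. jump_count w t)
           = density (count_space UNIV) (\<lambda>n. ennreal (t ^ n / fact n * exp (- t)))"
proof (rule measure_eqI_countable[of _ UNIV])
  interpret W: prob_space waiting_measure by (rule prob_space_waiting_measure)
  fix n :: nat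
  have "emeasure (distr waiting_measure (count_space UNIV) (\<lambda>w. jump_count w t)) {n} =
     emeasure waiting_measure {w \<in> space waiting_measure. jump_count w t = n}"
    by (subst emeasure_distr) (auto intro!: arg_cong[where f="emeasure waiting_measure"])
  also have "\<dots> = ennreal (t ^ n / fact n * exp (- t))"
    using measure_jump_count_eq[OF assms, of n] by (simp add: W.emeasure_eq_measure)
  also have "\<dots> = emeasure (density (count_space UNIV) (\<lambda>n. ennreal (t ^ n / fact n * exp (- t)))) {n}"
    by (subst emeasure_density) (auto simp: nn_integral_count_space_indicator[symmetric])
  finally show "emeasure (distr waiting_measure (count_space UNIV) (\<lambda>w. jump_count w t)) {n}
     = emeasure (density (count_space UNIV) (\<lambda>n. ennreal (t ^ n / fact n * exp (- t)))) {n}" .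
qed auto

text \<open>The generating function of the Poisson law, at complex arguments in the closed unit
  disc, where characteristic functions take their values.\<close>

lemma integral_jump_count_power:
  fixes z :: complex
  assumes "t \<ge> 0" "norm z \<le> 1"
  shows "(\<integral>w. z ^ jump_count w t \<partial>waiting_measure) = exp (t * (z - 1))"
proof -
  have sm: "summable (\<lambda>n. norm (exp (- t) * (t ^ n / fact n) * norm (z ^ n)))"
  proof (rule summable_comparison_test'[where N=0])
    show "summable (\<lambda>n. exp (- t) * (t ^ n / fact n))"
      using summable_exp[of t] by (intro summable_mult) (simp add: field_simps)
    show "norm (norm (exp (- t) * (t ^ n / fact n) * norm (z ^ n))) \<le> exp (- t) * (t ^ n / fact n)" for n
      using mult_left_mono[OF power_le_one[OF norm_ge_zero assms(2)], of "exp (- t) * (t ^ n / fact n)" n] assms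
      by (simp add: norm_power norm_mult)
  qed
  have "(\<integral>w. z ^ jump_count w t \<partial>waiting_measure)
     = (\<integral>n. z ^ n \<partial>distr waiting_measure (count_space UNIV) (\<lambda>w. jump_count w t))"
    by (subst integral_distr) auto
  also have "\<dots> = (\<integral>n. (t ^ n / fact n * exp (- t)) *\<^sub>R z ^ n \<partial>count_space UNIV)"
    unfolding distr_jump_count[OF assms(1)] using assms by (subst integral_density) auto
  also have "\<dots> = (\<Sum>n. (t ^ n / fact n * exp (- t)) *\<^sub>R z ^ n)"
    by (rule integral_count_space_nat) (use sm assms in \<open>simp add: integrable_count_space_nat_iff mult_ac norm_power abs_mult\<close>)
  also have "(\<lambda>n. (t ^ n / fact n * exp (- t)) *\<^sub>R z ^ n) = (\<lambda>n. of_real (exp (- t)) * (((of_real t * z) ^ n) /\<^sub>R fact n))"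
    by (auto simp: fun_eq_iff scaleR_conv_of_real power_mult_distrib field_simps)
  also have "(\<Sum>n. of_real (exp (- t)) * (((of_real t * z) ^ n) /\<^sub>R fact n)) = of_real (exp (-t)) * exp (of_real t * z)"
    using exp_converges[of "of_real t * z"] by (subst suminf_mult) (auto simp: sums_iff)
  also have "\<dots> = exp (t * (z - 1))"
    by (simp add: exp_of_real[symmetric] exp_add[symmetric] algebra_simps exp_diff exp_minus field_simps del: exp_of_real)
  finally show ?thesis .
qed

section \<open>The characteristic function of the displacement\<close>

abbreviation increments_measure :: "(int^'d) pmf \<Rightarrow> (nat \<Rightarrow> int^'d) measure" where
  "increments_measure p \<equiv> \<Pi>\<^sub>M i\<in>(UNIV :: nat set). measure_pmf p"

definition displacement :: "'d path_seed \<Rightarrow> real \<Rightarrow> int^'d" where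
  "displacement s t = (\<Sum>i<num_jumps s t. snd s i)"

lemma num_jumps_eq: "num_jumps s t = jump_count (fst s) t"
  by (simp add: num_jumps_def jump_count_def)

lemma prob_space_increments: "prob_space (increments_measure p)"
  by (intro prob_space_PiM prob_space_measure_pmf)

lemma prob_space_path_measure: "prob_space (path_measure p)"
  unfolding path_measure_def
  by (intro prob_space_pair prob_space_waiting_measure prob_space_increments)

text \<open>The sum is measurable for the discrete sigma-algebra by splitting over the countably
  many values of the preceding partial sum.\<close>

lemma measurable_increment_sum [measurable]:
  fixes p :: "(int^'d) pmf"
  shows "(\<lambda>x. \<Sum>i<(n::nat). x i) \<in> measurable (increments_measure p) (count_space (UNIV :: (int^'d) set))"
proof (induction n)
  case (Suc n)
  have c: "(\<lambda>x. x n) \<in> measurable (increments_measure p) (count_space UNIV)"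
    using measurable_component_singleton[of n UNIV "\<lambda>_. measure_pmf p"] by simp
  have "(\<lambda>x. (\<lambda>a x. a + x n) (\<Sum>i<n. x i) x) \<in> measurable (increments_measure p) (count_space (UNIV :: (int^'d) set))"
    by (rule measurable_compose_countable[OF _ Suc], rule measurable_compose[OF c]) simp
  then show ?case by simp
qed simp

text \<open>The number of summands is random; fixing each of its countably many values reduces to
  sums of fixed length.\<close>

lemma measurable_displacement [measurable]:
  fixes p :: "(int^'d) pmf"
  shows "(\<lambda>s. displacement s t) \<in> measurable (path_measure p) (count_space UNIV)"
proof -
  have "(\<lambda>s. (\<lambda>n s. \<Sum>i<n. snd s i) (jump_count (fst s) t) s) \<in> measurable (path_measure p) (count_space UNIV)"
    unfolding path_measure_def
    by (rule measurable_compose_countable, rule measurable_compose[OF measurable_snd measurable_increment_sum],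
        rule measurable_compose[OF measurable_fst measurable_jump_count])
  then show ?thesis by (simp add: displacement_def num_jumps_eq)
qed

definition step_char :: "(int^'d) pmf \<Rightarrow> real^'d \<Rightarrow> complex" where
  "step_char p \<theta> = (\<integral>x. cis (\<theta> \<bullet> lat x) \<partial>measure_pmf p)"

lemma norm_step_char_le: "norm (step_char p \<theta>) \<le> 1"
proof -
  have "norm (step_char p \<theta>) \<le> (\<integral>x. norm (cis (\<theta> \<bullet> lat x)) \<partial>measure_pmf p)"
    unfolding step_char_def by (rule integral_norm_bound)
  then show ?thesis by simp
qed

lemma integral_increment_sum_char:
  "(\<integral>x. cis (\<theta> \<bullet> lat (\<Sum>i<n. x i)) \<partial>increments_measure p) = step_char p \<theta> ^ n"
proof -
  interpret X: prob_space "increments_measure p" by (rule prob_space_increments)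
  have "X.indep_vars (\<lambda>i. measure_pmf p) (\<lambda>i \<omega>. \<omega> i) UNIV"
    by (rule indep_vars_PiM_components) (auto intro: prob_space_measure_pmf)
  then have "X.indep_vars (\<lambda>i. measure_pmf p) (\<lambda>i \<omega>. \<omega> i) {..<n}"
    by (rule X.indep_vars_subset) auto
  then have iv: "X.indep_vars (\<lambda>_. borel) (\<lambda>i \<omega>. cis (\<theta> \<bullet> lat (\<omega> i))) {..<n}"
    by (rule X.indep_vars_compose2[where Y="\<lambda>i z. cis (\<theta> \<bullet> lat z)"]) auto
  have m: "(\<lambda>\<omega>. cis (\<theta> \<bullet> lat (\<omega> i))) \<in> borel_measurable (increments_measure p)" for i
    using measurable_compose[OF measurable_component_singleton[of i UNIV "\<lambda>_. measure_pmf p"], of "\<lambda>z. cis (\<theta> \<bullet> lat z)" borel]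
    by simp
  have "(\<integral>x. cis (\<theta> \<bullet> lat (\<Sum>i<n. x i)) \<partial>increments_measure p)
      = (\<integral>x. (\<Prod>i<n. cis (\<theta> \<bullet> lat (x i))) \<partial>increments_measure p)"
    by (simp add: lat_sum inner_sum_right cis_sum)
  also have "\<dots> = (\<Prod>i<n. \<integral>x. cis (\<theta> \<bullet> lat (x i)) \<partial>increments_measure p)"
    by (rule X.indep_vars_lebesgue_integral[OF _ iv]) (auto intro!: X.integrable_const_bound[of _ 1] m)
  also have "(\<Prod>i<n. \<integral>x. cis (\<theta> \<bullet> lat (x i)) \<partial>increments_measure p) = step_char p \<theta> ^ n"
  proof -
    have "(\<integral>x. cis (\<theta> \<bullet> lat (x i)) \<partial>increments_measure p) = step_char p \<theta>" for i
    proof -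
      have "step_char p \<theta> = (\<integral>z. cis (\<theta> \<bullet> lat z) \<partial>distr (increments_measure p) (measure_pmf p) (\<lambda>x. x i))"
        unfolding step_char_def
        by (subst distr_PiM_component) (auto intro: prob_space_measure_pmf)
      then show ?thesis by (subst (asm) integral_distr) auto
    qed
    then have "(\<Prod>i<n. \<integral>x. cis (\<theta> \<bullet> lat (x i)) \<partial>increments_measure p) = step_char p \<theta> ^ n" by simp
    then show ?thesis .
  qed
  finally show ?thesis .
qed

text \<open>The displacement is a compound Poisson variable. Integrating over the increments with
  the waiting times frozen gives \<open>step_char\<close> to the power of the jump count, and the
  generating function does the rest.\<close>

lemma integral_displacement_char:
  assumes "t \<ge> 0"
  shows "(\<integral>s. cis (\<theta> \<bullet> lat (displacement s t)) \<partial>path_measure p) = exp (t * (step_char p \<theta> - 1))"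
proof -
  interpret W: prob_space waiting_measure by (rule prob_space_waiting_measure)
  interpret X: prob_space "increments_measure p" by (rule prob_space_increments)
  interpret P: pair_prob_space waiting_measure "increments_measure p" ..
  let ?f = "\<lambda>s. cis (\<theta> \<bullet> lat (displacement s t))"
  have "?f \<in> borel_measurable (path_measure p)"
    by (rule measurable_compose[OF measurable_displacement]) simp
  then have "integrable (path_measure p) ?f"
    unfolding path_measure_def by (intro P.integrable_const_bound[of _ 1]) auto
  then have "integral\<^sup>L (path_measure p) ?f = (\<integral>w. \<integral>x. ?f (w, x) \<partial>increments_measure p \<partial>waiting_measure)"
    unfolding path_measure_def by (rule P.integral_fst'[symmetric])
  also have "\<dots> = (\<integral>w. step_char p \<theta> ^ jump_count w t \<partial>waiting_measure)"
    by (simp add: displacement_def num_jumps_eq integral_increment_sum_char)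
  also have "\<dots> = exp (t * (step_char p \<theta> - 1))"
    by (rule integral_jump_count_power[OF assms norm_step_char_le])
  finally show ?thesis .
qed

lemma walk_pos_eq: "walk_pos N x s t = torus_proj N (x + displacement s t)"
  by (simp add: walk_pos_def displacement_def)

lemma measurable_walk_pos [measurable]:
  fixes p :: "(int^'d) pmf"
  shows "(\<lambda>s. walk_pos N x s t) \<in> measurable (path_measure p) (count_space UNIV)"
  unfolding walk_pos_eq by (rule measurable_compose[OF measurable_displacement]) simp

section \<open>Finiteness of the discrete torus and the mean of the Poisson law\<close>

lemma finite_torus_sites: "finite (torus_sites N :: (int^'d) set)"
  by (rule finite_subset[OF _ finite_int_vec_box[of "\<lambda>_. 0" "\<lambda>_. int N"]])
     (auto simp: torus_sites_def less_imp_le)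

lemma nn_integral_poisson_law:
  assumes "r \<ge> 0"
  shows "(\<integral>\<^sup>+k. of_nat k \<partial>measure_pmf (poisson_law r)) = ennreal r"
proof (cases "r > 0")
  case True
  have "(\<integral>\<^sup>+k. of_nat k \<partial>measure_pmf (poisson_pmf r)) = (\<integral>\<^sup>+k. ennreal (r ^ k / fact k * exp (- r)) * of_nat k \<partial>count_space UNIV)"
    unfolding nn_integral_measure_pmf using True by (intro nn_integral_cong) simp
  also have "\<dots> = (\<Sum>k. ennreal (r ^ k / fact k * exp (- r) * of_nat k))"
    unfolding nn_integral_count_space_nat
    using True by (intro suminf_cong, subst ennreal_mult) (simp_all add: ennreal_of_nat_eq_real_of_nat)
  also have "\<dots> = ennreal r"
  proof (rule suminf_ennreal_eq)
    show "0 \<le> r ^ k / fact k * exp (- r) * of_nat k" for k using True by simp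
    \<comment> \<open>The term for \<open>k = 0\<close> vanishes and the factor \<open>k\<close>
      cancels in \<open>fact k\<close>, so the series for the mean is the exponential series shifted
      by one index.\<close>
    have "(\<lambda>k. (r * exp (- r)) * (r ^ k /\<^sub>R fact k)) sums ((r * exp (- r)) * exp r)"
      by (rule sums_mult, rule exp_converges)
    moreover have "(r * exp (- r)) * (r ^ k /\<^sub>R fact k) = r ^ Suc k / fact (Suc k) * exp (- r) * of_nat (Suc k)" for k
      by (simp add: divide_simps mult_ac del: of_nat_Suc)
    moreover have "(r * exp (- r)) * exp r = r" by (simp add: mult.assoc flip: exp_add)
    ultimately have "(\<lambda>k. r ^ Suc k / fact (Suc k) * exp (- r) * of_nat (Suc k)) sums r" by (simp only:)
    from sums_Suc_imp[OF _ this] show "(\<lambda>k. r ^ k / fact k * exp (- r) * of_nat k) sums r"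
      by simp
  qed
  finally show ?thesis using True by (simp add: poisson_law_def)
next
  case False
  then have "r = 0" using assms by simp
  then show ?thesis by (simp add: poisson_law_def)
qed

section \<open>Mean occupation numbers\<close>

lemma torus_sites_proj: "N > 0 \<Longrightarrow> torus_proj N x \<in> torus_sites N"
  by (simp add: torus_proj_def torus_sites_def)

text \<open>Time reversal on the torus: for a given displacement the end point determines the
  starting point. This turns a sum over starting sites into one walk run backwards.\<close>

lemma torus_proj_eq_iff:
  assumes "N > 0" "x \<in> torus_sites N" "y \<in> torus_sites N"
  shows "torus_proj N (x + z) = y \<longleftrightarrow> x = torus_proj N (y - z)"
proof -
  have "(a + c) mod int N = b \<longleftrightarrow> a = (b - c) mod int N"
    if "0 \<le> a" "a < int N" "0 \<le> b" "b < int N" for a b c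
  proof
    assume "(a + c) mod int N = b"
    then have "(b - c) mod int N = (a + c - c) mod int N" by (metis mod_diff_left_eq)
    then show "a = (b - c) mod int N" using that by simp
  next
    assume "a = (b - c) mod int N"
    then have "(a + c) mod int N = (b - c + c) mod int N" by (metis mod_add_left_eq)
    then show "(a + c) mod int N = b" using that by simp
  qed
  then show ?thesis
    using assms(2,3) by (auto simp: torus_proj_def torus_sites_def vec_eq_iff)
qed

lemma torus_fun_macro_proj:
  assumes "torus_fun f" "N > 0"
  shows "f (macro_point N (torus_proj N x)) = f (macro_point N x)"
proof -
  define k :: "int^'a" where "k = (\<chi> i. x $ i div int N)"
  have "macro_point N (torus_proj N x) + (\<chi> i. of_int (k $ i)) = macro_point N x"
  proof (simp add: vec_eq_iff macro_point_def torus_proj_def k_def, intro allI)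
    fix i
    have "real_of_int (x $ i) = of_int (x $ i mod int N) + of_int (x $ i div int N) * real N"
      by (metis mod_div_mult_eq of_int_add of_int_mult of_int_of_nat_eq)
    then show "real_of_int (x $ i mod int N) / real N + of_int (x $ i div int N) = real_of_int (x $ i) / real N"
      using assms(2) by (simp add: field_simps)
  qed
  then show ?thesis using assms(1) unfolding torus_fun_def by metis
qed

lemma card_less_eq_sum_indicator:
  "of_nat (card {k. k < (n::nat) \<and> P k}) = (\<Sum>k<n. indicator {k. P k} k :: ennreal)"
proof -
  have "{k. k < n \<and> P k} = {..<n} \<inter> {k. P k}" by auto
  then show ?thesis by (simp add: sum.inter_restrict indicator_def)
qed

text \<open>Initial numbers and particle seeds are independent, so the mean number arriving from a
  site is its mean initial number times one arrival probability. Nonnegative integrals permit every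
  exchange before any integrability is known.\<close>

lemma mean_occupation_eq_sum:
  fixes p :: "(int^'d) pmf"
  assumes "\<And>u. \<rho>\<^sub>0 u \<ge> 0"
  shows "mean_occupation p \<rho>\<^sub>0 N t y =
    (\<Sum>x\<in>torus_sites N. \<rho>\<^sub>0 (macro_point N x) * measure (path_measure p) {s \<in> space (path_measure p). walk_pos N x s t = y})"
proof -
  let ?J = "torus_sites N \<times> (UNIV :: nat set) :: ((int^'d) \<times> nat) set"
  let ?S = "\<Pi>\<^sub>M a\<in>?J. path_measure p"
  let ?I = "init_measure \<rho>\<^sub>0 N"
  interpret I: prob_space ?I unfolding init_measure_def by (intro prob_space_PiM prob_space_measure_pmf)
  interpret S: prob_space ?S by (intro prob_space_PiM prob_space_path_measure)
  interpret P: pair_prob_space ?I ?S ..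
  interpret Pa: prob_space "path_measure p" by (rule prob_space_path_measure)
  let ?q = "\<lambda>x. emeasure (path_measure p) {s \<in> space (path_measure p). walk_pos N x s t = y}"
  let ?g = "\<lambda>x \<sigma> k. indicator {k. walk_pos N x (\<sigma> (x, k)) t = y} k :: ennreal"
  have wm: "(\<lambda>\<sigma>. walk_pos N x (\<sigma> (x, k)) t) \<in> measurable ?S (count_space UNIV)" if "x \<in> torus_sites N" for x k
    using measurable_compose[OF measurable_component_singleton[of "(x, k)" ?J "\<lambda>_. path_measure p"] measurable_walk_pos[of N x t p]] that by simp
  have gm: "(\<lambda>\<sigma>. ?g x \<sigma> k) \<in> borel_measurable ?S" if "x \<in> torus_sites N" for x k
    using measurable_compose[OF wm[OF that], of "\<lambda>z. indicator {y} z" borel k]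
    by (simp add: indicator_def)
  have im: "(\<lambda>\<eta>. \<eta> x) \<in> measurable ?I (count_space UNIV)" if "x \<in> torus_sites N" for x
    using measurable_component_singleton[OF that, of "\<lambda>x. measure_pmf (poisson_law (\<rho>\<^sub>0 (macro_point N x)))"]
    by (simp add: init_measure_def)
  have occ: "of_nat (occupation N \<omega> t y) = (\<Sum>x\<in>torus_sites N. \<Sum>k<fst \<omega> x. ?g x (snd \<omega>) k)" for \<omega>
    by (simp add: occupation_def card_less_eq_sum_indicator[symmetric])
  have fm: "(\<lambda>\<omega>. \<Sum>x\<in>torus_sites N. \<Sum>k<fst \<omega> x. ?g x (snd \<omega>) k) \<in> borel_measurable (?I \<Otimes>\<^sub>M ?S)"
  proof (rule borel_measurable_sum)
    fix x :: "int^'d" assume x: "x \<in> torus_sites N"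
    \<comment> \<open>The upper limit of the inner sum is itself random; measurability follows from
      that of the sums with each fixed limit.\<close>
    show "(\<lambda>\<omega>. \<Sum>k<fst \<omega> x. ?g x (snd \<omega>) k) \<in> borel_measurable (?I \<Otimes>\<^sub>M ?S)"
      by (rule measurable_compose_countable[where f="\<lambda>n \<omega>. \<Sum>k<n. ?g x (snd \<omega>) k" and g="\<lambda>\<omega>. fst \<omega> x"])
         (auto intro!: borel_measurable_sum measurable_compose[OF measurable_snd gm[OF x]] measurable_compose[OF measurable_fst im[OF x]])
  qed
  have inner: "(\<integral>\<^sup>+\<sigma>. ?g x \<sigma> k \<partial>?S) = ?q x" if x: "x \<in> torus_sites N" for x k
  proof -
    have "(\<integral>\<^sup>+\<sigma>. ?g x \<sigma> k \<partial>?S) = (\<integral>\<^sup>+s. indicator {y} (walk_pos N x s t) \<partial>distr ?S (path_measure p) (\<lambda>\<sigma>. \<sigma> (x, k)))"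
      using x by (subst nn_integral_distr) (auto simp: indicator_def intro!: measurable_compose[OF measurable_walk_pos])
    also have "distr ?S (path_measure p) (\<lambda>\<sigma>. \<sigma> (x, k)) = path_measure p"
      using x by (intro distr_PiM_component prob_space_path_measure) auto
    also have "(\<integral>\<^sup>+s. indicator {y} (walk_pos N x s t) \<partial>path_measure p) = (\<integral>\<^sup>+s. indicator {s \<in> space (path_measure p). walk_pos N x s t = y} s \<partial>path_measure p)"
      by (intro nn_integral_cong) (auto simp: indicator_def)
    also have "\<dots> = ?q x" by (rule nn_integral_indicator) measurable
    finally show ?thesis .
  qed
  have init: "(\<integral>\<^sup>+\<eta>. of_nat (\<eta> x) \<partial>?I) = ennreal (\<rho>\<^sub>0 (macro_point N x))" if x: "x \<in> torus_sites N" for x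
  proof -
    have "(\<integral>\<^sup>+\<eta>. of_nat (\<eta> x) \<partial>?I) = (\<integral>\<^sup>+k. of_nat k \<partial>distr ?I (measure_pmf (poisson_law (\<rho>\<^sub>0 (macro_point N x)))) (\<lambda>\<eta>. \<eta> x))"
      using x by (subst nn_integral_distr) (auto simp: init_measure_def)
    also have "distr ?I (measure_pmf (poisson_law (\<rho>\<^sub>0 (macro_point N x)))) (\<lambda>\<eta>. \<eta> x) = measure_pmf (poisson_law (\<rho>\<^sub>0 (macro_point N x)))"
      unfolding init_measure_def by (rule distr_PiM_component) (auto intro: x prob_space_measure_pmf)
    finally show ?thesis using assms by (simp add: nn_integral_poisson_law)
  qed
  have "(\<integral>\<^sup>+\<omega>. of_nat (occupation N \<omega> t y) \<partial>system_measure p \<rho>\<^sub>0 N)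
     = (\<integral>\<^sup>+\<eta>. \<integral>\<^sup>+\<sigma>. (\<Sum>x\<in>torus_sites N. \<Sum>k<\<eta> x. ?g x \<sigma> k) \<partial>?S \<partial>?I)"
    unfolding system_measure_def occ using S.nn_integral_fst[OF fm] by simp
  also have "\<dots> = (\<integral>\<^sup>+\<eta>. (\<Sum>x\<in>torus_sites N. of_nat (\<eta> x) * ?q x) \<partial>?I)"
  proof (rule nn_integral_cong)
    fix \<eta> :: "int^'d \<Rightarrow> nat"
    have "(\<integral>\<^sup>+\<sigma>. (\<Sum>x\<in>torus_sites N. \<Sum>k<\<eta> x. ?g x \<sigma> k) \<partial>?S) = (\<Sum>x\<in>torus_sites N. \<integral>\<^sup>+\<sigma>. (\<Sum>k<\<eta> x. ?g x \<sigma> k) \<partial>?S)"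
      by (rule nn_integral_sum) (intro borel_measurable_sum gm)
    also have "\<dots> = (\<Sum>x\<in>torus_sites N. \<Sum>k<\<eta> x. \<integral>\<^sup>+\<sigma>. ?g x \<sigma> k \<partial>?S)"
      by (intro sum.cong refl nn_integral_sum gm)
    also have "\<dots> = (\<Sum>x\<in>torus_sites N. of_nat (\<eta> x) * ?q x)"
      by (intro sum.cong refl) (simp add: inner)
    finally show "(\<integral>\<^sup>+\<sigma>. (\<Sum>x\<in>torus_sites N. \<Sum>k<\<eta> x. ?g x \<sigma> k) \<partial>?S) = (\<Sum>x\<in>torus_sites N. of_nat (\<eta> x) * ?q x)" .
  qed
  also have "\<dots> = (\<Sum>x\<in>torus_sites N. \<integral>\<^sup>+\<eta>. of_nat (\<eta> x) * ?q x \<partial>?I)"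
    by (rule nn_integral_sum) (intro borel_measurable_times measurable_compose[OF im], auto)
  also have "\<dots> = (\<Sum>x\<in>torus_sites N. ennreal (\<rho>\<^sub>0 (macro_point N x)) * ?q x)"
    by (intro sum.cong refl) (subst nn_integral_multc, auto simp: init intro!: measurable_compose[OF im])
  also have "\<dots> = ennreal (\<Sum>x\<in>torus_sites N. \<rho>\<^sub>0 (macro_point N x) * measure (path_measure p) {s \<in> space (path_measure p). walk_pos N x s t = y})"
    using assms by (simp add: Pa.emeasure_eq_measure ennreal_mult'[symmetric])
  finally have *: "(\<integral>\<^sup>+\<omega>. ennreal (real (occupation N \<omega> t y)) \<partial>system_measure p \<rho>\<^sub>0 N) =
     ennreal (\<Sum>x\<in>torus_sites N. \<rho>\<^sub>0 (macro_point N x) * measure (path_measure p) {s \<in> space (path_measure p). walk_pos N x s t = y})"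
    by (simp add: ennreal_of_nat_eq_real_of_nat)
  have "(\<lambda>\<omega>. of_nat (occupation N \<omega> t y) :: ennreal) \<in> borel_measurable (system_measure p \<rho>\<^sub>0 N)"
    unfolding occ system_measure_def by (rule fm)
  then have "(\<lambda>\<omega>. enn2real (of_nat (occupation N \<omega> t y))) \<in> borel_measurable (system_measure p \<rho>\<^sub>0 N)"
    by (rule borel_measurable_enn2real)
  then have "(\<lambda>\<omega>. real (occupation N \<omega> t y)) \<in> borel_measurable (system_measure p \<rho>\<^sub>0 N)"
    by (simp add: ennreal_of_nat_eq_real_of_nat)
  then show ?thesis unfolding mean_occupation_def
    by (subst integral_eq_nn_integral) (auto simp: * assms sum_nonneg)
qed

text \<open>Under the integral, for a fixed path, exactly one starting site leads to the target, so
  the sum over sites has a single nonzero indicator. Periodicity of the density then removes the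
  reduction modulo \<open>N\<close>.\<close>

lemma mean_occupation_eq_expectation:
  fixes p :: "(int^'d) pmf"
  assumes "torus_fun \<rho>\<^sub>0" "\<And>u. \<rho>\<^sub>0 u \<ge> 0" and N: "N > 0"
  shows "mean_occupation p \<rho>\<^sub>0 N t (torus_proj N y) =
    (\<integral>s. \<rho>\<^sub>0 (macro_point N (y - displacement s t)) \<partial>path_measure p)"
proof -
  interpret Pa: prob_space "path_measure p" by (rule prob_space_path_measure)
  let ?y = "torus_proj N y"
  have y: "?y \<in> torus_sites N" using N by (rule torus_sites_proj)
  have "mean_occupation p \<rho>\<^sub>0 N t ?y =
     (\<Sum>x\<in>torus_sites N. \<integral>s. \<rho>\<^sub>0 (macro_point N x) * indicator {s \<in> space (path_measure p). walk_pos N x s t = ?y} s \<partial>path_measure p)"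
    unfolding mean_occupation_eq_sum[OF assms(2)]
    by (intro sum.cong refl) simp
  also have "\<dots> = (\<integral>s. (\<Sum>x\<in>torus_sites N. \<rho>\<^sub>0 (macro_point N x) * indicator {s \<in> space (path_measure p). walk_pos N x s t = ?y} s) \<partial>path_measure p)"
    by (rule Bochner_Integration.integral_sum[symmetric], rule integrable_mult_right, rule integrable_real_indicator)
       (simp_all add: Pa.emeasure_eq_measure)
  also have "\<dots> = (\<integral>s. \<rho>\<^sub>0 (macro_point N (y - displacement s t)) \<partial>path_measure p)"
  proof (rule Bochner_Integration.integral_cong[OF refl])
    fix s assume s: "s \<in> space (path_measure p)"
    let ?x = "torus_proj N (?y - displacement s t)"
    have "(\<Sum>x\<in>torus_sites N. \<rho>\<^sub>0 (macro_point N x) * indicator {s \<in> space (path_measure p). walk_pos N x s t = ?y} s)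
       = (\<Sum>x\<in>torus_sites N. if x = ?x then \<rho>\<^sub>0 (macro_point N x) else 0)"
      by (intro sum.cong refl) (simp add: s walk_pos_eq torus_proj_eq_iff[OF N _ y] indicator_def)
    also have "\<dots> = \<rho>\<^sub>0 (macro_point N ?x)"
      using torus_sites_proj[OF N, of "?y - displacement s t"] by (simp add: finite_torus_sites)
    also have "torus_proj N (?y - displacement s t) = torus_proj N (y - displacement s t)"
      by (simp add: torus_proj_def vec_eq_iff mod_diff_left_eq)
    finally show "(\<Sum>x\<in>torus_sites N. \<rho>\<^sub>0 (macro_point N x) * indicator {s \<in> space (path_measure p). walk_pos N x s t = ?y} s)
       = \<rho>\<^sub>0 (macro_point N (y - displacement s t))" by (simp add: torus_fun_macro_proj[OF assms(1) N])
  qed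
  finally show ?thesis .
qed

section \<open>Linear changes of variables and Gaussian integrals\<close>

lemma Basis_vec_eq: "(Basis :: (real^'n) set) = range (\<lambda>i. axis i 1)"
  by (auto simp: Basis_vec_def)

lemma inj_axis: "inj (\<lambda>i::'n::finite. axis i (1::real))"
  by (auto simp: inj_on_def axis_eq_axis)

lemma prod_Basis_vec: "(\<Prod>b\<in>(Basis :: (real^'n) set). f b) = (\<Prod>i\<in>UNIV. f (axis i 1))"
  unfolding Basis_vec_eq by (subst prod.reindex[OF inj_axis]) simp

lemma sum_Basis_vec: "(\<Sum>b\<in>(Basis :: (real^'n) set). f b) = (\<Sum>i\<in>UNIV. f (axis i 1))"
  unfolding Basis_vec_eq by (subst sum.reindex[OF inj_axis]) simp

lemma box_vec: "box l u = {x :: real^'n. \<forall>i. l $ i < x $ i \<and> x $ i < u $ i}"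
  by (auto simp: mem_box_cart)

lemma emeasure_lborel_box_vec:
  assumes "\<And>i. l $ i \<le> u $ i"
  shows "emeasure lborel (box l u :: (real^'n) set) = ennreal (\<Prod>i\<in>UNIV. u $ i - l $ i)"
proof -
  have "emeasure lborel (box l u) = ennreal (\<Prod>b\<in>Basis. (u - l) \<bullet> b)"
    by (rule emeasure_lborel_box) (use assms in \<open>auto simp: Basis_vec_def inner_axis\<close>)
  then show ?thesis by (simp add: prod_Basis_vec inner_axis)
qed

lemma lborel_vec_eqI:
  fixes M :: "(real^'n) measure"
  assumes "\<And>l u. (\<And>i. l $ i \<le> u $ i) \<Longrightarrow> emeasure M (box l u) = ennreal (\<Prod>i\<in>UNIV. u $ i - l $ i)"
    and "sets M = sets borel"
  shows "lborel = M"
proof (rule lborel_eqI)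
  fix l u :: "real^'n" assume le: "\<And>b. b \<in> Basis \<Longrightarrow> l \<bullet> b \<le> u \<bullet> b"
  have "l $ i \<le> u $ i" for i using le[of "axis i 1"] by (simp add: Basis_vec_eq inner_axis)
  then show "emeasure M (box l u) = ennreal (\<Prod>b\<in>Basis. (u - l) \<bullet> b)"
    by (simp add: assms(1) prod_Basis_vec inner_axis)
qed (rule assms)

lemma borel_measurable_vecI:
  assumes "\<And>i. (\<lambda>x. f x $ i) \<in> borel_measurable M"
  shows "(f :: 'a \<Rightarrow> real^'n) \<in> borel_measurable M"
  by (subst borel_measurable_euclidean_space) (auto simp: Basis_vec_def inner_axis assms)

lemma measurable_vec_lambda_PiM: "vec_lambda \<in> borel_measurable (\<Pi>\<^sub>M i\<in>(UNIV :: 'n::finite set). lborel :: real measure)"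
  using measurable_component_singleton[of _ UNIV "\<lambda>_::'n. lborel :: real measure"]
  by (intro borel_measurable_vecI) simp

text \<open>In this form Fubini can single out one coordinate, and integrals of products over the
  coordinates factor.\<close>

lemma lborel_vec_eq_PiM:
  "lborel = distr (\<Pi>\<^sub>M i\<in>(UNIV :: 'n::finite set). lborel :: real measure) borel vec_lambda"
proof (rule lborel_vec_eqI)
  interpret product_sigma_finite "\<lambda>_::'n. lborel :: real measure" ..
  fix l u :: "real^'n" assume le: "\<And>i. l $ i \<le> u $ i"
  have eq: "vec_lambda -` box l u \<inter> space (\<Pi>\<^sub>M i\<in>UNIV. lborel) = (\<Pi>\<^sub>E i\<in>UNIV. {l $ i<..<u $ i})"
    by (auto simp: mem_box_cart space_PiM PiE_iff)
  show "emeasure (distr (\<Pi>\<^sub>M i\<in>UNIV. lborel) borel vec_lambda) (box l u) = ennreal (\<Prod>i\<in>UNIV. u $ i - l $ i)"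
    by (subst emeasure_distr[OF measurable_vec_lambda_PiM])
       (simp_all add: eq emeasure_PiM le prod_ennreal)
qed simp

lemma nn_integral_lborel_vec:
  fixes h :: "real^'n \<Rightarrow> ennreal"
  assumes "h \<in> borel_measurable borel"
  shows "(\<integral>\<^sup>+x. h x \<partial>lborel) = (\<integral>\<^sup>+f. h (vec_lambda f) \<partial>(\<Pi>\<^sub>M i\<in>UNIV. lborel))"
  by (subst lborel_vec_eq_PiM, subst nn_integral_distr[OF measurable_vec_lambda_PiM]) (use assms in simp_all)

lemma measurable_matrix_vector_mult [measurable]:
  "(*v) A \<in> borel_measurable (borel :: (real^'n) measure)"
  by (intro borel_measurable_continuous_onI matrix_vector_mult_linear_continuous_on)

lemma nn_integral_shear:
  fixes h :: "real^'n \<Rightarrow> ennreal"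
  assumes "m \<noteq> n" and [measurable]: "h \<in> borel_measurable borel"
  shows "(\<integral>\<^sup>+x. h (\<chi> i. if i = m then x $ m + c * x $ n else x $ i) \<partial>lborel) = (\<integral>\<^sup>+x. h x \<partial>lborel)"
proof -
  interpret product_sigma_finite "\<lambda>_::'n. lborel :: real measure" ..
  have ins: "UNIV = insert m (UNIV - {m})" by auto
  have fub: "(\<integral>\<^sup>+x. g x \<partial>lborel) = (\<integral>\<^sup>+f. (\<integral>\<^sup>+y. g (vec_lambda (f(m := y))) \<partial>lborel) \<partial>(\<Pi>\<^sub>M i\<in>UNIV - {m}. lborel))"
    if [measurable]: "g \<in> borel_measurable borel" for g :: "real^'n \<Rightarrow> ennreal"
  proof -
    have mg: "(\<lambda>f. g (vec_lambda f)) \<in> borel_measurable (\<Pi>\<^sub>M i\<in>insert m (UNIV - {m}). lborel)"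
      unfolding ins[symmetric] by (rule measurable_compose[OF measurable_vec_lambda_PiM that])
    show ?thesis
      unfolding nn_integral_lborel_vec[OF that]
      by (subst ins, subst product_nn_integral_insert[OF _ _ mg]) auto
  qed
  have lin: "linear (\<lambda>x::real^'n. \<chi> i. if i = m then x $ m + c * x $ n else x $ i)"
    by (rule linearI) (auto simp: vec_eq_iff algebra_simps)
  have [measurable]: "(\<lambda>x::real^'n. \<chi> i. if i = m then x $ m + c * x $ n else x $ i) \<in> borel_measurable borel"
    by (intro borel_measurable_continuous_onI linear_continuous_on) (simp add: linear_linear lin)
  have "(\<integral>\<^sup>+x. h (\<chi> i. if i = m then x $ m + c * x $ n else x $ i) \<partial>lborel)
     = (\<integral>\<^sup>+f. (\<integral>\<^sup>+y. h (vec_lambda (f(m := c * f n + y))) \<partial>lborel) \<partial>(\<Pi>\<^sub>M i\<in>UNIV - {m}. lborel))"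
    by (subst fub) (use \<open>m \<noteq> n\<close> in \<open>auto intro!: nn_integral_cong arg_cong[where f=h] simp: vec_eq_iff add.commute\<close>)
  also have "\<dots> = (\<integral>\<^sup>+f. (\<integral>\<^sup>+y. h (vec_lambda (f(m := y))) \<partial>lborel) \<partial>(\<Pi>\<^sub>M i\<in>UNIV - {m}. lborel))"
  proof (rule nn_integral_cong)
    fix f :: "'n \<Rightarrow> real"
    have "(\<lambda>y. vec_lambda (f(m := y))) \<in> borel_measurable borel"
      by (rule borel_measurable_vecI) auto
    then have "(\<lambda>y. h (vec_lambda (f(m := y)))) \<in> borel_measurable borel" by measurable
    from nn_integral_real_affine[OF this, of 1 "c * f n"]
    show "(\<integral>\<^sup>+y. h (vec_lambda (f(m := c * f n + y))) \<partial>lborel) = (\<integral>\<^sup>+y. h (vec_lambda (f(m := y))) \<partial>lborel)"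
      by simp
  qed
  also have "\<dots> = (\<integral>\<^sup>+x. h x \<partial>lborel)" by (rule fub[symmetric]) measurable
  finally show ?thesis .
qed

lemma nn_integral_permute:
  fixes h :: "real^'n \<Rightarrow> ennreal"
  assumes p: "p permutes UNIV" and [measurable]: "h \<in> borel_measurable borel"
  shows "(\<integral>\<^sup>+x. h (\<chi> i. x $ p i) \<partial>lborel) = (\<integral>\<^sup>+x. h x \<partial>lborel)"
proof -
  let ?T = "\<lambda>x::real^'n. \<chi> i. x $ p i"
  have [measurable]: "?T \<in> borel_measurable borel"
    by (intro borel_measurable_continuous_onI continuous_intros)
  have "lborel = distr lborel borel ?T"
  proof (rule lborel_vec_eqI)
    fix l u :: "real^'n" assume le: "\<And>i. l $ i \<le> u $ i"
    have "?T -` box l u = box (\<chi> i. l $ inv p i) (\<chi> i. u $ inv p i)"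
      unfolding box_vec using permutes_inverses[OF p] by (auto simp: vimage_def) metis+
    then have "emeasure (distr lborel borel ?T) (box l u) = (\<Prod>i\<in>UNIV. u $ inv p i - l $ inv p i)"
      by (simp add: emeasure_distr emeasure_lborel_box_vec le)
    also have "(\<Prod>i\<in>UNIV. u $ inv p i - l $ inv p i) = (\<Prod>i\<in>UNIV. u $ i - l $ i)"
      using prod.permute[OF permutes_inv[OF p], of "\<lambda>i. u $ i - l $ i"] by (simp add: o_def)
    finally show "emeasure (distr lborel borel ?T) (box l u) = ennreal (\<Prod>i\<in>UNIV. u $ i - l $ i)" .
  qed simp
  then have "(\<integral>\<^sup>+x. h x \<partial>lborel) = (\<integral>\<^sup>+x. h x \<partial>distr lborel borel ?T)" by simp
  also have "\<dots> = (\<integral>\<^sup>+x. h (?T x) \<partial>lborel)" by (rule nn_integral_distr) measurable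
  finally show ?thesis ..
qed

lemma nn_integral_diagonal:
  fixes h :: "real^'n \<Rightarrow> ennreal"
  assumes c: "\<And>i. c i \<noteq> 0" and [measurable]: "h \<in> borel_measurable borel"
  shows "(\<integral>\<^sup>+x. h x \<partial>lborel) = ennreal \<bar>\<Prod>i\<in>UNIV. c i\<bar> * (\<integral>\<^sup>+x. h (\<chi> i. c i * x $ i) \<partial>lborel)"
proof -
  \<comment> \<open>\<open>lborel_affine_euclidean\<close> indexes its factors by basis vectors, so
    \<open>c\<close> is transported along the bijection of indices with axis vectors.\<close>
  define c' where "c' b = c (SOME i. b = axis i 1)" for b :: "real^'n"
  have c': "c' (axis i 1) = c i" for i
    unfolding c'_def by (rule arg_cong[where f=c]) (auto simp: axis_eq_axis)
  have T: "(\<Sum>b\<in>Basis. (c' b * (x \<bullet> b)) *\<^sub>R b) = (\<chi> i. c i * x $ i)" for x :: "real^'n"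
  proof -
    have "(\<Sum>i\<in>UNIV. (c i * x $ i) *\<^sub>R axis i 1) = (\<chi> i. c i * x $ i)"
      by (simp add: vec_eq_iff axis_def if_distrib cong: if_cong)
    then show ?thesis by (simp add: sum_Basis_vec c' inner_axis)
  qed
  have c'0: "c' j \<noteq> 0" if "j \<in> Basis" for j using that c by (auto simp: Basis_vec_eq c')
  have eq: "lborel = density (distr lborel borel (\<lambda>x. \<chi> i. c i * x $ i)) (\<lambda>_. (\<Prod>j\<in>Basis. \<bar>c' j\<bar>))"
    using lborel_affine_euclidean[where c=c' and t=0, OF c'0] by (simp add: T)
  have [measurable]: "(\<lambda>x::real^'n. \<chi> i. c i * x $ i) \<in> borel_measurable borel"
    by (intro borel_measurable_continuous_onI continuous_intros)
  show ?thesis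
    by (subst eq) (simp add: nn_integral_density nn_integral_distr nn_integral_cmult prod_Basis_vec c' abs_prod)
qed

text \<open>The library's linear change of variables requires a well-ordered index type; the induction over
  elementary matrices below works for every finite one.\<close>

theorem nn_integral_linear_change:
  fixes A :: "real^'n^'n" and h :: "real^'n \<Rightarrow> ennreal"
  assumes "det A \<noteq> 0" "h \<in> borel_measurable borel"
  shows "(\<integral>\<^sup>+x. h x \<partial>lborel) = ennreal \<bar>det A\<bar> * (\<integral>\<^sup>+x. h (A *v x) \<partial>lborel)"
proof -
  \<comment> \<open>The integrand is quantified inside the induction, because the case of a product
    \<open>A ** B\<close> applies the hypothesis for \<open>B\<close> to \<open>h\<close> composed
    with \<open>A\<close>.\<close>
  have "det A \<noteq> 0 \<longrightarrow> (\<forall>h\<in>borel_measurable borel. (\<integral>\<^sup>+x. h x \<partial>lborel) = ennreal \<bar>det A\<bar> * (\<integral>\<^sup>+x. h (A *v x) \<partial>lborel))"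
  proof (induction A rule: induct_matrix_elementary)
    case (1 A B)
    show ?case
    proof (intro impI ballI)
      fix h :: "real^'n \<Rightarrow> ennreal" assume AB: "det (A ** B) \<noteq> 0" and h [measurable]: "h \<in> borel_measurable borel"
      have "(\<integral>\<^sup>+x. h x \<partial>lborel) = ennreal \<bar>det A\<bar> * (\<integral>\<^sup>+x. h (A *v x) \<partial>lborel)"
        using 1(1)[rule_format, OF _ h] AB by (simp add: det_mul)
      also have "(\<integral>\<^sup>+x. h (A *v x) \<partial>lborel) = ennreal \<bar>det B\<bar> * (\<integral>\<^sup>+x. h (A *v (B *v x)) \<partial>lborel)"
        using 1(2)[rule_format, of "\<lambda>x. h (A *v x)"] AB by (simp add: det_mul)
      finally show "(\<integral>\<^sup>+x. h x \<partial>lborel) = ennreal \<bar>det (A ** B)\<bar> * (\<integral>\<^sup>+x. h (A ** B *v x) \<partial>lborel)"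
        by (simp add: det_mul abs_mult ennreal_mult mult.assoc matrix_vector_mul_assoc)
    qed
  next
    case (2 A i)
    then show ?case by (simp add: det_zero_row)
  next
    case (3 A)
    have det: "det A = (\<Prod>i\<in>UNIV. A $ i $ i)" using 3 by (intro det_diagonal) auto
    have "A *v x = (\<chi> i. A $ i $ i * x $ i)" for x
    proof -
      have "(\<Sum>j\<in>UNIV. A $ i $ j * x $ j) = (\<Sum>j\<in>UNIV. if j = i then A $ i $ i * x $ i else 0)" for i
        by (intro sum.cong) (auto simp: 3)
      then show ?thesis by (simp add: matrix_vector_mult_def)
    qed
    then show ?case using nn_integral_diagonal[of "\<lambda>i. A $ i $ i"] by (auto simp: det)
  next
    case (4 m n)
    have p: "Transposition.transpose m n permutes UNIV" by (rule permutes_swap_id) auto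
    have "det (\<chi> i j. mat 1 $ i $ Transposition.transpose m n j :: real^'n^'n) = of_int (sign (Transposition.transpose m n))"
      using det_permute_columns[OF p, of "mat 1 :: real^'n^'n"] by simp
    then have d: "\<bar>det (\<chi> i j. mat 1 $ i $ Transposition.transpose m n j :: real^'n^'n)\<bar> = 1"
      by (simp add: sign_def)
    have "(\<chi> i j. mat 1 $ i $ Transposition.transpose m n j) *v x = (\<chi> i. x $ Transposition.transpose m n i)" for x :: "real^'n"
    proof -
      have "(\<Sum>j\<in>UNIV. (if i = Transposition.transpose m n j then 1 else 0) * x $ j) = (\<Sum>j\<in>UNIV. if j = Transposition.transpose m n i then x $ j else 0)" for i
        by (intro sum.cong) (auto simp: transpose_eq_iff)
      then show ?thesis by (simp add: matrix_vector_mult_def mat_def)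
    qed
    then show ?case by (simp add: d nn_integral_permute[OF p])
  next
    case (5 m n c)
    let ?A = "(\<chi> i j. if i = m \<and> j = n then c else of_bool (i = j)) :: real^'n^'n"
    have "?A = (\<chi> k. if k = m then row m (mat 1) + c *s row n (mat 1) else row k (mat 1))"
      using 5 by (auto simp: vec_eq_iff row_def mat_def)
    then have d: "det ?A = 1" using det_row_operation[OF 5, of "mat 1 :: real^'n^'n" c] by simp
    have "?A *v x = (\<chi> i. if i = m then x $ m + c * x $ n else x $ i)" for x
    proof -
      have "(\<Sum>j\<in>UNIV. ?A $ i $ j * x $ j) = (\<Sum>j\<in>UNIV. (if j = i then x $ j else 0) + (if i = m then if j = n then c * x $ j else 0 else 0))" for i
        by (intro sum.cong) (use 5 in auto)
      then show ?thesis by (auto simp: matrix_vector_mult_def sum.distrib)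
    qed
    then show ?case using nn_integral_shear[OF 5, of _ c] by (simp add: d)
  qed
  then show ?thesis using assms by blast
qed

section \<open>Factorization of positive definite matrices\<close>

lemma transpose_inner: "(transpose A *v x) \<bullet> y = x \<bullet> (A *v y)" for A :: "real^'n^'m"
  by (simp add: dot_lmul_matrix)

text \<open>Gram--Schmidt for the inner product \<open>x \<bullet> (C *v y)\<close>.\<close>

lemma conjugate_orthonormal_exists:
  fixes C :: "real^'n^'n"
  assumes sym: "transpose C = C" and pos: "\<And>x. x \<noteq> 0 \<Longrightarrow> x \<bullet> (C *v x) > 0"
    and "n \<le> CARD('n)"
  shows "\<exists>S. finite S \<and> card S = n \<and> (\<forall>v\<in>S. \<forall>w\<in>S. v \<bullet> (C *v w) = (if v = w then 1 else 0))"
  using \<open>n \<le> CARD('n)\<close>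
proof (induction n)
  case 0
  show ?case by (rule exI[of _ "{}"]) simp
next
  case (Suc n)
  then obtain S where S: "finite S" "card S = n"
    and orth: "\<And>v w. v \<in> S \<Longrightarrow> w \<in> S \<Longrightarrow> v \<bullet> (C *v w) = (if v = w then 1 else 0)" by auto
  have symm: "x \<bullet> (C *v y) = y \<bullet> (C *v x)" for x y
    using transpose_inner[of C x y] sym by (simp add: inner_commute)
  have "span S \<noteq> UNIV"
  proof
    assume "span S = UNIV"
    then have "dim (UNIV :: (real^'n) set) \<le> card S" by (intro dim_le_card) (auto simp: S)
    then show False using Suc.prems S by simp
  qed
  then obtain v where v: "v \<notin> span S" by auto
  define w where "w = v - (\<Sum>s\<in>S. (s \<bullet> (C *v v)) *\<^sub>R s)"
  have "(\<Sum>s\<in>S. (s \<bullet> (C *v v)) *\<^sub>R s) \<in> span S"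
    by (intro span_sum span_scale span_base)
  with v have "w \<noteq> 0" unfolding w_def by auto
  have wS: "w \<bullet> (C *v s) = 0" if s: "s \<in> S" for s
  proof -
    have "(\<Sum>r\<in>S. (r \<bullet> (C *v v)) * (r \<bullet> (C *v s))) = (\<Sum>r\<in>S. if r = s then s \<bullet> (C *v v) else 0)"
      by (intro sum.cong refl) (simp add: orth s)
    then show ?thesis using s S symm[of v s] by (simp add: w_def inner_diff_left inner_sum_left)
  qed
  define z where "z = (1 / sqrt (w \<bullet> (C *v w))) *\<^sub>R w"
  have zz: "z \<bullet> (C *v z) = 1"
    using pos[OF \<open>w \<noteq> 0\<close>] by (simp add: z_def matrix_vector_mult_scaleR)
  have zS: "z \<bullet> (C *v s) = 0" "s \<bullet> (C *v z) = 0" if "s \<in> S" for s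
    using wS[OF that] symm[of s z] by (simp_all add: z_def)
  have "z \<notin> S" using zz zS by force
  then show ?case
    using S orth zz zS by (intro exI[of _ "insert z S"]) auto
qed

text \<open>The rows of \<open>B\<close> form an orthonormal basis for the inner product given by
  \<open>C\<close>, that is \<open>B ** C ** transpose B = mat 1\<close>. Taking determinants shows
  that \<open>B\<close> is invertible, and its inverse is the required factor.\<close>

lemma positive_definite_factor:
  fixes C :: "real^'n^'n"
  assumes sym: "transpose C = C" and pos: "\<And>x. x \<noteq> 0 \<Longrightarrow> x \<bullet> (C *v x) > 0"
  obtains A where "det A \<noteq> 0" "C = A ** transpose A"
proof -
  obtain S where S: "finite S" "card S = CARD('n)"
    and orth: "\<And>v w. v \<in> S \<Longrightarrow> w \<in> S \<Longrightarrow> v \<bullet> (C *v w) = (if v = w then 1 else 0)"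
    using conjugate_orthonormal_exists[OF assms, of "CARD('n)"] by auto
  obtain f where f: "bij_betw f (UNIV :: 'n set) S"
    using finite_same_card_bij[of "UNIV :: 'n set" S] S by auto
  define B where "B = (\<chi> i. f i)"
  have "(B ** C ** transpose B) $ i $ j = (mat 1 :: real^'n^'n) $ i $ j" for i j
  proof -
    have "(B ** C ** transpose B) $ i $ j = f i \<bullet> (C *v f j)"
    proof -
      have "(B ** C ** transpose B) $ i $ j = (B ** (C ** transpose B)) $ i $ j" by (simp only: matrix_mul_assoc)
      also have "\<dots> = f i \<bullet> (C *v f j)"
        by (simp add: matrix_matrix_mult_def matrix_vector_mult_def B_def transpose_def inner_vec_def)
      finally show ?thesis .
    qed
    also have "\<dots> = (if i = j then 1 else 0)"
      using orth[of "f i" "f j"] bij_betwE[OF f] inj_eq[OF bij_betw_imp_inj_on[OF f], of i j] by simp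
    finally show ?thesis by (simp add: mat_def)
  qed
  then have BCB: "B ** C ** transpose B = mat 1" by (simp add: vec_eq_iff)
  have "det B * det C * det (transpose B) = det (B ** C ** transpose B)" by (simp only: det_mul)
  also have "\<dots> = 1" by (simp only: BCB det_I)
  finally have "det B \<noteq> 0" by auto
  then obtain A where A: "A ** B = mat 1" "B ** A = mat 1"
    unfolding invertible_det_nz[symmetric] invertible_def by blast
  show ?thesis
  proof (rule that)
    have "det A * det B = 1" using A(1) det_mul[of A B] by simp
    then show "det A \<noteq> 0" by auto
    have TA: "transpose B ** transpose A = mat 1" by (simp add: matrix_transpose_mul[symmetric] A(1) del: transpose_matrix_vector)
    have "C = (A ** B) ** C ** (transpose B ** transpose A)" by (simp add: A(1) TA)
    also have "\<dots> = A ** (B ** C ** transpose B) ** transpose A" by (simp only: matrix_mul_assoc)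
    finally show "C = A ** transpose A" by (simp add: BCB)
  qed
qed

section \<open>Gaussian densities as images of standard normal ones\<close>

lemma lborel_linear_change:
  fixes A :: "real^'n^'n"
  assumes "det A \<noteq> 0"
  shows "lborel = density (distr lborel borel ((*v) A)) (\<lambda>_. ennreal \<bar>det A\<bar>)"
proof (rule measure_eqI)
  fix X :: "(real^'n) set" assume "X \<in> sets lborel"
  then have [measurable]: "X \<in> sets borel" by simp
  have "emeasure lborel X = (\<integral>\<^sup>+x. indicator X x \<partial>lborel)" by simp
  also have "\<dots> = ennreal \<bar>det A\<bar> * (\<integral>\<^sup>+x. indicator X (A *v x) \<partial>lborel)"
    by (rule nn_integral_linear_change[OF assms]) simp
  also have "\<dots> = emeasure (density (distr lborel borel ((*v) A)) (\<lambda>_. ennreal \<bar>det A\<bar>)) X"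
    by (subst emeasure_density, simp, simp, subst nn_integral_cmult, simp, subst nn_integral_distr) simp_all
  finally show "emeasure lborel X = emeasure (density (distr lborel borel ((*v) A)) (\<lambda>_. ennreal \<bar>det A\<bar>)) X" .
qed simp

lemma integral_linear_change:
  fixes A :: "real^'n^'n" and f :: "real^'n \<Rightarrow> 'b::{banach, second_countable_topology}"
  assumes "det A \<noteq> 0" and [measurable]: "f \<in> borel_measurable borel"
  shows "integral\<^sup>L lborel f = \<bar>det A\<bar> *\<^sub>R (\<integral>x. f (A *v x) \<partial>lborel)"
  by (subst lborel_linear_change[OF assms(1)]) (simp add: integral_density integral_distr)

lemma integrable_prod_vec:
  fixes f :: "'n::finite \<Rightarrow> real \<Rightarrow> 'b::{real_normed_field, banach, second_countable_topology}"
  assumes "\<And>i. integrable lborel (f i)"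
  shows "integrable lborel (\<lambda>x::real^'n. \<Prod>i\<in>UNIV. f i (x $ i))"
    and "(\<integral>x. (\<Prod>i\<in>UNIV. f i (x $ i)) \<partial>(lborel :: (real^'n) measure)) = (\<Prod>i\<in>UNIV. integral\<^sup>L lborel (f i))"
proof -
  interpret product_sigma_finite "\<lambda>_::'n. lborel :: real measure" ..
  have [measurable]: "f i \<in> borel_measurable borel" for i
    using borel_measurable_integrable[OF assms[of i]] by simp
  have m: "(\<lambda>x::real^'n. \<Prod>i\<in>UNIV. f i (x $ i)) \<in> borel_measurable borel"
    by measurable
  show "integrable lborel (\<lambda>x::real^'n. \<Prod>i\<in>UNIV. f i (x $ i))"
    unfolding lborel_vec_eq_PiM
    by (subst integrable_distr_eq[OF measurable_vec_lambda_PiM m])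
       (simp add: product_integrable_prod assms)
  show "(\<integral>x. (\<Prod>i\<in>UNIV. f i (x $ i)) \<partial>(lborel :: (real^'n) measure)) = (\<Prod>i\<in>UNIV. integral\<^sup>L lborel (f i))"
    unfolding lborel_vec_eq_PiM
    by (subst integral_distr[OF measurable_vec_lambda_PiM m])
       (simp add: product_integral_prod assms)
qed

lemma matrix_inv_unique:
  fixes A B :: "real^'n^'n"
  assumes "A ** B = mat 1" "B ** A = mat 1"
  shows "matrix_inv A = B"
proof -
  have "\<exists>M. A ** M = mat 1 \<and> M ** A = mat 1" using assms by blast
  then have i: "A ** matrix_inv A = mat 1 \<and> matrix_inv A ** A = mat 1"
    unfolding matrix_inv_def by (rule someI_ex)
  have "matrix_inv A = matrix_inv A ** (A ** B)" by (simp add: assms)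
  also have "\<dots> = (matrix_inv A ** A) ** B" by (simp only: matrix_mul_assoc)
  finally show ?thesis using i by simp
qed

text \<open>Substituting \<open>A *v z\<close> turns the quadratic form of the inverse covariance
  into the squared norm of \<open>z\<close>, and \<open>\<bar>det A\<bar>\<close> cancels the square
  root of \<open>det (A ** transpose A)\<close>.\<close>

lemma gaussian_density_factor:
  fixes A :: "real^'n^'n"
  assumes "det A \<noteq> 0"
  shows "\<bar>det A\<bar> * gaussian_density (A ** transpose A) (A *v z) = (\<Prod>i\<in>UNIV. std_normal_density (z $ i))"
proof -
  obtain B where B: "A ** B = mat 1" "B ** A = mat 1"
    using assms unfolding invertible_det_nz[symmetric] invertible_def by blast
  have TB: "transpose A ** transpose B = mat 1" "transpose B ** transpose A = mat 1"
    by (simp_all only: matrix_transpose_mul[symmetric] B transpose_mat)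
  let ?C = "A ** transpose A" and ?M = "transpose B ** B"
  have "?C ** ?M = mat 1"
  proof -
    have "?C ** ?M = A ** (transpose A ** transpose B) ** B" by (simp only: matrix_mul_assoc)
    then show ?thesis by (simp add: TB B)
  qed
  moreover have "?M ** ?C = mat 1"
  proof -
    have "?M ** ?C = transpose B ** (B ** A) ** transpose A" by (simp only: matrix_mul_assoc)
    then show ?thesis by (simp add: TB B)
  qed
  ultimately have inv: "matrix_inv ?C = ?M" by (rule matrix_inv_unique)
  have "(A *v z) \<bullet> (?M *v (A *v z)) = (A *v z) \<bullet> (transpose B *v (B *v (A *v z)))"
    by (simp only: matrix_vector_mul_assoc[symmetric])
  also have "\<dots> = (B *v (A *v z)) \<bullet> (B *v (A *v z))"
    using transpose_inner[of B "B *v (A *v z)" "A *v z"] by (simp only: inner_commute)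
  also have "B *v (A *v z) = z" by (simp add: matrix_vector_mul_assoc B)
  finally have q: "(A *v z) \<bullet> (?M *v (A *v z)) = (\<Sum>i\<in>UNIV. (z $ i)\<^sup>2)" by (simp add: inner_vec_def power2_eq_square)
  have d: "sqrt ((2 * pi) ^ CARD('n) * det ?C) = (\<Prod>i\<in>(UNIV::'n set). sqrt (2 * pi)) * \<bar>det A\<bar>"
    by (simp add: det_mul real_sqrt_mult real_sqrt_power power_mult_distrib)
  have "(\<Prod>i\<in>UNIV. std_normal_density (z $ i)) = (\<Prod>i\<in>UNIV. 1 / sqrt (2 * pi) * exp (- (z $ i)\<^sup>2 / 2))"
    by (simp add: std_normal_density_def)
  also have "\<dots> = (\<Prod>i\<in>(UNIV::'n set). 1 / sqrt (2 * pi)) * exp (\<Sum>i\<in>UNIV. - (z $ i)\<^sup>2 / 2)"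
    by (simp only: prod.distrib exp_sum finite)
  also have "(\<Sum>i\<in>UNIV. - (z $ i)\<^sup>2 / 2) = - (\<Sum>i\<in>UNIV. (z $ i)\<^sup>2) / 2"
    by (simp add: sum_divide_distrib sum_negf)
  finally have pr: "(\<Prod>i\<in>UNIV. std_normal_density (z $ i)) = (\<Prod>i\<in>(UNIV::'n set). 1 / sqrt (2 * pi)) * exp (- (\<Sum>i\<in>UNIV. (z $ i)\<^sup>2) / 2)" .
  have *: "a * (e / ((\<Prod>i\<in>(UNIV::'n set). s) * a)) = (\<Prod>i\<in>(UNIV::'n set). 1 / s) * e" if "a \<noteq> 0" for a e s :: real
    using that by (simp add: power_one_over)
  show ?thesis unfolding gaussian_density_def inv q d pr by (rule *) (use assms in simp)
qed

lemma gaussian_density_measurable [measurable]: "gaussian_density S \<in> borel_measurable (borel :: (real^'n) measure)"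
  unfolding gaussian_density_def
  by (intro borel_measurable_divide borel_measurable_const borel_measurable_continuous_onI continuous_intros
        matrix_vector_mult_linear_continuous_on) simp

text \<open>Moving \<open>A\<close> to the frequency, as
  \<open>\<theta>' = transpose A *v \<theta>\<close>, makes the transform a product of
  one-dimensional normal ones; the exponents add up because \<open>\<theta>' \<bullet> \<theta>' =
  \<theta> \<bullet> (S *v \<theta>)\<close>.\<close>

lemma gaussian_density_char:
  fixes A :: "real^'n^'n"
  assumes "det A \<noteq> 0"
  defines "S \<equiv> A ** transpose A"
  shows "integrable lborel (gaussian_density S)"
    and "(\<integral>x. cis (\<theta> \<bullet> x) * gaussian_density S x \<partial>lborel) = exp (- (\<theta> \<bullet> (S *v \<theta>)) / 2)"
proof -
  define \<theta>' where "\<theta>' = transpose A *v \<theta>"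
  have "integrable lborel (\<lambda>z. \<bar>det A\<bar> * gaussian_density S (A *v z))"
    unfolding S_def gaussian_density_factor[OF assms(1)] by (rule integrable_prod_vec) simp
  then have "integrable (density (distr lborel borel ((*v) A)) (\<lambda>_. ennreal \<bar>det A\<bar>)) (gaussian_density S)"
    by (subst integrable_density) (auto simp: integrable_distr_eq)
  then show "integrable lborel (gaussian_density S)"
    by (simp only: lborel_linear_change[OF assms(1), symmetric])
  have one: "(\<integral>z. cis (a * z) * std_normal_density z \<partial>lborel) = exp (- a\<^sup>2 / 2)" for a
  proof -
    have "char std_normal_distribution a = (\<integral>z. std_normal_density z *\<^sub>R iexp (a * z) \<partial>lborel)"
      unfolding char_def by (subst integral_density) auto
    then show ?thesis
      unfolding char_std_normal_distribution by (simp add: cis_conv_exp scaleR_conv_of_real mult.commute)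
  qed
  have int: "integrable lborel (\<lambda>z. cis (a * z) * std_normal_density z)" for a
  proof (rule Bochner_Integration.integrable_bound)
    show "integrable lborel std_normal_density" by simp
    show "(\<lambda>z. cis (a * z) * std_normal_density z) \<in> borel_measurable lborel"
      by (intro borel_measurable_times) (auto simp: cis_conv_exp)
  qed (simp add: norm_mult)
  have th: "\<theta> \<bullet> (A *v z) = (\<Sum>i\<in>UNIV. \<theta>' $ i * z $ i)" for z
    using transpose_inner[of A \<theta> z] by (simp only: \<theta>'_def inner_vec_def inner_real_def)
  have m: "(\<lambda>x. cis (\<theta> \<bullet> x) * gaussian_density S x) \<in> borel_measurable borel"
    by (intro borel_measurable_times) (auto simp: cis_conv_exp)
  have "(\<integral>x. cis (\<theta> \<bullet> x) * gaussian_density S x \<partial>lborel)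
      = \<bar>det A\<bar> *\<^sub>R (\<integral>z. cis (\<theta> \<bullet> (A *v z)) * gaussian_density S (A *v z) \<partial>lborel)"
    by (rule integral_linear_change[OF assms(1) m])
  also have "\<dots> = (\<integral>z. cis (\<theta> \<bullet> (A *v z)) * of_real (\<bar>det A\<bar> * gaussian_density S (A *v z)) \<partial>lborel)"
    by (subst integral_scaleR_right[symmetric], intro Bochner_Integration.integral_cong refl) (simp add: scaleR_conv_of_real mult_ac)
  also have "\<dots> = (\<integral>z. (\<Prod>i\<in>UNIV. cis (\<theta>' $ i * z $ i) * std_normal_density (z $ i)) \<partial>(lborel :: (real^'n) measure))"
    by (simp only: S_def gaussian_density_factor[OF assms(1)] th cis_sum of_real_prod prod.distrib)
  also have "\<dots> = (\<Prod>i\<in>UNIV. \<integral>z. cis (\<theta>' $ i * z) * std_normal_density z \<partial>lborel)"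
    by (rule integrable_prod_vec(2)) (rule int)
  also have "\<dots> = of_real (exp (\<Sum>i\<in>UNIV. - (\<theta>' $ i)\<^sup>2 / 2))"
    by (simp only: one exp_sum finite of_real_prod)
  also have "(\<Sum>i\<in>UNIV. - (\<theta>' $ i)\<^sup>2 / 2) = - (\<theta>' \<bullet> \<theta>') / 2"
    by (simp add: inner_vec_def power2_eq_square sum_divide_distrib sum_negf)
  also have "\<theta>' \<bullet> \<theta>' = \<theta> \<bullet> (S *v \<theta>)"
    using transpose_inner[of A \<theta> "\<theta>'"] by (simp only: \<theta>'_def S_def matrix_vector_mul_assoc)
  finally show "(\<integral>x. cis (\<theta> \<bullet> x) * gaussian_density S x \<partial>lborel) = exp (- (\<theta> \<bullet> (S *v \<theta>)) / 2)" by simp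
qed

section \<open>Differentiation under Gaussian integrals\<close>

text \<open>Domination is asked for only near each point, since Gaussian majorants deteriorate as
  time tends to 0. Continuity is tested on a sequence whose first \<open>N\<close> terms are
  dropped, so that the rest lies where \<open>w\<close> dominates.\<close>

lemma continuous_on_integral_dominated:
  fixes f :: "'a::metric_space \<Rightarrow> 'b \<Rightarrow> real"
  assumes meas: "\<And>z. z \<in> S \<Longrightarrow> f z \<in> borel_measurable M"
    and cont: "\<And>x. continuous_on S (\<lambda>z. f z x)"
    and dom: "\<And>z. z \<in> S \<Longrightarrow> \<exists>e>0. \<exists>w. integrable M w \<and> (\<forall>z'\<in>S. dist z' z < e \<longrightarrow> (\<forall>x. \<bar>f z' x\<bar> \<le> w x))"
  shows "continuous_on S (\<lambda>z. \<integral>x. f z x \<partial>M)"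
  unfolding continuous_on_eq_continuous_within continuous_within_sequentially o_def
proof (intro ballI allI impI, elim conjE)
  fix z X assume z: "z \<in> S" and XS: "\<forall>n. X n \<in> S" and X: "X \<longlonglongrightarrow> z"
  obtain e w where e: "e > 0" and w: "integrable M w" "\<And>z' x. z' \<in> S \<Longrightarrow> dist z' z < e \<Longrightarrow> \<bar>f z' x\<bar> \<le> w x"
    using dom[OF z] by blast
  obtain N where N: "\<And>n. n \<ge> N \<Longrightarrow> dist (X n) z < e"
    using X e unfolding lim_sequentially by blast
  have "(\<lambda>n. \<integral>x. f (X (n + N)) x \<partial>M) \<longlonglongrightarrow> (\<integral>x. f z x \<partial>M)"
  proof (rule integral_dominated_convergence[where w=w])
    show "AE x in M. (\<lambda>n. f (X (n + N)) x) \<longlonglongrightarrow> f z x"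
    proof (rule AE_I2)
      fix x
      have "(\<lambda>n. f (X n) x) \<longlonglongrightarrow> f z x"
        using cont[of x] z XS X
        unfolding continuous_on_eq_continuous_within continuous_within_sequentially o_def by blast
      then show "(\<lambda>n. f (X (n + N)) x) \<longlonglongrightarrow> f z x" by (rule LIMSEQ_ignore_initial_segment)
    qed
  qed (use meas z XS w N in auto)
  then show "(\<lambda>n. \<integral>x. f (X n) x \<partial>M) \<longlonglongrightarrow> (\<integral>x. f z x \<partial>M)" by (rule LIMSEQ_offset)
qed

text \<open>By the mean value inequality the majorant \<open>w\<close> of the derivative also bounds
  all difference quotients with parameters within \<open>e\<close> of \<open>s0\<close>, so
  dominated convergence applies to them.\<close>

lemma has_real_derivative_integral:
  fixes f :: "real \<Rightarrow> 'b \<Rightarrow> real"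
  assumes e: "e > 0"
    and der: "\<And>s x. \<bar>s - s0\<bar> < e \<Longrightarrow> ((\<lambda>s. f s x) has_real_derivative f' s x) (at s)"
    and bound: "\<And>s x. \<bar>s - s0\<bar> < e \<Longrightarrow> \<bar>f' s x\<bar> \<le> w x" and w: "integrable M w"
    and int: "\<And>s. \<bar>s - s0\<bar> < e \<Longrightarrow> integrable M (f s)"
    and meas: "f' s0 \<in> borel_measurable M"
  shows "((\<lambda>s. \<integral>x. f s x \<partial>M) has_real_derivative (\<integral>x. f' s0 x \<partial>M)) (at s0)"
  unfolding has_field_derivative_iff tendsto_at_iff_sequentially o_def
proof (intro allI impI)
  fix X assume X0: "\<forall>i. X i \<in> UNIV - {s0}" and X: "X \<longlonglongrightarrow> s0"
  obtain N where N: "\<And>n. n \<ge> N \<Longrightarrow> \<bar>X n - s0\<bar> < e"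
    using X e unfolding lim_sequentially dist_real_def by blast
  let ?Y = "\<lambda>n. X (n + N)"
  have Y: "\<bar>?Y n - s0\<bar> < e" "?Y n \<noteq> s0" for n using N X0 by auto
  have "(\<lambda>n. \<integral>x. (f (?Y n) x - f s0 x) / (?Y n - s0) \<partial>M) \<longlonglongrightarrow> (\<integral>x. f' s0 x \<partial>M)"
  proof (rule integral_dominated_convergence[where w=w])
    show "AE x in M. (\<lambda>n. (f (?Y n) x - f s0 x) / (?Y n - s0)) \<longlonglongrightarrow> f' s0 x"
    proof (rule AE_I2)
      fix x
      have "(\<lambda>n. (f (X n) x - f s0 x) / (X n - s0)) \<longlonglongrightarrow> f' s0 x"
        using der[of s0 x] e X0 X
        unfolding has_field_derivative_iff tendsto_at_iff_sequentially o_def by auto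
      then show "(\<lambda>n. (f (?Y n) x - f s0 x) / (?Y n - s0)) \<longlonglongrightarrow> f' s0 x"
        by (rule LIMSEQ_ignore_initial_segment)
    qed
    show "AE x in M. norm ((f (?Y n) x - f s0 x) / (?Y n - s0)) \<le> w x" for n
    proof (rule AE_I2)
      fix x
      have "norm (f (?Y n) x - f s0 x) \<le> w x * norm (?Y n - s0)"
        by (rule field_differentiable_bound[of "ball s0 e" "\<lambda>s. f s x" "\<lambda>s. f' s x"])
           (use e Y[of n] in \<open>auto simp: dist_real_def abs_minus_commute intro!: bound has_field_derivative_at_within der\<close>)
      then show "norm ((f (?Y n) x - f s0 x) / (?Y n - s0)) \<le> w x"
        using Y(2)[of n] by (simp add: pos_divide_le_eq)
    qed
    show "(\<lambda>x. (f (?Y n) x - f s0 x) / (?Y n - s0)) \<in> borel_measurable M" for n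
      using int[OF Y(1)[of n]] int[of s0] e by simp
  qed (use w meas in auto)
  moreover have "(\<integral>x. (f (?Y n) x - f s0 x) / (?Y n - s0) \<partial>M)
      = ((\<integral>x. f (?Y n) x \<partial>M) - (\<integral>x. f s0 x \<partial>M)) / (?Y n - s0)" for n
    using int[OF Y(1)[of n]] int[of s0] e by simp
  ultimately have "(\<lambda>n. ((\<integral>x. f (?Y n) x \<partial>M) - (\<integral>x. f s0 x \<partial>M)) / (?Y n - s0)) \<longlonglongrightarrow> (\<integral>x. f' s0 x \<partial>M)"
    by (simp only:)
  then show "(\<lambda>n. ((\<integral>x. f (X n) x \<partial>M) - (\<integral>x. f s0 x \<partial>M)) / (X n - s0)) \<longlonglongrightarrow> (\<integral>x. f' s0 x \<partial>M)"
    by (rule LIMSEQ_offset)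
qed

section \<open>Convolution with Gaussian dominated kernels\<close>

lemma integrable_exp_neg_norm:
  assumes "k > 0"
  shows "integrable lborel (\<lambda>x::real^'n. exp (- k * (norm x)\<^sup>2))"
proof -
  \<comment> \<open>With variance \<open>1 / (2 * k)\<close> the function
    \<open>exp (- k * s\<^sup>2)\<close> is a multiple of a centered normal density.\<close>
  define \<sigma> where "\<sigma> = sqrt (1 / (2 * k))"
  have \<sigma>: "\<sigma> > 0" "\<sigma>\<^sup>2 = 1 / (2 * k)" using assms by (auto simp: \<sigma>_def)
  have "exp (- k * s\<^sup>2) = sqrt (2 * pi * \<sigma>\<^sup>2) * normal_density 0 \<sigma> s" for s
    using assms by (simp add: normal_density_def \<sigma>(2))
  then have "integrable lborel (\<lambda>s. exp (- k * s\<^sup>2))"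
    using \<sigma>(1) by simp
  then have "integrable lborel (\<lambda>x::real^'n. \<Prod>i\<in>UNIV. exp (- k * (x $ i)\<^sup>2))"
    by (rule integrable_prod_vec)
  moreover have "(\<Prod>i\<in>UNIV. exp (- k * (x $ i)\<^sup>2)) = exp (- k * (norm x)\<^sup>2)" for x :: "real^'n"
  proof -
    have "(\<Prod>i\<in>UNIV. exp (- k * (x $ i)\<^sup>2)) = exp (\<Sum>i\<in>UNIV. - k * (x $ i)\<^sup>2)"
      by (simp only: exp_sum finite)
    also have "(\<Sum>i\<in>UNIV. - k * (x $ i)\<^sup>2) = - k * (norm x)\<^sup>2"
      unfolding power2_norm_eq_inner by (simp add: inner_vec_def power2_eq_square sum_distrib_left)
    finally show ?thesis .
  qed
  ultimately show ?thesis by simp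
qed

text \<open>A Gaussian bound that is uniform for times in compact subintervals of \<open>(0, \<infinity>)\<close> justifies
  differentiation under the integral sign.\<close>

definition gauss_dominated :: "(real \<Rightarrow> real^'n \<Rightarrow> real) \<Rightarrow> bool" where
  "gauss_dominated g \<longleftrightarrow> continuous_on ({0<..} \<times> UNIV) (\<lambda>(t, y). g t y) \<and>
     (\<forall>a b. 0 < a \<longrightarrow> (\<exists>c k. k > 0 \<and> (\<forall>t\<in>{a..b}. \<forall>y. \<bar>g t y\<bar> \<le> c * exp (- k * (norm y)\<^sup>2))))"

lemma gauss_dominatedD_cont:
  assumes "gauss_dominated g"
  shows "continuous_on S h1 \<Longrightarrow> continuous_on S h2 \<Longrightarrow> (\<And>z. z \<in> S \<Longrightarrow> 0 < h1 z) \<Longrightarrow> continuous_on S (\<lambda>z. g (h1 z) (h2 z))"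
  using assms unfolding gauss_dominated_def
  by (auto intro!: continuous_on_compose2[of "{0<..} \<times> UNIV" "\<lambda>(t, y). g t y" S "\<lambda>z. (h1 z, h2 z)", simplified] continuous_on_Pair)

definition gauss_conv :: "(real^'n \<Rightarrow> real) \<Rightarrow> (real \<Rightarrow> real^'n \<Rightarrow> real) \<Rightarrow> real \<Rightarrow> real^'n \<Rightarrow> real" where
  "gauss_conv f g t u = (\<integral>x. f x * g t (u - x) \<partial>lborel)"

context
  fixes f :: "real^'n \<Rightarrow> real" and B :: real
  assumes f_cont: "continuous_on UNIV f" and f_bound: "\<And>x. \<bar>f x\<bar> \<le> B"
begin

text \<open>One majorant for all \<open>u\<close> in a ball: since \<open>(norm x)\<^sup>2\<close>
  is at most twice the sum of the squared norms of \<open>u - x\<close> and \<open>u\<close>, the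
  shift by \<open>u\<close> costs half of the rate \<open>k\<close> and a factor
  \<open>exp (k * R\<^sup>2)\<close>.\<close>

lemma gauss_conv_dominated:
  assumes g: "gauss_dominated g" and "0 < a"
  obtains w where "integrable lborel w"
    "\<And>t u x. a \<le> t \<Longrightarrow> t \<le> b \<Longrightarrow> norm u \<le> R \<Longrightarrow> \<bar>f x * g t (u - x)\<bar> \<le> w x"
proof -
  obtain c k where k: "k > 0" and c: "\<And>t y. t \<in> {a..b} \<Longrightarrow> \<bar>g t y\<bar> \<le> c * exp (- k * (norm y)\<^sup>2)"
    using assms unfolding gauss_dominated_def by blast
  show ?thesis
  proof (rule that)
    show "integrable lborel (\<lambda>x::real^'n. B * \<bar>c\<bar> * exp (k * R\<^sup>2) * exp (- (k / 2) * (norm x)\<^sup>2))"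
      by (intro integrable_mult_right integrable_exp_neg_norm) (use k in simp)
    fix t and u x :: "real^'n" assume t: "a \<le> t" "t \<le> b" and u: "norm u \<le> R"
    have "norm x \<le> norm (u - x) + norm u"
      using norm_triangle_sub[of x u] by (simp add: norm_minus_commute)
    then have "(norm x)\<^sup>2 \<le> (norm (u - x) + norm u)\<^sup>2" by (intro power_mono) auto
    also have "\<dots> \<le> 2 * (norm (u - x))\<^sup>2 + 2 * (norm u)\<^sup>2"
      using sum_squares_bound[of "norm (u - x)" "norm u"] by (simp add: power2_sum)
    also have "(norm u)\<^sup>2 \<le> R\<^sup>2" using u by (intro power_mono) auto
    finally have "(norm x)\<^sup>2 / 2 - R\<^sup>2 \<le> (norm (u - x))\<^sup>2" by simp
    then have "- k * (norm (u - x))\<^sup>2 \<le> k * R\<^sup>2 + - (k / 2) * (norm x)\<^sup>2"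
      using k mult_left_mono[of "(norm x)\<^sup>2 / 2 - R\<^sup>2" "(norm (u - x))\<^sup>2" k] by (simp add: algebra_simps)
    then have "exp (- k * (norm (u - x))\<^sup>2) \<le> exp (k * R\<^sup>2) * exp (- (k / 2) * (norm x)\<^sup>2)"
      by (simp flip: exp_add)
    then have "\<bar>c\<bar> * exp (- k * (norm (u - x))\<^sup>2) \<le> \<bar>c\<bar> * (exp (k * R\<^sup>2) * exp (- (k / 2) * (norm x)\<^sup>2))"
      by (rule mult_left_mono) simp
    moreover have "\<bar>g t (u - x)\<bar> \<le> \<bar>c\<bar> * exp (- k * (norm (u - x))\<^sup>2)"
    proof -
      have "\<bar>g t (u - x)\<bar> \<le> c * exp (- k * (norm (u - x))\<^sup>2)" using c t by simp
      also have "\<dots> \<le> \<bar>c\<bar> * exp (- k * (norm (u - x))\<^sup>2)" by (intro mult_right_mono) auto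
      finally show ?thesis .
    qed
    ultimately have "\<bar>g t (u - x)\<bar> \<le> \<bar>c\<bar> * (exp (k * R\<^sup>2) * exp (- (k / 2) * (norm x)\<^sup>2))" by linarith
    then have "\<bar>f x\<bar> * \<bar>g t (u - x)\<bar> \<le> B * (\<bar>c\<bar> * (exp (k * R\<^sup>2) * exp (- (k / 2) * (norm x)\<^sup>2)))"
      using f_bound[of x] by (intro mult_mono) auto
    then show "\<bar>f x * g t (u - x)\<bar> \<le> B * \<bar>c\<bar> * exp (k * R\<^sup>2) * exp (- (k / 2) * (norm x)\<^sup>2)"
      by (simp add: abs_mult mult.assoc)
  qed
qed

lemma gauss_conv_measurable:
  assumes g: "gauss_dominated g" and "0 < t"
  shows "(\<lambda>x. f x * g t (u - x)) \<in> borel_measurable lborel"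
  by (simp, intro borel_measurable_continuous_onI continuous_intros f_cont gauss_dominatedD_cont[OF g])
     (use assms in auto)

lemma gauss_conv_integrable:
  assumes g: "gauss_dominated g" and "0 < t"
  shows "integrable lborel (\<lambda>x. f x * g t (u - x))"
proof -
  obtain w where w: "integrable lborel w" "\<And>s v x. t \<le> s \<Longrightarrow> s \<le> t \<Longrightarrow> norm v \<le> norm u \<Longrightarrow> \<bar>f x * g s (v - x)\<bar> \<le> w x"
    using gauss_conv_dominated[OF assms, of t "norm u"] by blast
  have "norm (f x * g t (u - x)) \<le> norm (w x)" for x using w(2)[of t u x] by simp
  then show ?thesis
    by (intro Bochner_Integration.integrable_bound[OF w(1) gauss_conv_measurable[OF assms]] AE_I2)
qed

lemma gauss_conv_continuous:
  assumes g: "gauss_dominated g"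
  shows "continuous_on ({0<..} \<times> UNIV) (\<lambda>(t, u). gauss_conv f g t u)"
proof -
  have "continuous_on ({0<..} \<times> UNIV) (\<lambda>z. \<integral>x. f x * g (fst z) (snd z - x) \<partial>lborel)"
  proof (rule continuous_on_integral_dominated)
    fix z :: "real \<times> (real^'n)" assume z: "z \<in> {0<..} \<times> UNIV"
    then show "(\<lambda>x. f x * g (fst z) (snd z - x)) \<in> borel_measurable lborel"
      by (intro gauss_conv_measurable[OF g]) auto
    have t: "0 < fst z" using z by auto
    \<comment> \<open>Within distance \<open>fst z / 2\<close> of \<open>z\<close>, times stay in a
      compact subinterval of the positive half-line and positions in a ball, so a single majorant
      serves the whole neighbourhood.\<close>
    obtain w where w: "integrable lborel w"
      "\<And>t u x. fst z / 2 \<le> t \<Longrightarrow> t \<le> 2 * fst z \<Longrightarrow> norm u \<le> norm (snd z) + fst z \<Longrightarrow> \<bar>f x * g t (u - x)\<bar> \<le> w x"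
      using gauss_conv_dominated[OF g half_gt_zero[OF t], of "2 * fst z" "norm (snd z) + fst z"] by blast
    show "\<exists>e>0. \<exists>w. integrable lborel w \<and> (\<forall>z'\<in>{0<..} \<times> UNIV. dist z' z < e \<longrightarrow> (\<forall>x. \<bar>f x * g (fst z') (snd z' - x)\<bar> \<le> w x))"
    proof (intro exI conjI ballI impI allI)
      show "fst z / 2 > 0" using t by simp
      show "integrable lborel w" by (rule w)
      fix z' :: "real \<times> (real^'n)" and x assume d: "dist z' z < fst z / 2"
      have "\<bar>fst z' - fst z\<bar> < fst z / 2" using dist_fst_le[of z' z] d by (simp add: dist_real_def)
      moreover have "norm (snd z' - snd z) < fst z / 2" using dist_snd_le[of z' z] d by (simp add: dist_norm)
      ultimately show "\<bar>f x * g (fst z') (snd z' - x)\<bar> \<le> w x"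
        using norm_triangle_sub[of "snd z'" "snd z"] t by (intro w; linarith)
    qed
  next
    show "continuous_on ({0<..} \<times> UNIV) (\<lambda>z. f x * g (fst z) (snd z - x))" for x
      by (intro continuous_intros gauss_dominatedD_cont[OF g]) auto
  qed
  then show ?thesis by (simp add: gauss_conv_def case_prod_beta')
qed

text \<open>The derivative falls on the kernel; \<open>f\<close> enters only as a bounded continuous
  weight.\<close>

lemma gauss_conv_time_derivative:
  assumes g: "gauss_dominated g" and g': "gauss_dominated g'"
    and der: "\<And>t y. t > 0 \<Longrightarrow> ((\<lambda>s. g s y) has_real_derivative g' t y) (at t)"
    and t: "t > 0"
  shows "((\<lambda>s. gauss_conv f g s u) has_real_derivative gauss_conv f g' t u) (at t)"
  unfolding gauss_conv_def
proof -
  obtain w where w: "integrable lborel w"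
    "\<And>s v x. t / 2 \<le> s \<Longrightarrow> s \<le> 2 * t \<Longrightarrow> norm v \<le> norm u \<Longrightarrow> \<bar>f x * g' s (v - x)\<bar> \<le> w x"
    using gauss_conv_dominated[OF g' half_gt_zero[OF t], of "2 * t" "norm u"] by blast
  show "((\<lambda>s. \<integral>x. f x * g s (u - x) \<partial>lborel) has_real_derivative (\<integral>x. f x * g' t (u - x) \<partial>lborel)) (at t)"
  proof (rule has_real_derivative_integral[where e="t / 2" and w=w])
    fix s assume s: "\<bar>s - t\<bar> < t / 2"
    then have s0: "s > 0" "t / 2 \<le> s" "s \<le> 2 * t" using t by linarith+
    show "((\<lambda>s. f x * g s (u - x)) has_real_derivative f x * g' s (u - x)) (at s)" for x
      by (intro DERIV_cmult der s0)
    show "\<bar>f x * g' s (u - x)\<bar> \<le> w x" for x by (intro w s0) simp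
    show "integrable lborel (\<lambda>x. f x * g s (u - x))" by (intro gauss_conv_integrable[OF g] s0)
  qed (use t w gauss_conv_measurable[OF g'] in auto)
qed

lemma gauss_conv_partial:
  assumes g: "gauss_dominated g" and g': "gauss_dominated g'"
    and der: "\<And>t y. t > 0 \<Longrightarrow> has_partial i (g t) (g' t y) y"
    and t: "t > 0"
  shows "has_partial i (gauss_conv f g t) (gauss_conv f g' t u) u"
  unfolding has_partial_def gauss_conv_def
proof -
  let ?v = "\<lambda>h. u + h *\<^sub>R axis i 1"
  obtain w where w: "integrable lborel w"
    "\<And>s v x. t \<le> s \<Longrightarrow> s \<le> t \<Longrightarrow> norm v \<le> norm u + 1 \<Longrightarrow> \<bar>f x * g' s (v - x)\<bar> \<le> w x"
    using gauss_conv_dominated[OF g' t, of t "norm u + 1"] by blast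
  have "((\<lambda>h. \<integral>x. f x * g t (?v h - x) \<partial>lborel) has_real_derivative (\<integral>x. f x * g' t (?v 0 - x) \<partial>lborel)) (at 0)"
  proof (rule has_real_derivative_integral[where e=1 and w=w and f'="\<lambda>h x. f x * g' t (?v h - x)"])
    fix h :: real assume h: "\<bar>h - 0\<bar> < 1"
    have "((\<lambda>r. g t (?v h - x + r *\<^sub>R axis i 1)) has_real_derivative g' t (?v h - x)) (at 0)" for x
      using der[OF t, of "?v h - x"] by (simp add: has_partial_def)
    then have "((\<lambda>r. g t (?v r - x)) has_real_derivative g' t (?v h - x)) (at h)" for x
      using DERIV_shift[of "\<lambda>r. g t (?v r - x)" "g' t (?v h - x)" 0 h] by (simp add: algebra_simps)
    then show "((\<lambda>h. f x * g t (?v h - x)) has_real_derivative f x * g' t (?v h - x)) (at h)" for x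
      by (intro DERIV_cmult)
    have "norm (?v h) \<le> norm u + 1"
      using norm_triangle_ineq[of u "h *\<^sub>R axis i 1"] h by simp
    then show "\<bar>f x * g' t (?v h - x)\<bar> \<le> w x" for x by (intro w) auto
    show "integrable lborel (\<lambda>x. f x * g t (?v h - x))" by (intro gauss_conv_integrable[OF g] t)
  qed (use t w gauss_conv_measurable[OF g'] in auto)
  then show "((\<lambda>h. \<integral>x. f x * g t (u + h *\<^sub>R axis i 1 - x) \<partial>lborel) has_real_derivative (\<integral>x. f x * g' t (u - x) \<partial>lborel)) (at 0)"
    by simp
qed

end

section \<open>The heat kernel and the heat flow\<close>

lemma matrix_vector_mult_scaleR_left: "(a *\<^sub>R A) *v x = a *\<^sub>R (A *v x)" for A :: "real^'n^'m"
  by (simp add: matrix_vector_mult_def vec_eq_iff sum_distrib_left mult.assoc)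

lemma det_scaleR: "det (a *\<^sub>R A) = a ^ CARD('n) * det A" for A :: "real^'n^'n"
proof -
  have "a *\<^sub>R A = matrix ((*\<^sub>R) a) ** A"
  proof -
    have "(matrix ((*\<^sub>R) a) ** A) *v x = (a *\<^sub>R A) *v x" for x
      by (simp add: matrix_vector_mul_assoc[symmetric] matrix_vector_mult_scaleR_left)
    then show ?thesis by (simp add: matrix_eq)
  qed
  then show ?thesis by (simp add: det_mul)
qed

section \<open>The Gaussian kernel, its derivatives and their bounds\<close>

context
  fixes C A :: "real^'n^'n"
  assumes A: "det A \<noteq> 0" and C: "C = A ** transpose A"
begin

lemma cov_inv:
  shows cov_inv_right: "C ** matrix_inv C = mat 1" and cov_inv_left: "matrix_inv C ** C = mat 1"
proof -
  have "det C \<noteq> 0" using A by (simp add: C det_mul)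
  then have "\<exists>M. C ** M = mat 1 \<and> M ** C = mat 1"
    unfolding invertible_det_nz[symmetric] invertible_def .
  then have "C ** matrix_inv C = mat 1 \<and> matrix_inv C ** C = mat 1"
    unfolding matrix_inv_def by (rule someI_ex)
  then show "C ** matrix_inv C = mat 1" "matrix_inv C ** C = mat 1" by auto
qed

lemma cov_sym: "transpose C = C"
  by (simp add: C matrix_transpose_mul)

lemma cov_inv_sym: "transpose (matrix_inv C) = matrix_inv C"
proof -
  have "C ** transpose (matrix_inv C) = transpose (matrix_inv C ** C)"
    by (simp only: matrix_transpose_mul cov_sym)
  moreover have "transpose (matrix_inv C) ** C = transpose (C ** matrix_inv C)"
    by (simp only: matrix_transpose_mul cov_sym)
  ultimately show ?thesis
    by (intro matrix_inv_unique[symmetric]) (simp_all add: cov_inv)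
qed

lemma cov_inv_commute: "x \<bullet> (matrix_inv C *v y) = y \<bullet> (matrix_inv C *v x)"
  using transpose_inner[of "matrix_inv C" x y] by (simp only: cov_inv_sym inner_commute)

lemma matrix_inv_scaleR: "t \<noteq> 0 \<Longrightarrow> matrix_inv (t *\<^sub>R C) = (1 / t) *\<^sub>R matrix_inv C"
proof (rule matrix_inv_unique)
  assume "t \<noteq> 0"
  then have "((t *\<^sub>R C) ** ((1 / t) *\<^sub>R matrix_inv C)) *v x = mat 1 *v x"
            "(((1 / t) *\<^sub>R matrix_inv C) ** (t *\<^sub>R C)) *v x = mat 1 *v x" for x
    by (simp_all add: matrix_vector_mul_assoc[symmetric] matrix_vector_mult_scaleR_left matrix_vector_mult_scaleR)
       (simp_all add: matrix_vector_mul_assoc cov_inv)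
  then show "(t *\<^sub>R C) ** ((1 / t) *\<^sub>R matrix_inv C) = mat 1" "((1 / t) *\<^sub>R matrix_inv C) ** (t *\<^sub>R C) = mat 1"
    by (simp_all only: matrix_eq simp_thms)
qed

text \<open>With \<open>B\<close> the inverse of \<open>A\<close>, the form is the squared norm of
  \<open>B *v y\<close>. Applying \<open>A\<close>, whose operator norm is at most \<open>K\<close>,
  recovers \<open>y\<close>, so the lower bound holds with \<open>1 / K\<^sup>2\<close>.\<close>

lemma cov_inv_lower:
  obtains l where "l > 0" "\<And>y. l * (norm y)\<^sup>2 \<le> y \<bullet> (matrix_inv C *v y)"
proof -
  obtain B where B: "A ** B = mat 1" "B ** A = mat 1"
    using A unfolding invertible_det_nz[symmetric] invertible_def by blast
  have TB: "transpose A ** transpose B = mat 1" "transpose B ** transpose A = mat 1"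
    by (simp_all only: matrix_transpose_mul[symmetric] B transpose_mat)
  have M: "matrix_inv C = transpose B ** B"
  proof (rule matrix_inv_unique)
    have "C ** (transpose B ** B) = A ** (transpose A ** transpose B) ** B" by (simp only: C matrix_mul_assoc)
    then show "C ** (transpose B ** B) = mat 1" by (simp add: TB B)
    have "(transpose B ** B) ** C = transpose B ** (B ** A) ** transpose A" by (simp only: C matrix_mul_assoc)
    then show "(transpose B ** B) ** C = mat 1" by (simp add: TB B)
  qed
  have q: "y \<bullet> (matrix_inv C *v y) = (norm (B *v y))\<^sup>2" for y
  proof -
    have "y \<bullet> (matrix_inv C *v y) = (transpose B *v (B *v y)) \<bullet> y"
      by (simp only: M matrix_vector_mul_assoc inner_commute)
    then show ?thesis by (simp only: transpose_inner power2_norm_eq_inner)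
  qed
  obtain K where K: "K > 0" "\<And>z. norm (A *v z) \<le> K * norm z"
    using linear_bounded_pos[OF matrix_vector_mul_linear[of A]] by blast
  show ?thesis
  proof (rule that)
    show "1 / K\<^sup>2 > 0" using K by simp
    fix y
    have "norm y \<le> K * norm (B *v y)" using K(2)[of "B *v y"] by (simp add: matrix_vector_mul_assoc B)
    then have "(norm y)\<^sup>2 \<le> (K * norm (B *v y))\<^sup>2" by (intro power_mono) auto
    then show "1 / K\<^sup>2 * (norm y)\<^sup>2 \<le> y \<bullet> (matrix_inv C *v y)"
      using K(1) by (simp add: q power_mult_distrib divide_simps mult.commute)
  qed
qed

text \<open>Separates time from space: the determinant scales with the power \<open>CARD('n)\<close>
  of \<open>t\<close> and the inverse with \<open>1 / t\<close>. Derivatives and bounds are read off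
  from this form.\<close>

lemma gaussian_density_scaleR:
  assumes "t > 0"
  shows "gaussian_density (t *\<^sub>R C) y =
     1 / sqrt ((2 * pi) ^ CARD('n) * det C) * t powr (- real CARD('n) / 2) * exp (- (y \<bullet> (matrix_inv C *v y)) / (2 * t))"
proof -
  have "sqrt (t ^ CARD('n)) = (t powr real CARD('n)) powr (1 / 2)"
    by (subst powr_half_sqrt) (use assms in \<open>simp_all add: powr_realpow\<close>)
  also have "\<dots> = t powr (real CARD('n) / 2)" by (simp add: powr_powr)
  finally have "1 / sqrt (t ^ CARD('n)) = t powr (- (real CARD('n) / 2))"
    by (simp only: powr_minus inverse_eq_divide)
  then have "1 / sqrt (t ^ CARD('n)) = t powr (- real CARD('n) / 2)" by simp
  moreover have "sqrt ((2 * pi) ^ CARD('n) * det (t *\<^sub>R C)) = sqrt ((2 * pi) ^ CARD('n) * det C) * sqrt (t ^ CARD('n))"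
    by (simp only: det_scaleR real_sqrt_mult mult_ac)
  moreover have "y \<bullet> (matrix_inv (t *\<^sub>R C) *v y) = (y \<bullet> (matrix_inv C *v y)) / t"
    using assms by (simp add: matrix_inv_scaleR matrix_vector_mult_scaleR_left)
  ultimately have "gaussian_density (t *\<^sub>R C) y = exp (- ((y \<bullet> (matrix_inv C *v y)) / t) / 2) /
      (sqrt ((2 * pi) ^ CARD('n) * det C) * sqrt (t ^ CARD('n)))"
    by (simp only: gaussian_density_def)
  also have "\<dots> = 1 / sqrt ((2 * pi) ^ CARD('n) * det C) * (1 / sqrt (t ^ CARD('n))) * exp (- (y \<bullet> (matrix_inv C *v y)) / (2 * t))"
    by (simp add: mult.commute)
  finally show ?thesis by (simp only: \<open>1 / sqrt (t ^ CARD('n)) = t powr (- real CARD('n) / 2)\<close>)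
qed

lemma quad_form_continuous: "continuous_on S (\<lambda>z. snd z \<bullet> (matrix_inv C *v snd z))" for S :: "(real \<times> (real^'n)) set"
  by (intro continuous_intros continuous_on_compose2[OF matrix_vector_mult_linear_continuous_on[of UNIV]]) auto

text \<open>A factor of at most quadratic growth is absorbed by giving up half of the exponential
  rate. All derivatives that occur are the kernel times such a factor, so this one estimate covers
  them.\<close>

lemma gauss_dominated_kernel_mult:
  assumes P: "continuous_on ({0<..} \<times> UNIV) (\<lambda>(t, y). P t y)"
    and bound: "\<And>a. a > 0 \<Longrightarrow> \<exists>c. \<forall>t\<ge>a. \<forall>y. \<bar>P t y\<bar> \<le> c * (1 + (norm y)\<^sup>2)"
  shows "gauss_dominated (\<lambda>t y. gaussian_density (t *\<^sub>R C) y * P t y)"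
  unfolding gauss_dominated_def
proof (intro conjI allI impI)
  let ?\<kappa> = "1 / sqrt ((2 * pi) ^ CARD('n) * det C)"
  have \<kappa>: "?\<kappa> \<ge> 0" by (simp add: C det_mul)
  have "continuous_on ({0<..} \<times> UNIV) (\<lambda>z. ?\<kappa> * fst z powr (- real CARD('n) / 2) * exp (- (snd z \<bullet> (matrix_inv C *v snd z)) / (2 * fst z)) * P (fst z) (snd z))"
    using P by (intro continuous_intros quad_form_continuous) (auto simp: case_prod_beta')
  then show "continuous_on ({0<..} \<times> UNIV) (\<lambda>(t, y). gaussian_density (t *\<^sub>R C) y * P t y)"
    by (rule continuous_on_eq) (auto simp: gaussian_density_scaleR)
  fix a b :: real assume a: "0 < a"
  obtain c where c: "\<And>t y. t \<ge> a \<Longrightarrow> \<bar>P t y\<bar> \<le> c * (1 + (norm y)\<^sup>2)" using bound[OF a] by blast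
  have c0: "c \<ge> 0" using order_trans[OF abs_ge_zero c[of a 0]] by simp
  obtain l where l: "l > 0" "\<And>y. l * (norm y)\<^sup>2 \<le> y \<bullet> (matrix_inv C *v y)" using cov_inv_lower by blast
  \<comment> \<open>The maximum with \<open>a\<close> keeps the upper end positive even when
    \<open>b\<close> is not, so that the rate \<open>k\<close> below is positive.\<close>
  define b' where "b' = max a b"
  have b': "b' > 0" "b \<le> b'" using a by (auto simp: b'_def)
  \<comment> \<open>For times up to \<open>b'\<close> the exponent of the kernel is at least
    \<open>l * (norm y)\<^sup>2 / (2 * b')\<close>, which is
    \<open>2 * k * (norm y)\<^sup>2\<close>: one half pays for the factor \<open>P\<close>, the
    other remains.\<close>
  define k where "k = l / (4 * b')"
  have k: "k > 0" using l b' by (simp add: k_def)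
  show "\<exists>c k. 0 < k \<and> (\<forall>t\<in>{a..b}. \<forall>y. \<bar>gaussian_density (t *\<^sub>R C) y * P t y\<bar> \<le> c * exp (- k * (norm y)\<^sup>2))"
  proof (rule exI[of _ "?\<kappa> * a powr (- real CARD('n) / 2) * c * (1 + 1 / k)"], rule exI[of _ k], intro conjI ballI allI k)
    fix t y assume t: "t \<in> {a..b}"
    then have t0: "t > 0" "a \<le> t" "t \<le> b'" using a b' by auto
    have "2 * k * (norm y)\<^sup>2 \<le> (y \<bullet> (matrix_inv C *v y)) / (2 * t)"
    proof -
      have "2 * k * (norm y)\<^sup>2 = l * (norm y)\<^sup>2 / (2 * b')" by (simp add: k_def)
      also have "\<dots> \<le> l * (norm y)\<^sup>2 / (2 * t)" using t0 l b' by (intro divide_left_mono) auto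
      also have "\<dots> \<le> (y \<bullet> (matrix_inv C *v y)) / (2 * t)" using l(2)[of y] t0 by (intro divide_right_mono) auto
      finally show ?thesis .
    qed
    then have e1: "exp (- (y \<bullet> (matrix_inv C *v y)) / (2 * t)) \<le> exp (- 2 * k * (norm y)\<^sup>2)" by simp
    have "t powr (- real CARD('n) / 2) \<le> a powr (- real CARD('n) / 2)"
      using a t0 by (intro powr_mono2') auto
    then have "\<bar>gaussian_density (t *\<^sub>R C) y\<bar> \<le> ?\<kappa> * a powr (- real CARD('n) / 2) * exp (- 2 * k * (norm y)\<^sup>2)"
      unfolding gaussian_density_scaleR[OF t0(1)] abs_mult abs_exp_cancel abs_of_nonneg[OF \<kappa>] abs_of_nonneg[OF powr_ge_zero]
      by (intro mult_mono e1 mult_left_mono \<kappa> mult_nonneg_nonneg) auto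
    then have "\<bar>gaussian_density (t *\<^sub>R C) y\<bar> * \<bar>P t y\<bar>
        \<le> (?\<kappa> * a powr (- real CARD('n) / 2) * exp (- 2 * k * (norm y)\<^sup>2)) * (c * (1 + (norm y)\<^sup>2))"
      using c[OF t0(2), of y] \<kappa> by (intro mult_mono) auto
    also have "\<dots> = (?\<kappa> * a powr (- real CARD('n) / 2) * c) * (exp (- 2 * k * (norm y)\<^sup>2) * (1 + (norm y)\<^sup>2))"
      by (simp only: mult_ac)
    also have "\<dots> \<le> (?\<kappa> * a powr (- real CARD('n) / 2) * c) * ((1 + 1 / k) * exp (- k * (norm y)\<^sup>2))"
    proof (rule mult_left_mono)
      \<comment> \<open>Together with \<open>1 + s \<le> exp s\<close> this bounds the quadratic
        factor by the half of the exponential that is given up, with constant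
        \<open>1 + 1 / k\<close>.\<close>
      have "1 + (norm y)\<^sup>2 \<le> (1 + 1 / k) * (1 + k * (norm y)\<^sup>2)"
        using k by (simp add: algebra_simps)
      also have "\<dots> \<le> (1 + 1 / k) * exp (k * (norm y)\<^sup>2)"
        using k exp_ge_add_one_self[of "k * (norm y)\<^sup>2"] by (intro mult_left_mono) auto
      finally have "exp (- 2 * k * (norm y)\<^sup>2) * (1 + (norm y)\<^sup>2) \<le> exp (- 2 * k * (norm y)\<^sup>2) * ((1 + 1 / k) * exp (k * (norm y)\<^sup>2))"
        by (rule mult_left_mono) simp
      also have "\<dots> = (1 + 1 / k) * exp (- k * (norm y)\<^sup>2)"
        by (simp add: mult.left_commute flip: exp_add)
      finally show "exp (- 2 * k * (norm y)\<^sup>2) * (1 + (norm y)\<^sup>2) \<le> (1 + 1 / k) * exp (- k * (norm y)\<^sup>2)" .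
    qed (use c0 \<kappa> in auto)
    finally show "\<bar>gaussian_density (t *\<^sub>R C) y * P t y\<bar> \<le> ?\<kappa> * a powr (- real CARD('n) / 2) * c * (1 + 1 / k) * exp (- k * (norm y)\<^sup>2)"
      by (simp only: abs_mult mult.assoc)
  qed
qed

lemma gauss_dominated_kernel: "gauss_dominated (\<lambda>t. gaussian_density (t *\<^sub>R C))"
proof -
  have "gauss_dominated (\<lambda>t y. gaussian_density (t *\<^sub>R C) y * (\<lambda>_ _. 1) t y)"
    by (rule gauss_dominated_kernel_mult) (auto intro!: exI[of _ 1])
  then show ?thesis by simp
qed

text \<open>The second factor is the time derivative of the logarithm of the kernel. Here and in the
  spatial derivatives, the form kernel times polynomial in \<open>y\<close> is the one to which the
  domination estimate applies.\<close>

definition kernel_t :: "real \<Rightarrow> real^'n \<Rightarrow> real" where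
  "kernel_t t y = gaussian_density (t *\<^sub>R C) y * ((y \<bullet> (matrix_inv C *v y)) / (2 * t\<^sup>2) - real CARD('n) / (2 * t))"

definition kernel_i :: "'n \<Rightarrow> real \<Rightarrow> real^'n \<Rightarrow> real" where
  "kernel_i i t y = gaussian_density (t *\<^sub>R C) y * (- ((matrix_inv C *v y) $ i) / t)"

definition kernel_ij :: "'n \<Rightarrow> 'n \<Rightarrow> real \<Rightarrow> real^'n \<Rightarrow> real" where
  "kernel_ij i j t y = gaussian_density (t *\<^sub>R C) y *
     ((matrix_inv C *v y) $ i * (matrix_inv C *v y) $ j / t\<^sup>2 - matrix_inv C $ j $ i / t)"

lemma kernel_t_derivative:
  assumes "t > 0"
  shows "((\<lambda>s. gaussian_density (s *\<^sub>R C) y) has_real_derivative kernel_t t y) (at t)"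
proof -
  define \<kappa> where "\<kappa> = 1 / sqrt ((2 * pi) ^ CARD('n) * det C)"
  define e where "e = - real CARD('n) / 2"
  define q where "q = y \<bullet> (matrix_inv C *v y)"
  have K: "gaussian_density (s *\<^sub>R C) y = \<kappa> * s powr e * exp (- q / (2 * s))" if "s > 0" for s
    using that by (simp only: gaussian_density_scaleR \<kappa>_def e_def q_def)
  have pw: "t powr (e - 1) = t powr e / t" using assms by (simp add: powr_diff)
  have eq: "kernel_t t y = \<kappa> * (e * (t powr e / t)) * exp (- q / (2 * t)) + \<kappa> * t powr e * (exp (- q / (2 * t)) * (q / (2 * t\<^sup>2)))"
    unfolding kernel_t_def K[OF assms] q_def[symmetric] by (simp add: algebra_simps e_def)
  have "((\<lambda>s. \<kappa> * s powr e * exp (- q / (2 * s))) has_real_derivative kernel_t t y) (at t)"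
    unfolding eq pw[symmetric] using assms
    by (auto intro!: derivative_eq_intros simp: power2_eq_square divide_simps)
  then show ?thesis
    by (rule has_field_derivative_transform_within_open[where S="{0<..}"]) (use assms K in auto)
qed

lemma quad_form_shift:
  "(y + h *\<^sub>R axis i 1) \<bullet> (matrix_inv C *v (y + h *\<^sub>R axis i 1)) =
     y \<bullet> (matrix_inv C *v y) + 2 * h * (matrix_inv C *v y) $ i + h\<^sup>2 * matrix_inv C $ i $ i"
proof -
  have "axis i 1 \<bullet> (matrix_inv C *v z) = (matrix_inv C *v z) $ i" for z by (simp add: inner_axis')
  moreover have "(matrix_inv C *v axis i 1) $ i = matrix_inv C $ i $ i"
    by (simp add: matrix_vector_mult_basis column_def)
  moreover have "y \<bullet> (matrix_inv C *v axis i 1) = axis i 1 \<bullet> (matrix_inv C *v y)" by (rule cov_inv_commute)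
  ultimately show ?thesis
    by (simp add: matrix_vector_right_distrib matrix_vector_mult_scaleR inner_add_left inner_add_right power2_eq_square algebra_simps)
qed

lemma component_shift:
  "(matrix_inv C *v (y + h *\<^sub>R axis i 1)) $ j = (matrix_inv C *v y) $ j + h * matrix_inv C $ j $ i"
  by (simp add: matrix_vector_right_distrib matrix_vector_mult_scaleR matrix_vector_mult_basis column_def)

lemma kernel_i_partial:
  assumes "t > 0"
  shows "has_partial i (gaussian_density (t *\<^sub>R C)) (kernel_i i t y) y"
proof -
  define \<kappa> where "\<kappa> = 1 / sqrt ((2 * pi) ^ CARD('n) * det C) * t powr (- real CARD('n) / 2)"
  have K: "gaussian_density (t *\<^sub>R C) z = \<kappa> * exp (- (z \<bullet> (matrix_inv C *v z)) / (2 * t))" for z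
    using assms by (simp only: gaussian_density_scaleR \<kappa>_def)
  show ?thesis
    using assms unfolding has_partial_def kernel_i_def K quad_form_shift
    by (auto intro!: derivative_eq_intros simp: divide_simps)
qed

lemma kernel_ij_partial:
  assumes "t > 0"
  shows "has_partial i (kernel_i j t) (kernel_ij i j t y) y"
proof -
  have "((\<lambda>h. gaussian_density (t *\<^sub>R C) (y + h *\<^sub>R axis i 1)) has_real_derivative kernel_i i t y) (at 0)"
    using kernel_i_partial[OF assms, of i y] by (simp add: has_partial_def)
  then show ?thesis
    using assms unfolding has_partial_def kernel_i_def[of j] component_shift
    by (auto intro!: derivative_eq_intros simp: kernel_ij_def kernel_i_def field_simps power2_eq_square)
qed

lemma component_continuous: "continuous_on S (\<lambda>z. (matrix_inv C *v snd z) $ i)" for S :: "(real \<times> (real^'n)) set"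
  by (intro continuous_intros continuous_on_compose2[OF matrix_vector_mult_linear_continuous_on[of UNIV]]) auto

lemma quad_bounds:
  obtains m where "m \<ge> 0" "\<And>y i. \<bar>(matrix_inv C *v y) $ i\<bar> \<le> m * norm y" "\<And>y. \<bar>y \<bullet> (matrix_inv C *v y)\<bar> \<le> m * (norm y)\<^sup>2"
proof -
  obtain m where m: "m > 0" "\<And>y. norm (matrix_inv C *v y) \<le> m * norm y"
    using linear_bounded_pos[OF matrix_vector_mul_linear[of "matrix_inv C"]] by blast
  show ?thesis
  proof (rule that)
    show "m \<ge> 0" using m by simp
    show "\<bar>(matrix_inv C *v y) $ i\<bar> \<le> m * norm y" for y i
      using component_le_norm_cart[of "matrix_inv C *v y" i] m(2)[of y] by linarith
    show "\<bar>y \<bullet> (matrix_inv C *v y)\<bar> \<le> m * (norm y)\<^sup>2" for y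
    proof -
      have "\<bar>y \<bullet> (matrix_inv C *v y)\<bar> \<le> norm y * norm (matrix_inv C *v y)" by (rule Cauchy_Schwarz_ineq2)
      also have "\<dots> \<le> norm y * (m * norm y)" by (intro mult_left_mono m) simp
      finally show ?thesis by (simp add: power2_eq_square mult_ac)
    qed
  qed
qed

lemma affine_le_mult_one_plus: "p \<ge> 0 \<Longrightarrow> q \<ge> 0 \<Longrightarrow> s \<ge> 0 \<Longrightarrow> p * s + q \<le> (p + q) * (1 + s)" for p q s :: real
  by (simp add: algebra_simps)

lemma gauss_dominated_kernel_t: "gauss_dominated kernel_t"
  unfolding kernel_t_def
proof (rule gauss_dominated_kernel_mult)
  show "continuous_on ({0<..} \<times> UNIV) (\<lambda>(t, y). (y \<bullet> (matrix_inv C *v y)) / (2 * t\<^sup>2) - real CARD('n) / (2 * t))"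
    unfolding case_prod_beta' by (intro continuous_intros quad_form_continuous) auto
  fix a :: real assume a: "a > 0"
  obtain m where m: "m \<ge> 0" "\<And>y. \<bar>y \<bullet> (matrix_inv C *v y)\<bar> \<le> m * (norm y)\<^sup>2" by (rule quad_bounds) blast
  show "\<exists>c. \<forall>t\<ge>a. \<forall>y. \<bar>(y \<bullet> (matrix_inv C *v y)) / (2 * t\<^sup>2) - real CARD('n) / (2 * t)\<bar> \<le> c * (1 + (norm y)\<^sup>2)"
  proof (intro exI[of _ "m / (2 * a\<^sup>2) + real CARD('n) / (2 * a)"] allI impI)
    fix t and y :: "real^'n" assume t: "a \<le> t"
    have "\<bar>(y \<bullet> (matrix_inv C *v y)) / (2 * t\<^sup>2) - real CARD('n) / (2 * t)\<bar>
       \<le> \<bar>(y \<bullet> (matrix_inv C *v y))\<bar> / (2 * t\<^sup>2) + real CARD('n) / (2 * t)"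
      using a t abs_triangle_ineq4[of "(y \<bullet> (matrix_inv C *v y)) / (2 * t\<^sup>2)" "real CARD('n) / (2 * t)"] by (simp add: abs_divide)
    also have "\<dots> \<le> (m * (norm y)\<^sup>2) / (2 * a\<^sup>2) + real CARD('n) / (2 * a)"
      using a t m by (intro add_mono frac_le mult_left_mono power_mono) auto
    also have "\<dots> \<le> (m / (2 * a\<^sup>2) + real CARD('n) / (2 * a)) * (1 + (norm y)\<^sup>2)"
      using a m affine_le_mult_one_plus[of "m / (2 * a\<^sup>2)" "real CARD('n) / (2 * a)" "(norm y)\<^sup>2"] by simp
    finally show "\<bar>(y \<bullet> (matrix_inv C *v y)) / (2 * t\<^sup>2) - real CARD('n) / (2 * t)\<bar>
       \<le> (m / (2 * a\<^sup>2) + real CARD('n) / (2 * a)) * (1 + (norm y)\<^sup>2)" .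
  qed
qed

lemma gauss_dominated_kernel_i: "gauss_dominated (kernel_i i)"
  unfolding kernel_i_def
proof (rule gauss_dominated_kernel_mult)
  show "continuous_on ({0<..} \<times> UNIV) (\<lambda>(t, y). - ((matrix_inv C *v y) $ i) / t)"
    unfolding case_prod_beta' by (intro continuous_intros component_continuous) auto
  fix a :: real assume a: "a > 0"
  obtain m where m: "m \<ge> 0" "\<And>y i. \<bar>(matrix_inv C *v y) $ i\<bar> \<le> m * norm y" by (rule quad_bounds) blast
  show "\<exists>c. \<forall>t\<ge>a. \<forall>y. \<bar>- ((matrix_inv C *v y) $ i) / t\<bar> \<le> c * (1 + (norm y)\<^sup>2)"
  proof (intro exI[of _ "m / a"] allI impI)
    fix t and y :: "real^'n" assume t: "a \<le> t"
    have "norm y \<le> 1 + (norm y)\<^sup>2"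
      using sum_squares_bound[of "norm y" 1] norm_ge_zero[of y] by (simp del: norm_ge_zero)
    have "\<bar>- ((matrix_inv C *v y) $ i) / t\<bar> = \<bar>(matrix_inv C *v y) $ i\<bar> / t"
      using a t by (simp add: abs_divide)
    also have "\<dots> \<le> m * norm y / a" using a t m by (intro frac_le) auto
    also have "\<dots> \<le> m * (1 + (norm y)\<^sup>2) / a"
      using a m \<open>norm y \<le> 1 + (norm y)\<^sup>2\<close> by (intro divide_right_mono mult_left_mono) auto
    finally show "\<bar>- ((matrix_inv C *v y) $ i) / t\<bar> \<le> m / a * (1 + (norm y)\<^sup>2)" by simp
  qed
qed

lemma gauss_dominated_kernel_ij: "gauss_dominated (kernel_ij i j)"
  unfolding kernel_ij_def
proof (rule gauss_dominated_kernel_mult)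
  show "continuous_on ({0<..} \<times> UNIV) (\<lambda>(t, y). (matrix_inv C *v y) $ i * (matrix_inv C *v y) $ j / t\<^sup>2 - matrix_inv C $ j $ i / t)"
    unfolding case_prod_beta' by (intro continuous_intros component_continuous) auto
  fix a :: real assume a: "a > 0"
  obtain m where m: "m \<ge> 0" "\<And>y i. \<bar>(matrix_inv C *v y) $ i\<bar> \<le> m * norm y" by (rule quad_bounds) blast
  show "\<exists>c. \<forall>t\<ge>a. \<forall>y. \<bar>(matrix_inv C *v y) $ i * (matrix_inv C *v y) $ j / t\<^sup>2 - matrix_inv C $ j $ i / t\<bar> \<le> c * (1 + (norm y)\<^sup>2)"
  proof (intro exI[of _ "m * m / a\<^sup>2 + \<bar>matrix_inv C $ j $ i\<bar> / a"] allI impI)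
    fix t and y :: "real^'n" assume t: "a \<le> t"
    let ?x = "(matrix_inv C *v y) $ i" and ?z = "(matrix_inv C *v y) $ j"
    have "\<bar>?x * ?z / t\<^sup>2 - matrix_inv C $ j $ i / t\<bar> \<le> \<bar>?x\<bar> * \<bar>?z\<bar> / t\<^sup>2 + \<bar>matrix_inv C $ j $ i\<bar> / t"
      using a t abs_triangle_ineq4[of "?x * ?z / t\<^sup>2" "matrix_inv C $ j $ i / t"] by (simp add: abs_divide abs_mult)
    also have "\<dots> \<le> (m * norm y) * (m * norm y) / a\<^sup>2 + \<bar>matrix_inv C $ j $ i\<bar> / a"
      using a t m by (intro add_mono frac_le mult_mono power_mono) auto
    also have "\<dots> \<le> (m * m / a\<^sup>2 + \<bar>matrix_inv C $ j $ i\<bar> / a) * (1 + (norm y)\<^sup>2)"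
      using a m affine_le_mult_one_plus[of "m * m / a\<^sup>2" "\<bar>matrix_inv C $ j $ i\<bar> / a" "(norm y)\<^sup>2"] by (simp add: power2_eq_square mult_ac)
    finally show "\<bar>?x * ?z / t\<^sup>2 - matrix_inv C $ j $ i / t\<bar> \<le> (m * m / a\<^sup>2 + \<bar>matrix_inv C $ j $ i\<bar> / a) * (1 + (norm y)\<^sup>2)" .
  qed
qed

text \<open>Contracting with \<open>C\<close> undoes its inverse twice: the quadratic part becomes
  \<open>y \<bullet> (matrix_inv C *v y)\<close>, and the constant part the trace of
  \<open>C ** matrix_inv C\<close>, which is the dimension.\<close>

lemma kernel_heat_equation:
  assumes "t > 0"
  shows "kernel_t t y = (1 / 2) * (\<Sum>i\<in>UNIV. \<Sum>j\<in>UNIV. C $ i $ j * kernel_ij i j t y)"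
proof -
  let ?M = "matrix_inv C" and ?K = "gaussian_density (t *\<^sub>R C) y"
  let ?v = "?M *v y"
  have q: "(\<Sum>i\<in>UNIV. \<Sum>j\<in>UNIV. C $ i $ j * (?v $ i * ?v $ j)) = y \<bullet> ?v"
  proof -
    have "(\<Sum>i\<in>UNIV. \<Sum>j\<in>UNIV. C $ i $ j * (?v $ i * ?v $ j)) = ?v \<bullet> (C *v ?v)"
      by (simp add: inner_vec_def matrix_vector_mult_def[of C] sum_distrib_left mult_ac)
    also have "C *v ?v = y" by (simp add: matrix_vector_mul_assoc cov_inv)
    finally show ?thesis by (simp add: inner_commute)
  qed
  have tr: "(\<Sum>i\<in>UNIV. \<Sum>j\<in>UNIV. C $ i $ j * ?M $ j $ i) = real CARD('n)"
  proof -
    have "(\<Sum>i\<in>UNIV. \<Sum>j\<in>UNIV. C $ i $ j * ?M $ j $ i) = (\<Sum>i\<in>UNIV. (C ** ?M) $ i $ i)"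
      by (simp add: matrix_matrix_mult_def)
    then show ?thesis by (simp add: cov_inv mat_def)
  qed
  have s: "(\<Sum>i\<in>UNIV. \<Sum>j\<in>UNIV. c * F i j) = c * (\<Sum>i\<in>UNIV. \<Sum>j\<in>UNIV. F i j)"
    for c :: real and F :: "'n \<Rightarrow> 'n \<Rightarrow> real" by (simp only: sum_distrib_left)
  have "(\<Sum>i\<in>UNIV. \<Sum>j\<in>UNIV. C $ i $ j * kernel_ij i j t y)
     = (\<Sum>i\<in>UNIV. \<Sum>j\<in>UNIV. ?K / t\<^sup>2 * (C $ i $ j * (?v $ i * ?v $ j)) - ?K / t * (C $ i $ j * ?M $ j $ i))"
    by (intro sum.cong refl) (simp add: kernel_ij_def algebra_simps)
  also have "\<dots> = ?K / t\<^sup>2 * (y \<bullet> ?v) - ?K / t * real CARD('n)"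
    by (simp only: sum_subtractf s q tr)
  finally show ?thesis
    by (simp add: kernel_t_def algebra_simps)
qed

end

section \<open>The heat flow\<close>

lemma integral_reflect_translate:
  fixes h :: "real^'n \<Rightarrow> 'b::{banach, second_countable_topology}"
  assumes h: "h \<in> borel_measurable borel"
  shows "(\<integral>y. h (u - y) \<partial>lborel) = integral\<^sup>L lborel h"
proof -
  have "integral\<^sup>L lborel h = integral\<^sup>L (density (distr lborel borel (\<lambda>x. u + (-1) *\<^sub>R x)) (\<lambda>_. ennreal (\<bar>-1\<bar> ^ DIM(real^'n)))) h"
    by (subst lborel_affine[of "-1" u]) simp_all
  also have "\<dots> = (\<integral>y. h (u - y) \<partial>lborel)"
    using h by (simp add: density_1 integral_distr)
  finally show ?thesis ..
qed

text \<open>At time 0 the covariance is singular and the kernel formula says nothing, so the initial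
  value is supplied by hand; that the two branches fit together continuously has to be
  proved.\<close>

definition heat_flow :: "real^'n^'n \<Rightarrow> (real^'n \<Rightarrow> real) \<Rightarrow> real \<Rightarrow> real^'n \<Rightarrow> real" where
  "heat_flow C f t u = (if t > 0 then \<integral>x. f x * gaussian_density (t *\<^sub>R C) (u - x) \<partial>lborel else f u)"

lemma trig_poly_bounded: "trig_poly f \<Longrightarrow> \<exists>B. \<forall>x. \<bar>f x\<bar> \<le> B"
proof (induction rule: trig_poly.induct)
  case (trig_cos k b)
  show ?case by (rule exI[of _ 1]) simp
next
  case (trig_add f g)
  then obtain A B where "\<forall>x. \<bar>f x\<bar> \<le> A" "\<forall>x. \<bar>g x\<bar> \<le> B" by blast
  then have "\<bar>f x + g x\<bar> \<le> A + B" for x using abs_triangle_ineq[of "f x" "g x"] by (smt (verit))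
  then show ?case by blast
next
  case (trig_scale f c)
  then obtain A where "\<forall>x. \<bar>f x\<bar> \<le> A" by blast
  then have "\<bar>c * f x\<bar> \<le> \<bar>c\<bar> * A" for x by (simp add: abs_mult mult_left_mono)
  then show ?case by blast
qed

context
  fixes C A :: "real^'n^'n"
  assumes A: "det A \<noteq> 0" and C: "C = A ** transpose A"
begin

text \<open>Rescaling the factor by \<open>sqrt t\<close> lets every statement about the covariance
  \<open>A ** transpose A\<close> be used at time \<open>t\<close>.\<close>

lemma scaled_factor:
  assumes "t > 0"
  shows "t *\<^sub>R C = (sqrt t *\<^sub>R A) ** transpose (sqrt t *\<^sub>R A)" and "det (sqrt t *\<^sub>R A) \<noteq> 0"
proof -
  have "(c *\<^sub>R A) ** transpose (c *\<^sub>R A) = (c * c) *\<^sub>R (A ** transpose A)" for c :: real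
    by (simp add: matrix_matrix_mult_def transpose_def vec_eq_iff sum_distrib_left mult_ac)
  then show "t *\<^sub>R C = (sqrt t *\<^sub>R A) ** transpose (sqrt t *\<^sub>R A)" using assms by (simp add: C[symmetric])
  show "det (sqrt t *\<^sub>R A) \<noteq> 0" using assms A by (simp add: det_scaleR)
qed

lemma heat_char:
  assumes "t > 0"
  shows "(\<integral>x. cis (\<theta> \<bullet> x) * gaussian_density (t *\<^sub>R C) x \<partial>lborel) = exp (- t * (\<theta> \<bullet> (C *v \<theta>)) / 2)"
  using gaussian_density_char(2)[OF scaled_factor(2)[OF assms], of \<theta>]
  unfolding scaled_factor(1)[OF assms, symmetric]
  by (simp add: matrix_vector_mult_scaleR_left)

lemma heat_integrable: "t > 0 \<Longrightarrow> integrable lborel (gaussian_density (t *\<^sub>R C))"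
  using gaussian_density_char(1)[OF scaled_factor(2)] scaled_factor(1) by simp

lemma heat_kernel_nonneg: "t > 0 \<Longrightarrow> gaussian_density (t *\<^sub>R C) y \<ge> 0"
  unfolding gaussian_density_scaleR[OF A C] by (auto simp: C det_mul)

lemma heat_kernel_total: "t > 0 \<Longrightarrow> integral\<^sup>L lborel (gaussian_density (t *\<^sub>R C)) = 1"
proof -
  assume t: "t > 0"
  have "complex_of_real (integral\<^sup>L lborel (gaussian_density (t *\<^sub>R C))) = 1"
    using heat_char[OF t, of 0] by simp
  then show ?thesis by (simp only: of_real_eq_1_iff)
qed

lemma heat_flow_eq:
  assumes "continuous_on UNIV f" "t > 0"
  shows "heat_flow C f t u = (\<integral>y. f (u - y) * gaussian_density (t *\<^sub>R C) y \<partial>lborel)"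
proof -
  have "(\<lambda>x. f x * gaussian_density (t *\<^sub>R C) (u - x)) \<in> borel_measurable borel"
    using borel_measurable_continuous_onI[OF assms(1)] by measurable
  from integral_reflect_translate[OF this, of u] show ?thesis using assms(2) by (simp add: heat_flow_def)
qed

lemma heat_flow_torus_fun:
  assumes "continuous_on UNIV f" "torus_fun f"
  shows "torus_fun (heat_flow C f t)"
proof (rule torus_funI)
  fix u k
  show "heat_flow C f t (u + lat k) = heat_flow C f t u"
  proof (cases "t > 0")
    case True
    have "f (u + lat k - y) = f (u - y)" for y
      using torus_fun_lat[OF assms(2), of "u - y" k] by (simp add: algebra_simps)
    then show ?thesis by (simp add: heat_flow_eq[OF assms(1) True])
  next
    case False
    then show ?thesis by (simp add: heat_flow_def torus_fun_lat[OF assms(2)])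
  qed
qed

text \<open>Cosines are eigenfunctions of the flow, the factor being the characteristic function of
  the kernel, which is real and even. The formula includes \<open>t = 0\<close>, and this is how
  continuity at time 0 is reached.\<close>

lemma heat_flow_cos:
  assumes "t \<ge> 0"
  shows "heat_flow C (\<lambda>x. cos (\<theta> \<bullet> x + b)) t u = exp (- t * (\<theta> \<bullet> (C *v \<theta>)) / 2) * cos (\<theta> \<bullet> u + b)"
proof (cases "t > 0")
  case True
  have "heat_flow C (\<lambda>x. cos (\<theta> \<bullet> x + b)) t u = (\<integral>y. cos (\<theta> \<bullet> (u - y) + b) * gaussian_density (t *\<^sub>R C) y \<partial>lborel)"
    by (intro heat_flow_eq continuous_intros True)
  also have "\<dots> = (\<integral>y. Re (cis (\<theta> \<bullet> u + b) * (cis ((- \<theta>) \<bullet> y) * gaussian_density (t *\<^sub>R C) y)) \<partial>lborel)"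
  proof (intro Bochner_Integration.integral_cong refl)
    fix y
    have "\<theta> \<bullet> (u - y) + b = (\<theta> \<bullet> u + b) - \<theta> \<bullet> y" by (simp add: inner_diff_right)
    then show "cos (\<theta> \<bullet> (u - y) + b) * gaussian_density (t *\<^sub>R C) y = Re (cis (\<theta> \<bullet> u + b) * (cis ((- \<theta>) \<bullet> y) * gaussian_density (t *\<^sub>R C) y))"
      by (simp add: cos_diff algebra_simps)
  qed
  also have "\<dots> = Re (\<integral>y. cis (\<theta> \<bullet> u + b) * (cis ((- \<theta>) \<bullet> y) * gaussian_density (t *\<^sub>R C) y) \<partial>lborel)"
  proof (rule integral_Re)
    show "integrable lborel (\<lambda>y. cis (\<theta> \<bullet> u + b) * (cis ((- \<theta>) \<bullet> y) * gaussian_density (t *\<^sub>R C) y))"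
    proof (rule Bochner_Integration.integrable_bound[OF heat_integrable[OF True]])
      show "(\<lambda>y. cis (\<theta> \<bullet> u + b) * (cis ((- \<theta>) \<bullet> y) * gaussian_density (t *\<^sub>R C) y)) \<in> borel_measurable lborel"
        by (intro borel_measurable_times) (auto simp: cis_conv_exp)
    qed (auto simp: norm_mult)
  qed
  also have "(\<integral>y. cis (\<theta> \<bullet> u + b) * (cis ((- \<theta>) \<bullet> y) * gaussian_density (t *\<^sub>R C) y) \<partial>lborel) = cis (\<theta> \<bullet> u + b) * exp (- t * ((- \<theta>) \<bullet> (C *v (- \<theta>))) / 2)"
    by (subst integral_mult_right_zero, subst heat_char[OF True]) simp
  also have "(- \<theta>) \<bullet> (C *v (- \<theta>)) = \<theta> \<bullet> (C *v \<theta>)"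
    using matrix_vector_mult_scaleR[of C "-1" \<theta>] by simp
  finally show ?thesis by simp
next
  case False
  then show ?thesis using assms by (simp add: heat_flow_def)
qed

lemma flow_integrable:
  assumes "continuous_on UNIV f" "\<And>x. \<bar>f x\<bar> \<le> B" "t > 0"
  shows "integrable lborel (\<lambda>x. f x * gaussian_density (t *\<^sub>R C) (u - x))"
  using gauss_conv_integrable[OF assms(1,2) gauss_dominated_kernel[OF A C] assms(3)] .

lemma heat_flow_add:
  assumes "continuous_on UNIV f" "\<And>x. \<bar>f x\<bar> \<le> B" "continuous_on UNIV g" "\<And>x. \<bar>g x\<bar> \<le> B'"
  shows "heat_flow C (\<lambda>x. f x + g x) t u = heat_flow C f t u + heat_flow C g t u"
  using flow_integrable[OF assms(1,2)] flow_integrable[OF assms(3,4)]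
  by (simp add: heat_flow_def distrib_right)

lemma heat_flow_scale: "heat_flow C (\<lambda>x. c * f x) t u = c * heat_flow C f t u"
  by (simp add: heat_flow_def mult.assoc)

text \<open>The kernel is nonnegative with total mass 1, so averaging against it cannot enlarge a
  uniform distance.\<close>

lemma heat_flow_close:
  assumes f: "continuous_on UNIV f" "\<And>x. \<bar>f x\<bar> \<le> B" and g: "continuous_on UNIV g" "\<And>x. \<bar>g x\<bar> \<le> B'"
    and e: "\<And>x. \<bar>f x - g x\<bar> \<le> e"
  shows "\<bar>heat_flow C f t u - heat_flow C g t u\<bar> \<le> e"
proof (cases "t > 0")
  case True
  let ?G = "gaussian_density (t *\<^sub>R C)"
  have Gi: "integrable lborel (\<lambda>x. ?G (u - x))"
    using flow_integrable[of "\<lambda>_. 1" 1, OF _ _ True] by simp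
  have tot: "(\<integral>x. ?G (u - x) \<partial>lborel) = 1"
    by (subst integral_reflect_translate) (auto simp: heat_kernel_total[OF True])
  have "heat_flow C f t u - heat_flow C g t u = (\<integral>x. f x * ?G (u - x) - g x * ?G (u - x) \<partial>lborel)"
    using flow_integrable[OF f True] flow_integrable[OF g True] True by (simp add: heat_flow_def)
  also have "\<bar>\<dots>\<bar> \<le> (\<integral>x. \<bar>f x * ?G (u - x) - g x * ?G (u - x)\<bar> \<partial>lborel)"
    by (rule integral_abs_bound)
  also have "\<dots> \<le> (\<integral>x. e * ?G (u - x) \<partial>lborel)"
  proof (rule integral_mono)
    show "integrable lborel (\<lambda>x. \<bar>f x * ?G (u - x) - g x * ?G (u - x)\<bar>)"
      by (intro integrable_abs Bochner_Integration.integrable_diff flow_integrable[OF f True] flow_integrable[OF g True])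
    show "integrable lborel (\<lambda>x. e * ?G (u - x))" using Gi by simp
    fix x
    have "\<bar>f x * ?G (u - x) - g x * ?G (u - x)\<bar> = \<bar>f x - g x\<bar> * ?G (u - x)"
      using heat_kernel_nonneg[OF True, of "u - x"] by (simp add: left_diff_distrib[symmetric] abs_mult)
    also have "\<dots> \<le> e * ?G (u - x)" by (intro mult_right_mono e heat_kernel_nonneg True)
    finally show "\<bar>f x * ?G (u - x) - g x * ?G (u - x)\<bar> \<le> e * ?G (u - x)" .
  qed
  also have "\<dots> = e" by (simp add: tot)
  finally show ?thesis .
next
  case False
  then show ?thesis using e by (simp add: heat_flow_def)
qed

lemma heat_flow_trig_continuous:
  assumes "trig_poly f"
  shows "continuous_on ({0..} \<times> UNIV) (\<lambda>(t, u). heat_flow C f t u)"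
  using assms
proof induction
  case (trig_cos k b)
  let ?\<theta> = "(2 * pi) *\<^sub>R lat k"
  have "continuous_on ({0..} \<times> UNIV) (\<lambda>z. exp (- fst z * (?\<theta> \<bullet> (C *v ?\<theta>)) / 2) * cos (?\<theta> \<bullet> snd z + b))"
    by (intro continuous_intros) auto
  moreover have "exp (- fst z * (?\<theta> \<bullet> (C *v ?\<theta>)) / 2) * cos (?\<theta> \<bullet> snd z + b) = heat_flow C (\<lambda>x. cos (?\<theta> \<bullet> x + b)) (fst z) (snd z)"
    if "z \<in> {0..} \<times> UNIV" for z :: "real \<times> (real^'n)"
    by (rule heat_flow_cos[symmetric]) (use that in auto)
  ultimately show ?case unfolding case_prod_beta' by (rule continuous_on_eq)
next
  case (trig_add f g)
  obtain B where B: "\<And>x. \<bar>f x\<bar> \<le> B" using trig_poly_bounded[OF trig_add.hyps(1)] by blast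
  obtain B' where B': "\<And>x. \<bar>g x\<bar> \<le> B'" using trig_poly_bounded[OF trig_add.hyps(2)] by blast
  from B B' have "heat_flow C (\<lambda>x. f x + g x) t u = heat_flow C f t u + heat_flow C g t u" for t u
    using trig_add.hyps by (intro heat_flow_add trig_poly_continuous)
  then show ?case using continuous_on_add[OF trig_add.IH] by (simp add: case_prod_beta')
next
  case (trig_scale f c)
  then show ?case by (auto simp: heat_flow_scale case_prod_beta' intro!: continuous_intros)
qed

text \<open>The approximation error is at most \<open>1 / Suc n\<close> simultaneously at all times
  and positions, so the flow is a uniform limit of flows whose joint continuity is visible from the
  eigenvalues.\<close>

lemma heat_flow_continuous:
  assumes per: "torus_fun f" and cont: "continuous_on UNIV f" and bd: "\<And>x. \<bar>f x\<bar> \<le> B"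
  shows "continuous_on ({0..} \<times> UNIV) (\<lambda>(t, u). heat_flow C f t u)"
proof -
  have "\<forall>n. \<exists>g. trig_poly g \<and> (\<forall>x. \<bar>f x - g x\<bar> < 1 / Suc n)"
  proof
    fix n
    show "\<exists>g. trig_poly g \<and> (\<forall>x. \<bar>f x - g x\<bar> < 1 / Suc n)"
      by (rule trig_poly_dense[OF per cont, of "1 / Suc n"]) (simp, blast)
  qed
  from choice[OF this] obtain g where g: "\<And>n. trig_poly (g n)" "\<And>n x. \<bar>f x - g n x\<bar> < 1 / Suc n"
    by blast
  have close: "\<bar>heat_flow C f t u - heat_flow C (g n) t u\<bar> \<le> 1 / Suc n" for n t u
  proof -
    obtain B' where B': "\<And>x. \<bar>g n x\<bar> \<le> B'" using trig_poly_bounded[OF g(1)] by blast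
    show ?thesis
      by (rule heat_flow_close[OF cont bd trig_poly_continuous[OF g(1)] B']) (rule less_imp_le[OF g(2)])
  qed
  have "uniform_limit ({0..} \<times> UNIV) (\<lambda>n (t, u). heat_flow C (g n) t u) (\<lambda>(t, u). heat_flow C f t u) sequentially"
  proof (rule uniform_limitI)
    fix e :: real assume "e > 0"
    then have "\<forall>\<^sub>F n in sequentially. 1 / Suc n < e"
      using order_tendstoD(2)[OF LIMSEQ_inverse_real_of_nat] by (simp add: inverse_eq_divide)
    then show "\<forall>\<^sub>F n in sequentially. \<forall>x\<in>{0..} \<times> UNIV. dist (case x of (t, u) \<Rightarrow> heat_flow C (g n) t u) (case x of (t, u) \<Rightarrow> heat_flow C f t u) < e"
    proof eventually_elim
      case (elim n)
      then show ?case using close[of _ _ n] by (auto simp: dist_real_def abs_minus_commute intro: le_less_trans)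
    qed
  qed
  then show ?thesis
    by (rule uniform_limit_theorem[rotated]) (auto intro!: always_eventually heat_flow_trig_continuous g)
qed

lemma heat_flow_solution:
  assumes per: "torus_fun f" and cont: "continuous_on UNIV f" and bd: "\<And>x. \<bar>f x\<bar> \<le> B"
  shows "heat_solution C f (heat_flow C f)"
  unfolding heat_solution_def
proof (intro conjI allI impI)
  show "torus_fun (heat_flow C f t)" for t by (rule heat_flow_torus_fun[OF cont per])
  show "heat_flow C f 0 u = f u" for u by (simp add: heat_flow_def)
  show "continuous_on ({0..} \<times> UNIV) (\<lambda>(t, u). heat_flow C f t u)" by (rule heat_flow_continuous[OF per cont bd])
  note cv = gauss_conv_continuous[OF cont bd]
  have flow: "heat_flow C f t = gauss_conv f (\<lambda>t. gaussian_density (t *\<^sub>R C)) t" if "t > 0" for t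
    using that by (auto simp: heat_flow_def gauss_conv_def)
  show "\<exists>\<rho>t \<rho>i \<rho>ij.
       continuous_on ({0<..} \<times> UNIV) (\<lambda>(t, u). \<rho>t t u) \<and>
       (\<forall>i. continuous_on ({0<..} \<times> UNIV) (\<lambda>(t, u). \<rho>i i t u)) \<and>
       (\<forall>i j. continuous_on ({0<..} \<times> UNIV) (\<lambda>(t, u). \<rho>ij i j t u)) \<and>
       (\<forall>t>0. \<forall>u.
           ((\<lambda>s. heat_flow C f s u) has_real_derivative \<rho>t t u) (at t) \<and>
           (\<forall>i. has_partial i (heat_flow C f t) (\<rho>i i t u) u) \<and>
           (\<forall>i j. has_partial i (\<rho>i j t) (\<rho>ij i j t u) u) \<and>
           \<rho>t t u = 1 / 2 * (\<Sum>i\<in>UNIV. \<Sum>j\<in>UNIV. C $ i $ j * \<rho>ij i j t u))"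
  proof (intro exI conjI allI impI)
    show "continuous_on ({0<..} \<times> UNIV) (\<lambda>(t, u). gauss_conv f (kernel_t C) t u)"
      by (intro cv gauss_dominated_kernel_t[OF A C])
    show "continuous_on ({0<..} \<times> UNIV) (\<lambda>(t, u). gauss_conv f (kernel_i C i) t u)" for i
      by (intro cv gauss_dominated_kernel_i[OF A C])
    show "continuous_on ({0<..} \<times> UNIV) (\<lambda>(t, u). gauss_conv f (kernel_ij C i j) t u)" for i j
      by (intro cv gauss_dominated_kernel_ij[OF A C])
    fix t :: real and u assume t: "t > 0"
    have "((\<lambda>s. gauss_conv f (\<lambda>t. gaussian_density (t *\<^sub>R C)) s u) has_real_derivative gauss_conv f (kernel_t C) t u) (at t)"
      by (rule gauss_conv_time_derivative[OF cont bd gauss_dominated_kernel[OF A C] gauss_dominated_kernel_t[OF A C] kernel_t_derivative[OF A C] t])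
    \<comment> \<open>The flow coincides with the convolution only at positive times; these form an
      open set around \<open>t\<close>, which is enough for the derivative.\<close>
    then show "((\<lambda>s. heat_flow C f s u) has_real_derivative gauss_conv f (kernel_t C) t u) (at t)"
      by (rule has_field_derivative_transform_within_open[where S="{0<..}"]) (use t flow in auto)
    show "has_partial i (heat_flow C f t) (gauss_conv f (kernel_i C i) t u) u" for i
      unfolding flow[OF t]
      by (rule gauss_conv_partial[OF cont bd gauss_dominated_kernel[OF A C] gauss_dominated_kernel_i[OF A C] kernel_i_partial[OF A C] t])
    show "has_partial i (gauss_conv f (kernel_i C j) t) (gauss_conv f (kernel_ij C i j) t u) u" for i j
      by (rule gauss_conv_partial[OF cont bd gauss_dominated_kernel_i[OF A C] gauss_dominated_kernel_ij[OF A C] kernel_ij_partial[OF A C] t])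
    show "gauss_conv f (kernel_t C) t u = 1 / 2 * (\<Sum>i\<in>UNIV. \<Sum>j\<in>UNIV. C $ i $ j * gauss_conv f (kernel_ij C i j) t u)"
    proof -
      note int = gauss_conv_integrable[OF cont bd gauss_dominated_kernel_ij[OF A C] t]
      have "gauss_conv f (kernel_t C) t u = (\<integral>x. 1 / 2 * (\<Sum>i\<in>UNIV. \<Sum>j\<in>UNIV. C $ i $ j * (f x * kernel_ij C i j t (u - x))) \<partial>lborel)"
        unfolding gauss_conv_def kernel_heat_equation[OF A C t]
        by (intro Bochner_Integration.integral_cong refl) (simp add: sum_distrib_left mult_ac)
      also have "\<dots> = 1 / 2 * (\<Sum>i\<in>UNIV. \<Sum>j\<in>UNIV. C $ i $ j * gauss_conv f (kernel_ij C i j) t u)"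
        unfolding gauss_conv_def
        by (subst integral_mult_right_zero, subst Bochner_Integration.integral_sum, intro Bochner_Integration.integrable_sum integrable_mult_right int,
            subst Bochner_Integration.integral_sum, intro integrable_mult_right int, subst integral_mult_right_zero, rule refl)
      finally show ?thesis .
    qed
  qed
qed

end

section \<open>The transport equation\<close>

text \<open>Half-open, so that its lattice translates cover every point exactly once; it differs
  from the closed cell by a null set.\<close>

definition half_open_cube :: "(real^'n) set" where
  "half_open_cube = {x. \<forall>i. 0 \<le> x $ i \<and> x $ i < 1}"

lemma half_open_cube_sets [measurable]: "(half_open_cube :: (real^'n::finite) set) \<in> sets borel"
proof -
  have "(half_open_cube :: (real^'n) set) = (\<Inter>i::'n. {x. 0 \<le> x $ i} \<inter> {x. x $ i < 1})" by (auto simp: half_open_cube_def)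
  also have "\<dots> \<in> sets borel"
    by (intro sets.finite_INT sets.Int borel_closed borel_open closed_Collect_le open_Collect_less continuous_intros) auto
  finally show ?thesis .
qed

lemma AE_half_open_cube: "AE x in lborel. (x \<in> half_open_cube) = (x \<in> (cbox 0 1 :: (real^'n) set))"
proof -
  have "emeasure lborel (cbox 0 1 - box 0 1 :: (real^'n) set) = 0"
    by (subst emeasure_Diff) (auto simp: box_subset_cbox emeasure_lborel_cbox_eq emeasure_lborel_box_eq Basis_vec_def inner_axis)
  then have "AE x in lborel. x \<notin> (cbox 0 1 - box 0 1 :: (real^'n) set)"
    by (intro AE_not_in) (auto simp: null_sets_def)
  then show ?thesis
    by eventually_elim (auto simp: half_open_cube_def mem_box_cart less_imp_le)
qed

lemma in_half_open_cube_iff: "x - lat k \<in> half_open_cube \<longleftrightarrow> k = floor_vec x"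
proof -
  have "0 \<le> x $ i - of_int (k $ i) \<and> x $ i - of_int (k $ i) < 1 \<longleftrightarrow> k $ i = \<lfloor>x $ i\<rfloor>" for i
    by linarith
  then show ?thesis by (simp add: half_open_cube_def floor_vec_def lat_def vec_eq_iff)
qed

lemma integral_translate:
  fixes h :: "real^'n \<Rightarrow> real"
  assumes "h \<in> borel_measurable borel"
  shows "(\<integral>x. h (x + c) \<partial>lborel) = integral\<^sup>L lborel h"
proof -
  have "integral\<^sup>L lborel h = integral\<^sup>L (distr lborel borel ((+) c)) h" by (simp add: lborel_distr_plus)
  also have "\<dots> = (\<integral>x. h (x + c) \<partial>lborel)" using assms by (simp add: integral_distr add.commute)
  finally show ?thesis ..
qed

lemma integrable_indicator_bounded:
  fixes f :: "real^'n \<Rightarrow> real"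
  assumes cont: "continuous_on UNIV f" and S: "S \<in> sets borel" "bounded S"
  shows "integrable lborel (\<lambda>x. indicator S x * f x)"
proof -
  obtain a b where ab: "S \<subseteq> cbox a b" using bounded_subset_cbox_symmetric[OF S(2)] by blast
  have "integrable lborel (\<lambda>x. indicator (cbox a b) x *\<^sub>R f x)"
    by (rule borel_integrable_compact) (auto intro: continuous_on_subset[OF cont])
  then show ?thesis
    by (rule Bochner_Integration.integrable_bound)
       (use ab S borel_measurable_continuous_onI[OF cont] in \<open>auto simp: indicator_def intro!: AE_I2\<close>)
qed

text \<open>The shifted cell is cut along the lattice translates of the cell, which tile the space, and is
  reassembled by periodicity.\<close>

theorem cell_integral_shift:
  fixes f :: "real^'n \<Rightarrow> real"
  assumes per: "torus_fun f" and cont: "continuous_on UNIV f"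
  shows "(LINT u:cbox 0 1|lborel. f (u + a)) = (LINT u:cbox 0 1|lborel. f u)"
proof -
  let ?Q = "half_open_cube :: (real^'n) set"
  have [measurable]: "f \<in> borel_measurable borel" by (rule borel_measurable_continuous_onI[OF cont])
  \<comment> \<open>The cell shifted by \<open>a\<close> has side 1, so in each coordinate it meets
    only the unit interval starting at the floor of \<open>a $ i\<close> and the next one.\<close>
  define K where "K = {k :: int^'n. \<forall>i. \<lfloor>a $ i\<rfloor> \<le> k $ i \<and> k $ i \<le> \<lfloor>a $ i\<rfloor> + 1}"
  have K: "finite K" unfolding K_def by (rule finite_int_vec_box)
  have cube: "(LINT u:cbox 0 1|lborel. g u) = (\<integral>u. indicator ?Q u * g u \<partial>lborel)"
    if [measurable]: "g \<in> borel_measurable borel" for g :: "real^'n \<Rightarrow> real"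
    unfolding set_lebesgue_integral_def
    by (rule integral_cong_AE) (auto intro!: eventually_mono[OF AE_half_open_cube] simp: indicator_def)
  have sum1: "(\<Sum>k\<in>K. indicator ?Q (x - lat k)) = (1 :: real)" if "x - a \<in> ?Q" for x
  proof -
    have "0 \<le> x $ i - a $ i \<and> x $ i - a $ i < 1" for i using that by (simp add: half_open_cube_def)
    then have "\<lfloor>a $ i\<rfloor> \<le> \<lfloor>x $ i\<rfloor> \<and> \<lfloor>x $ i\<rfloor> \<le> \<lfloor>a $ i\<rfloor> + 1" for i by (smt (verit) floor_mono floor_add_int le_floor_iff floor_le_iff of_int_1 floor_correct)
    then have "floor_vec x \<in> K" by (simp add: K_def floor_vec_def)
    have "(\<Sum>k\<in>K. indicator ?Q (x - lat k)) = (\<Sum>k\<in>K. if k = floor_vec x then 1 else (0::real))"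
      by (intro sum.cong refl) (simp add: indicator_def in_half_open_cube_iff)
    then show ?thesis using K \<open>floor_vec x \<in> K\<close> by simp
  qed
  \<comment> \<open>The same finite set serves the reassembly: for \<open>y\<close> in the cell
    exactly one \<open>k\<close> in \<open>K\<close> moves \<open>y\<close> into the shifted
    cell.\<close>
  have sum2: "(\<Sum>k\<in>K. indicator ?Q (y + lat k - a)) = (1 :: real)" if "y \<in> ?Q" for y
  proof -
    have y: "0 \<le> y $ i \<and> y $ i < 1" for i using that by (simp add: half_open_cube_def)
    have "\<lfloor>a $ i\<rfloor> \<le> - \<lfloor>y $ i - a $ i\<rfloor> \<and> - \<lfloor>y $ i - a $ i\<rfloor> \<le> \<lfloor>a $ i\<rfloor> + 1" for i using y[of i] by linarith
    then have *: "- floor_vec (y - a) \<in> K" by (simp add: K_def floor_vec_def)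
    have "(\<Sum>k\<in>K. indicator ?Q (y + lat k - a)) = (\<Sum>k\<in>K. if k = - floor_vec (y - a) then 1 else (0::real))"
    proof (intro sum.cong refl)
      fix k
      have "y + lat k - a = (y - a) - lat (- k)" by (simp add: lat_uminus)
      then have "y + lat k - a \<in> ?Q \<longleftrightarrow> k = - floor_vec (y - a)"
        using in_half_open_cube_iff[of "y - a" "- k"] by (metis minus_equation_iff)
      then show "indicator ?Q (y + lat k - a) = (if k = - floor_vec (y - a) then 1 else (0::real))"
        by (simp add: indicator_def)
    qed
    then show ?thesis using K * by simp
  qed
  have bdQ: "bounded ?Q" by (rule bounded_subset[OF bounded_cbox[of 0 1]]) (auto simp: half_open_cube_def mem_box_cart less_imp_le)
  define F where "F k x = indicator ?Q (x - lat k) * indicator ?Q (x - a) * f x" for k x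
  have Fm [measurable]: "F k \<in> borel_measurable borel" for k unfolding F_def by measurable
  have ind: "indicator ?Q (x - c) = indicator ((+) c ` ?Q) x" for x c
    by (auto simp: indicator_def image_iff algebra_simps)
  have int: "integrable lborel (\<lambda>x. indicator ?Q (x - lat k) * (indicator ?Q (x - a) * f x))" for k
  proof (rule Bochner_Integration.integrable_bound)
    have "(+) a ` ?Q = (\<lambda>x. x - a) -` ?Q \<inter> space borel" by (auto simp: image_iff) (metis diff_add_cancel add.commute)
    also have "\<dots> \<in> sets borel" by measurable
    finally have "integrable lborel (\<lambda>x. indicator ((+) a ` ?Q) x * f x)"
      by (intro integrable_indicator_bounded[OF cont] bounded_translation bdQ)
    then show "integrable lborel (\<lambda>x. indicator ?Q (x - a) * f x)" by (simp add: ind)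
  qed (auto simp: indicator_def)
  have "(LINT u:cbox 0 1|lborel. f (u + a)) = (\<integral>u. indicator ?Q u * f (u + a) \<partial>lborel)"
    by (rule cube) measurable
  also have "\<dots> = (\<integral>x. indicator ?Q (x - a) * f x \<partial>lborel)"
    using integral_translate[of "\<lambda>x. indicator ?Q (x - a) * f x" a] by simp
  also have "\<dots> = (\<integral>x. (\<Sum>k\<in>K. indicator ?Q (x - lat k) * (indicator ?Q (x - a) * f x)) \<partial>lborel)"
  proof (intro Bochner_Integration.integral_cong refl)
    show "indicator ?Q (x - a) * f x = (\<Sum>k\<in>K. indicator ?Q (x - lat k) * (indicator ?Q (x - a) * f x))" for x
      by (cases "x - a \<in> ?Q") (simp_all add: sum1 flip: sum_distrib_right)
  qed
  also have "\<dots> = (\<Sum>k\<in>K. \<integral>x. indicator ?Q (x - lat k) * (indicator ?Q (x - a) * f x) \<partial>lborel)"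
    by (rule Bochner_Integration.integral_sum) (rule int)
  also have "\<dots> = (\<Sum>k\<in>K. \<integral>y. indicator ?Q y * (indicator ?Q (y + lat k - a) * f y) \<partial>lborel)"
  proof (intro sum.cong refl)
    fix k
    show "(\<integral>x. indicator ?Q (x - lat k) * (indicator ?Q (x - a) * f x) \<partial>lborel) = (\<integral>y. indicator ?Q y * (indicator ?Q (y + lat k - a) * f y) \<partial>lborel)"
      using integral_translate[of "\<lambda>x. indicator ?Q (x - lat k) * (indicator ?Q (x - a) * f x)" "lat k"]
      by (simp add: torus_fun_lat[OF per])
  qed
  also have "\<dots> = (\<integral>y. (\<Sum>k\<in>K. indicator ?Q y * (indicator ?Q (y + lat k - a) * f y)) \<partial>lborel)"
  proof (rule Bochner_Integration.integral_sum[symmetric])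
    fix k
    have "integrable lborel (\<lambda>x. indicator ?Q x * f x)" by (rule integrable_indicator_bounded[OF cont _ bdQ]) simp
    then show "integrable lborel (\<lambda>y. indicator ?Q y * (indicator ?Q (y + lat k - a) * f y))"
      by (rule Bochner_Integration.integrable_bound) (auto simp: indicator_def)
  qed
  also have "\<dots> = (\<integral>y. indicator ?Q y * f y \<partial>lborel)"
  proof (intro Bochner_Integration.integral_cong refl)
    show "(\<Sum>k\<in>K. indicator ?Q y * (indicator ?Q (y + lat k - a) * f y)) = indicator ?Q y * f y" for y
      by (cases "y \<in> ?Q") (simp_all add: sum2 flip: sum_distrib_right)
  qed
  also have "\<dots> = (LINT u:cbox 0 1|lborel. f u)" by (rule cube[symmetric]) measurable
  finally show ?thesis .
qed

section \<open>Weak and classical solutions by shifting along characteristics\<close>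

text \<open>Collects what the weak formulation sees of a test function. The derivative is periodic
  because the function is invariant under lattice translations and its derivative at a point is
  unique.\<close>

lemma test_fun_derivative:
  fixes \<phi> :: "real \<times> (real^'n) \<Rightarrow> real"
  assumes \<phi>: "test_fun \<phi>"
  obtains D where "\<And>z. (\<phi> has_derivative D z) (at z)" "\<And>v. continuous_on UNIV (\<lambda>z. D z v)"
    "\<And>z. frechet_derivative \<phi> (at z) = D z"
    "\<And>t u k. D (t, u + lat k) = D (t, u)"
proof -
  have "C_k (Suc 0) \<phi>" using \<phi> by (simp add: test_fun_def smooth_fun_def del: C_k.simps)
  then obtain D where D: "\<And>z. (\<phi> has_derivative D z) (at z)" "\<And>v. continuous_on UNIV (\<lambda>z. D z v)"
    by auto
  show ?thesis
  proof (rule that)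
    show "(\<phi> has_derivative D z) (at z)" for z by (rule D)
    show "continuous_on UNIV (\<lambda>z. D z v)" for v by (rule D)
    show "frechet_derivative \<phi> (at z) = D z" for z by (rule frechet_derivative_at[OF D(1), symmetric])
    fix t u k
    have "\<phi> (z + (0, lat k)) = \<phi> z" for z
    proof (cases z)
      case (Pair s v)
      then show ?thesis using \<phi> torus_fun_lat[of "\<lambda>u. \<phi> (s, u)" v k] by (simp add: test_fun_def)
    qed
    have s: "((\<lambda>z::real \<times> (real^'n). z + (0, lat k)) has_derivative (\<lambda>x. x)) (at (t, u))"
      by (auto intro!: derivative_eq_intros)
    have "((\<lambda>z. \<phi> (z + (0, lat k))) has_derivative D (t, u + lat k)) (at (t, u))"
      using has_derivative_compose[OF s, of \<phi> "D (t, u + lat k)"] D(1)[of "(t, u + lat k)"] by simp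
    with \<open>\<And>z. \<phi> (z + (0, lat k)) = \<phi> z\<close> have "(\<phi> has_derivative D (t, u + lat k)) (at (t, u))" by simp
    then show "D (t, u + lat k) = D (t, u)" by (rule has_derivative_unique[OF _ D(1)])
  qed
qed

text \<open>The operator is a single directional derivative, along the characteristic direction
  \<open>(1, m)\<close>.\<close>

lemma transport_op_linear:
  assumes "linear D"
  shows "transport_op m D = D (1, m)"
proof -
  interpret linear D by fact
  have "m = (\<Sum>i\<in>UNIV. m $ i *\<^sub>R axis i 1)" by (simp add: vec_eq_iff axis_def if_distrib cong: if_cong)
  then have "(1, m) = (1, 0) + (\<Sum>i\<in>UNIV. m $ i *\<^sub>R (0, axis i 1))"
    by (simp add: prod_eq_iff fst_sum snd_sum)
  from arg_cong[OF this, of D]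
  have "D (1, m) = D (1, 0) + (\<Sum>i\<in>UNIV. D (m $ i *\<^sub>R (0, axis i 1)))" by (simp only: add sum)
  then show ?thesis by (simp add: transport_op_def scale del: scaleR_Pair)
qed

lemma transport_weak_shift:
  fixes f :: "real^'n \<Rightarrow> real"
  assumes per: "torus_fun f" and cont: "continuous_on UNIV f"
  shows "transport_weak m f (\<lambda>t u. f (u - t *\<^sub>R m))"
  unfolding transport_weak_def
proof (intro conjI allI impI)
  show "torus_fun (\<lambda>u. f (u - t *\<^sub>R m))" for t
  proof (rule torus_funI)
    show "f (u + lat k - t *\<^sub>R m) = f (u - t *\<^sub>R m)" for u k
      using torus_fun_lat[OF per, of "u - t *\<^sub>R m" k] by (simp add: algebra_simps)
  qed
  show "f (u - 0 *\<^sub>R m) = f u" for u by simp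
  have cf: "continuous_on S (\<lambda>z. f (snd z - fst z *\<^sub>R m))" for S
    by (intro continuous_on_compose2[OF cont] continuous_intros) auto
  show "set_integrable lborel ({0..T} \<times> cbox 0 1) (\<lambda>(t, u). f (u - t *\<^sub>R m))" for T
    unfolding set_integrable_def case_prod_beta'
    by (intro borel_integrable_compact cf compact_Times) auto
  fix \<phi> :: "real \<times> (real^'n) \<Rightarrow> real" assume \<phi>: "test_fun \<phi>"
  obtain D where D: "\<And>z. (\<phi> has_derivative D z) (at z)" "\<And>v. continuous_on UNIV (\<lambda>z. D z v)"
    and fr: "\<And>z. frechet_derivative \<phi> (at z) = D z" and Dper: "\<And>t u k. D (t, u + lat k) = D (t, u)"
    by (rule test_fun_derivative[OF \<phi>]) blast
  define \<psi> where "\<psi> z = D z (1, m)" for z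
  have op: "transport_op m (frechet_derivative \<phi> (at z)) = \<psi> z" for z
    unfolding fr \<psi>_def by (rule transport_op_linear) (rule has_derivative_linear[OF D(1)])
  have \<psi>_cont: "continuous_on S \<psi>" for S unfolding \<psi>_def by (rule continuous_on_subset[OF D(2)]) simp
  obtain T0 where T0: "\<And>t u. \<bar>t\<bar> > T0 \<Longrightarrow> \<phi> (t, u) = 0" using \<phi> by (auto simp: test_fun_def)
  \<comment> \<open>The added 1 puts \<open>T\<close> strictly beyond the support:
    \<open>\<phi>\<close> vanishes at \<open>T\<close>, and it vanishes on the open set of later
    times, so \<open>\<psi>\<close> does too and the time integral stops at
    \<open>T\<close>.\<close>
  define T where "T = \<bar>T0\<bar> + 1"
  have \<phi>T: "\<phi> (T, u) = 0" for u by (rule T0) (simp add: T_def)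
  have \<psi>0: "\<psi> (t, u) = 0" if "t > T" for t u
  proof -
    have "((\<lambda>_. 0) has_derivative D (t, u)) (at (t, u))"
    proof (rule has_derivative_transform_within_open[OF D(1)])
      show "open ({T<..} \<times> (UNIV :: (real^'n) set))" by (intro open_Times) auto
      show "\<phi> z = 0" if "z \<in> {T<..} \<times> UNIV" for z
        using that T0[of "fst z" "snd z"] by (auto simp: T_def)
    qed (use that in auto)
    then have "D (t, u) = (\<lambda>_. 0)" by (rule has_derivative_unique) simp
    then show ?thesis by (simp add: \<psi>_def)
  qed
  let ?Q = "cbox 0 1 :: (real^'n) set"
  let ?g = "\<lambda>t u. indicator {0..T} t * (indicator ?Q u * (f (u - t *\<^sub>R m) * \<psi> (t, u)))"
  let ?h = "\<lambda>t u. indicator {0..T} t * (indicator ?Q u * (f u * \<psi> (t, u + t *\<^sub>R m)))"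
  have rect: "indicator ({0..T} \<times> ?Q) z = indicator {0..T} (fst z) * (indicator ?Q (snd z) :: real)" for z
    by (cases z) (simp add: indicator_def)
  have gi: "integrable (lborel \<Otimes>\<^sub>M lborel) (case_prod ?g)"
  proof -
    have "integrable lborel (\<lambda>z. indicator ({0..T} \<times> ?Q) z *\<^sub>R (f (snd z - fst z *\<^sub>R m) * \<psi> z))"
      by (intro borel_integrable_compact compact_Times continuous_intros cf \<psi>_cont) auto
    then show ?thesis by (simp add: lborel_prod rect case_prod_beta' mult.assoc)
  qed
  have hi: "integrable (lborel \<Otimes>\<^sub>M lborel) (case_prod ?h)"
  proof -
    have "integrable lborel (\<lambda>z. indicator ({0..T} \<times> ?Q) z *\<^sub>R (f (snd z) * \<psi> (fst z, snd z + fst z *\<^sub>R m)))"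
      by (intro borel_integrable_compact compact_Times continuous_intros
            continuous_on_compose2[OF cont] continuous_on_compose2[OF \<psi>_cont[of UNIV]]) auto
    then show ?thesis by (simp add: lborel_prod rect case_prod_beta' mult.assoc)
  qed
  have "(LINT z:{0..} \<times> ?Q|lborel. f (snd z - fst z *\<^sub>R m) * transport_op m (frechet_derivative \<phi> (at z)))
      = (\<integral>z. case_prod ?g z \<partial>(lborel \<Otimes>\<^sub>M lborel))"
    unfolding set_lebesgue_integral_def lborel_prod op
  proof (intro Bochner_Integration.integral_cong refl)
    fix z :: "real \<times> (real^'n)"
    show "indicat_real ({0..} \<times> ?Q) z *\<^sub>R (f (snd z - fst z *\<^sub>R m) * \<psi> z) = case_prod ?g z"
      by (cases z) (auto simp: indicator_def \<psi>0)
  qed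
  also have "\<dots> = (\<integral>t. \<integral>u. ?g t u \<partial>lborel \<partial>lborel)"
    using lborel_pair.integral_fst'[OF gi] by simp
  \<comment> \<open>At fixed time the integrand is periodic in space. Moving the cell by
    \<open>t *\<^sub>R m\<close> frees \<open>f\<close> from \<open>t\<close>, and the remaining
    factor is the derivative in \<open>t\<close> of \<open>\<phi>\<close> along the characteristic
    starting at \<open>u\<close>.\<close>
  also have "\<dots> = (\<integral>t. \<integral>u. ?h t u \<partial>lborel \<partial>lborel)"
  proof (rule Bochner_Integration.integral_cong[OF refl])
    fix t :: real
    let ?F = "\<lambda>u. f (u - t *\<^sub>R m) * \<psi> (t, u)"
    have "torus_fun ?F"
    proof (rule torus_funI)
      fix u k
      have "f (u + lat k - t *\<^sub>R m) = f (u - t *\<^sub>R m)"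
        using torus_fun_lat[OF per, of "u - t *\<^sub>R m" k] by (simp add: algebra_simps)
      then show "f (u + lat k - t *\<^sub>R m) * \<psi> (t, u + lat k) = f (u - t *\<^sub>R m) * \<psi> (t, u)"
        by (simp add: \<psi>_def Dper)
    qed
    moreover have "continuous_on UNIV ?F"
      by (intro continuous_intros continuous_on_compose2[OF cont] continuous_on_compose2[OF \<psi>_cont[of UNIV]]) auto
    ultimately have "(LINT u:?Q|lborel. ?F (u + t *\<^sub>R m)) = (LINT u:?Q|lborel. ?F u)"
      by (rule cell_integral_shift)
    then show "(\<integral>u. ?g t u \<partial>lborel) = (\<integral>u. ?h t u \<partial>lborel)"
      by (simp add: set_lebesgue_integral_def)
  qed
  also have "\<dots> = (\<integral>u. \<integral>t. ?h t u \<partial>lborel \<partial>lborel)"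
    using lborel_pair.Fubini_integral[OF hi] by simp
  also have "\<dots> = (\<integral>u. - (indicator ?Q u * (f u * \<phi> (0, u))) \<partial>lborel)"
  proof (intro Bochner_Integration.integral_cong refl)
    fix u
    \<comment> \<open>Of the two boundary values the one at \<open>T\<close> vanishes, and the one
      at 0 is what cancels the initial term of the weak formulation.\<close>
    have "(\<integral>t. \<psi> (t, u + t *\<^sub>R m) * indicator {0..T} t \<partial>lborel) = \<phi> (T, u + T *\<^sub>R m) - \<phi> (0, u + 0 *\<^sub>R m)"
    proof (rule integral_FTC_Icc_real[where F="\<lambda>t. \<phi> (t, u + t *\<^sub>R m)"])
      show "0 \<le> T" by (simp add: T_def)
      fix t
      have "((\<lambda>t. \<phi> (t, u + t *\<^sub>R m)) has_derivative (\<lambda>h. D (t, u + t *\<^sub>R m) (h, h *\<^sub>R m))) (at t)"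
        by (rule has_derivative_compose[OF _ D(1), of "\<lambda>t. (t, u + t *\<^sub>R m)"]) (auto intro!: derivative_eq_intros)
      moreover have "D (t, u + t *\<^sub>R m) (h, h *\<^sub>R m) = h * \<psi> (t, u + t *\<^sub>R m)" for h
        using linear_scale[OF has_derivative_linear[OF D(1)], of "(t, u + t *\<^sub>R m)" h "(1, m)"] by (simp add: \<psi>_def)
      ultimately show "((\<lambda>t. \<phi> (t, u + t *\<^sub>R m)) has_real_derivative \<psi> (t, u + t *\<^sub>R m)) (at t)"
        by (simp add: has_field_derivative_def mult_commute_abs)
      have "continuous_on UNIV (\<lambda>t. \<psi> (t, u + t *\<^sub>R m))"
        by (intro continuous_on_compose2[OF \<psi>_cont[of UNIV]] continuous_intros) auto
      then show "isCont (\<lambda>t. \<psi> (t, u + t *\<^sub>R m)) t" by (simp add: continuous_on_eq_continuous_at)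
    qed
    then have "(\<integral>t. indicator {0..T} t * \<psi> (t, u + t *\<^sub>R m) \<partial>lborel) = - \<phi> (0, u)"
      by (simp add: \<phi>T mult.commute)
    moreover have "(\<integral>t. ?h t u \<partial>lborel) = indicator ?Q u * f u * (\<integral>t. indicator {0..T} t * \<psi> (t, u + t *\<^sub>R m) \<partial>lborel)"
      by (subst integral_mult_right_zero[symmetric]) (simp add: mult_ac)
    ultimately show "(\<integral>t. ?h t u \<partial>lborel) = - (indicator ?Q u * (f u * \<phi> (0, u)))" by simp
  qed
  finally show "(LINT z:{0..} \<times> ?Q|lborel. f (snd z - fst z *\<^sub>R m) * transport_op m (frechet_derivative \<phi> (at z)))
     + (LINT u:?Q|lborel. f u * \<phi> (0, u)) = 0"
    by (simp add: set_lebesgue_integral_def)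
qed

text \<open>By the chain rule everything rests on the inner map sending \<open>(s, v)\<close> to
  \<open>v - s *\<^sub>R m\<close>, which annihilates the direction \<open>(1, m)\<close>.\<close>

lemma transport_classical_shift:
  fixes f :: "real^'n \<Rightarrow> real"
  assumes per: "torus_fun f" and diff: "\<And>u. f differentiable (at u)"
  shows "transport_classical m f (\<lambda>t u. f (u - t *\<^sub>R m))"
  unfolding transport_classical_def
proof (intro conjI allI impI)
  show "torus_fun (\<lambda>u. f (u - t *\<^sub>R m))" for t
  proof (rule torus_funI)
    show "f (u + lat k - t *\<^sub>R m) = f (u - t *\<^sub>R m)" for u k
      using torus_fun_lat[OF per, of "u - t *\<^sub>R m" k] by (simp add: algebra_simps)
  qed
  show "f (u - 0 *\<^sub>R m) = f u" for u by simp
  fix t :: real and u :: "real^'n"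
  obtain f' where f': "(f has_derivative f') (at (u - t *\<^sub>R m))" using diff by (auto simp: differentiable_def)
  let ?D = "\<lambda>z. f' (snd z - fst z *\<^sub>R m)"
  have "((\<lambda>z. f (snd z - fst z *\<^sub>R m)) has_derivative ?D) (at (t, u) within {0..} \<times> UNIV)"
    by (rule has_derivative_compose[of "\<lambda>z. snd z - fst z *\<^sub>R m"]) (use f' in \<open>auto intro!: derivative_eq_intros\<close>)
  moreover have "transport_op m ?D = 0"
  proof -
    have "linear ?D"
      using linear_compose[of "\<lambda>z. snd z - fst z *\<^sub>R m" f', OF _ has_derivative_linear[OF f']]
      by (simp add: o_def linear_iff algebra_simps)
    then show ?thesis using linear_0[OF has_derivative_linear[OF f']] by (simp add: transport_op_linear)
  qed
  ultimately show "\<exists>D. ((\<lambda>(s, v). f (v - s *\<^sub>R m)) has_derivative D) (at (t, u) within {0..} \<times> UNIV) \<and> transport_op m D = 0"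
    by (auto simp: case_prod_beta')
qed

section \<open>Convergence\<close>

lemma step_char_eq_sum:
  assumes "finite_range_jump p"
  shows "step_char p \<theta> = (\<Sum>x\<in>set_pmf p. pmf p x *\<^sub>R cis (\<theta> \<bullet> lat x))"
  using assms unfolding step_char_def finite_range_jump_def by (rule integral_measure_pmf) auto

lemma jump_mean_eq: "jump_mean p = (\<Sum>x\<in>set_pmf p. pmf p x *\<^sub>R lat x)"
  by (simp add: jump_mean_def lat_def vec_eq_iff mult.commute)

lemma jump_mean_inner: "\<theta> \<bullet> jump_mean p = (\<Sum>x\<in>set_pmf p. pmf p x * (\<theta> \<bullet> lat x))"
  by (simp add: jump_mean_eq inner_sum_right)

lemma jump_cov_quadratic:
  "\<theta> \<bullet> (jump_cov p *v \<theta>) = (\<Sum>x\<in>set_pmf p. pmf p x * (\<theta> \<bullet> lat x)\<^sup>2)"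
proof -
  have "(\<theta> \<bullet> lat x)\<^sup>2 = (\<Sum>i\<in>UNIV. \<Sum>j\<in>UNIV. \<theta> $ i * \<theta> $ j * (of_int (x $ i) * of_int (x $ j)))" for x
    by (simp add: inner_vec_def lat_def power2_eq_square sum_product mult_ac)
  then have "(\<Sum>x\<in>set_pmf p. pmf p x * (\<theta> \<bullet> lat x)\<^sup>2)
     = (\<Sum>x\<in>set_pmf p. \<Sum>i\<in>UNIV. \<Sum>j\<in>UNIV. \<theta> $ i * (\<theta> $ j * (of_int (x $ i) * of_int (x $ j) * pmf p x)))"
    by (simp add: sum_distrib_left mult_ac)
  also have "\<dots> = (\<Sum>i\<in>UNIV. \<Sum>j\<in>UNIV. \<Sum>x\<in>set_pmf p. \<theta> $ i * (\<theta> $ j * (of_int (x $ i) * of_int (x $ j) * pmf p x)))"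
    by (subst sum.swap, intro sum.cong refl, rule sum.swap)
  also have "\<dots> = \<theta> \<bullet> (jump_cov p *v \<theta>)"
    by (simp add: inner_vec_def matrix_vector_mult_def jump_cov_def sum_distrib_left sum_distrib_right mult_ac)
  finally show ?thesis ..
qed

text \<open>Finite range makes the transform a finite sum, so the limit is taken jump by jump. The
  cosine contributes order \<open>1 / N\<close> and disappears; the sine leaves the drift.\<close>

lemma tendsto_scaled_char_ballistic:
  assumes "finite_range_jump p"
  shows "(\<lambda>N. of_real (real N) * (step_char p ((- 1 / real N) *\<^sub>R \<theta>) - 1)) \<longlonglongrightarrow> - \<i> * of_real (\<theta> \<bullet> jump_mean p)"
proof -
  have fin: "finite (set_pmf p)" using assms by (simp add: finite_range_jump_def)
  have one: "(\<Sum>x\<in>set_pmf p. pmf p x) = 1" using fin by (rule sum_pmf_eq_1) simp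
  have lim: "(\<lambda>N. of_real (real N) * (cis (- a / real N) - 1)) \<longlonglongrightarrow> - \<i> * of_real a" for a
  proof -
    have "(\<lambda>N. real N * (cos (a / real N) - 1)) \<longlonglongrightarrow> 0" by real_asymp
    moreover have "(\<lambda>N. real N * sin (a / real N)) \<longlonglongrightarrow> a" by real_asymp
    ultimately show ?thesis
      by (simp add: tendsto_complex_iff tendsto_minus)
  qed
  have "of_real (real N) * (step_char p ((- 1 / real N) *\<^sub>R \<theta>) - 1)
      = (\<Sum>x\<in>set_pmf p. pmf p x *\<^sub>R (of_real (real N) * (cis (- (\<theta> \<bullet> lat x) / real N) - 1)))" for N
  proof -
    \<comment> \<open>The total mass 1 is written as the sum of the weights, so that the subtracted
      1 can be distributed over the jumps.\<close>
    have "step_char p ((- 1 / real N) *\<^sub>R \<theta>) - 1 = (\<Sum>x\<in>set_pmf p. pmf p x *\<^sub>R cis (- (\<theta> \<bullet> lat x) / real N)) - (\<Sum>x\<in>set_pmf p. pmf p x *\<^sub>R 1)"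
      using one by (simp add: step_char_eq_sum[OF assms] scaleR_sum_left[symmetric])
    also have "\<dots> = (\<Sum>x\<in>set_pmf p. pmf p x *\<^sub>R (cis (- (\<theta> \<bullet> lat x) / real N) - 1))"
      by (simp only: sum_subtractf[symmetric] scaleR_diff_right[symmetric])
    finally show ?thesis
      by (simp only: sum_distrib_left scaleR_conv_of_real mult_ac)
  qed
  moreover have "(\<lambda>N. \<Sum>x\<in>set_pmf p. pmf p x *\<^sub>R (of_real (real N) * (cis (- (\<theta> \<bullet> lat x) / real N) - 1)))
      \<longlonglongrightarrow> (\<Sum>x\<in>set_pmf p. pmf p x *\<^sub>R (- \<i> * of_real (\<theta> \<bullet> lat x)))"
    by (intro tendsto_sum tendsto_scaleR tendsto_const lim)
  moreover have "(\<Sum>x\<in>set_pmf p. pmf p x *\<^sub>R (- \<i> * of_real (\<theta> \<bullet> lat x))) = - \<i> * of_real (\<theta> \<bullet> jump_mean p)"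
    by (simp add: jump_mean_inner sum_distrib_left scaleR_conv_of_real mult_ac sum_negf)
  ultimately show ?thesis by simp
qed

text \<open>For one jump with \<open>a = \<theta> \<bullet> lat x\<close> nonzero,
  \<open>N^2 * (cis (- a / N) - 1)\<close> has an imaginary part growing like \<open>N\<close>.
  Adding \<open>\<i> * a / N\<close> inside each summand removes it, and since the mean vanishes
  these additions sum to 0.\<close>

lemma tendsto_scaled_char_diffusive:
  assumes "finite_range_jump p" and m0: "jump_mean p = 0"
  shows "(\<lambda>N. of_real ((real N)\<^sup>2) * (step_char p ((- 1 / real N) *\<^sub>R \<theta>) - 1)) \<longlonglongrightarrow> of_real (- (\<theta> \<bullet> (jump_cov p *v \<theta>)) / 2)"
proof -
  have fin: "finite (set_pmf p)" using assms by (simp add: finite_range_jump_def)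
  have one: "(\<Sum>x\<in>set_pmf p. pmf p x) = 1" using fin by (rule sum_pmf_eq_1) simp
  have lim: "(\<lambda>N. of_real ((real N)\<^sup>2) * (cis (- a / real N) - 1 + \<i> * of_real (a / real N))) \<longlonglongrightarrow> of_real (- (a * a) / 2)" for a :: real
  proof -
    have "(\<lambda>N. (real N)\<^sup>2 * (cos (a / real N) - 1)) \<longlonglongrightarrow> - (a * a) / 2" by (real_asymp simp: power2_eq_square)
    moreover have "(\<lambda>N. (real N)\<^sup>2 * (a / real N - sin (a / real N))) \<longlonglongrightarrow> 0" by real_asymp
    ultimately show ?thesis
      by (simp add: tendsto_complex_iff del: of_real_power)
  qed
  have "of_real ((real N)\<^sup>2) * (step_char p ((- 1 / real N) *\<^sub>R \<theta>) - 1)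
      = (\<Sum>x\<in>set_pmf p. pmf p x *\<^sub>R (of_real ((real N)\<^sup>2) * (cis (- (\<theta> \<bullet> lat x) / real N) - 1 + \<i> * of_real ((\<theta> \<bullet> lat x) / real N))))" for N
  proof -
    have z: "(\<Sum>x\<in>set_pmf p. pmf p x *\<^sub>R (\<i> * of_real ((\<theta> \<bullet> lat x) / real N))) = 0"
    proof -
      have "(\<Sum>x\<in>set_pmf p. pmf p x *\<^sub>R (\<i> * of_real ((\<theta> \<bullet> lat x) / real N))) = \<i> * of_real ((\<theta> \<bullet> jump_mean p) / real N)"
        by (simp add: jump_mean_inner sum_distrib_left sum_divide_distrib scaleR_conv_of_real mult_ac)
      then show ?thesis by (simp add: m0)
    qed
    have "step_char p ((- 1 / real N) *\<^sub>R \<theta>) - 1 = (\<Sum>x\<in>set_pmf p. pmf p x *\<^sub>R cis (- (\<theta> \<bullet> lat x) / real N)) - (\<Sum>x\<in>set_pmf p. pmf p x *\<^sub>R 1)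
        + (\<Sum>x\<in>set_pmf p. pmf p x *\<^sub>R (\<i> * of_real ((\<theta> \<bullet> lat x) / real N)))"
      unfolding z using one by (simp add: step_char_eq_sum[OF assms(1)] scaleR_sum_left[symmetric])
    also have "\<dots> = (\<Sum>x\<in>set_pmf p. pmf p x *\<^sub>R (cis (- (\<theta> \<bullet> lat x) / real N) - 1 + \<i> * of_real ((\<theta> \<bullet> lat x) / real N)))"
      by (simp only: sum_subtractf[symmetric] sum.distrib[symmetric] scaleR_diff_right[symmetric] scaleR_add_right[symmetric])
    finally show ?thesis
      by (simp only: sum_distrib_left scaleR_conv_of_real mult_ac)
  qed
  moreover have "(\<lambda>N. \<Sum>x\<in>set_pmf p. pmf p x *\<^sub>R (of_real ((real N)\<^sup>2) * (cis (- (\<theta> \<bullet> lat x) / real N) - 1 + \<i> * of_real ((\<theta> \<bullet> lat x) / real N))))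
      \<longlonglongrightarrow> (\<Sum>x\<in>set_pmf p. pmf p x *\<^sub>R of_real (- ((\<theta> \<bullet> lat x) * (\<theta> \<bullet> lat x)) / 2))"
    by (intro tendsto_sum tendsto_scaleR tendsto_const lim)
  moreover have "(\<Sum>x\<in>set_pmf p. pmf p x *\<^sub>R of_real (- ((\<theta> \<bullet> lat x) * (\<theta> \<bullet> lat x)) / 2)) = complex_of_real (- (\<theta> \<bullet> (jump_cov p *v \<theta>)) / 2)"
    by (simp add: jump_cov_quadratic sum_divide_distrib sum_negf scaleR_conv_of_real power2_eq_square)
  ultimately show ?thesis by (simp only:)
qed

section \<open>Nondegeneracy of the covariance matrix\<close>

lemma jump_cov_sym: "transpose (jump_cov p) = jump_cov p"
  by (simp add: transpose_def jump_cov_def vec_eq_iff mult_ac)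

lemma n_step_orthogonal:
  assumes "\<And>z. z \<in> set_pmf p \<Longrightarrow> \<theta> \<bullet> lat z = 0" and "y \<in> set_pmf (n_step p n x)"
  shows "\<theta> \<bullet> lat y = \<theta> \<bullet> lat x"
  using assms(2)
proof (induction n arbitrary: y)
  case (Suc n)
  then obtain z w where "z \<in> set_pmf (n_step p n x)" "w \<in> set_pmf p" "y = z + w"
    by (auto simp: jump_kernel_def)
  then show ?case using Suc.IH assms(1) by (simp add: lat_add inner_add_right)
qed simp

text \<open>If the form vanishes at \<open>\<theta>\<close>, every possible jump is orthogonal to
  \<open>\<theta>\<close>, and the walk from 0 never leaves that hyperplane. Irreducibility makes it
  reach every unit vector, which forces each coordinate of \<open>\<theta>\<close> to be 0.\<close>

lemma jump_cov_pos:
  assumes fin: "finite_range_jump p" and irr: "irreducible_jump p" and "\<theta> \<noteq> 0"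
  shows "\<theta> \<bullet> (jump_cov p *v \<theta>) > 0"
proof (rule ccontr)
  assume "\<not> \<theta> \<bullet> (jump_cov p *v \<theta>) > 0"
  moreover have f: "finite (set_pmf p)" using fin by (simp add: finite_range_jump_def)
  ultimately have "(\<Sum>x\<in>set_pmf p. pmf p x * (\<theta> \<bullet> lat x)\<^sup>2) = 0"
    unfolding jump_cov_quadratic using sum_nonneg[of "set_pmf p" "\<lambda>x. pmf p x * (\<theta> \<bullet> lat x)\<^sup>2"] by force
  then have "\<forall>x\<in>set_pmf p. pmf p x * (\<theta> \<bullet> lat x)\<^sup>2 = 0"
    using f by (subst (asm) sum_nonneg_eq_0_iff) auto
  then have orth: "\<theta> \<bullet> lat x = 0" if "x \<in> set_pmf p" for x
    using that by (auto simp: set_pmf_iff)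
  have "\<theta> $ i = 0" for i
  proof -
    obtain n where "pmf (n_step p n 0) (axis i 1) > 0" using irr by (auto simp: irreducible_jump_def)
    then have "\<theta> \<bullet> lat (axis i 1) = \<theta> \<bullet> lat 0"
      by (intro n_step_orthogonal[OF orth, where n=n]) (auto simp: set_pmf_iff)
    moreover have "lat (axis i 1) = axis i 1" by (auto simp: lat_def axis_def vec_eq_iff)
    ultimately show ?thesis by (simp add: lat_0 inner_axis)
  qed
  then show False using \<open>\<theta> \<noteq> 0\<close> by (simp add: vec_eq_iff)
qed

section \<open>Limits of expectations along the reversed walk\<close>

text \<open>Makes sense for arbitrary \<open>f\<close>, including the signed trigonometric
  polynomials, to which no Poisson initial measure corresponds. The starting point is left
  unreduced, which a periodic \<open>f\<close> does not notice.\<close>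

definition walk_mean :: "(int^'d) pmf \<Rightarrow> (real^'d \<Rightarrow> real) \<Rightarrow> nat \<Rightarrow> real \<Rightarrow> real^'d \<Rightarrow> real" where
  "walk_mean p f N s u = (\<integral>\<omega>. f (macro_point N (floor_vec (real N *\<^sub>R u) - displacement \<omega> s)) \<partial>path_measure p)"

lemma mean_occupation_eq_walk_mean:
  assumes "torus_fun \<rho>\<^sub>0" "\<And>u. \<rho>\<^sub>0 u \<ge> 0" "N > 0"
  shows "mean_occupation p \<rho>\<^sub>0 N s (micro_site N u) = walk_mean p \<rho>\<^sub>0 N s u"
  unfolding walk_mean_def micro_site_def mean_occupation_eq_expectation[OF assms]
  by (simp add: floor_vec_def mean_occupation_eq_expectation[OF assms])

lemma walk_mean_integrable:
  fixes f :: "real^'d \<Rightarrow> real"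
  assumes "\<And>x. \<bar>f x\<bar> \<le> B"
  shows "integrable (path_measure p) (\<lambda>\<omega>. f (macro_point N (y - displacement \<omega> s)))"
proof -
  interpret prob_space "path_measure p" by (rule prob_space_path_measure)
  have "(\<lambda>\<omega>. f (macro_point N (y - displacement \<omega> s))) \<in> borel_measurable (path_measure p)"
    by (rule measurable_compose[OF measurable_displacement]) simp
  then show ?thesis by (rule integrable_const_bound[of _ B, rotated]) (simp add: assms)
qed

text \<open>An average under a probability measure is a contraction; that the bound is free of
  \<open>N\<close> and \<open>s\<close> is what allows approximation before the limit.\<close>

lemma walk_mean_close:
  fixes f g :: "real^'d \<Rightarrow> real"
  assumes f: "\<And>x. \<bar>f x\<bar> \<le> B" and g: "\<And>x. \<bar>g x\<bar> \<le> B'" and e: "\<And>x. \<bar>f x - g x\<bar> \<le> e"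
  shows "\<bar>walk_mean p f N s u - walk_mean p g N s u\<bar> \<le> e"
proof -
  interpret prob_space "path_measure p" by (rule prob_space_path_measure)
  let ?y = "\<lambda>\<omega>. macro_point N (floor_vec (real N *\<^sub>R u) - displacement \<omega> s)"
  have "walk_mean p f N s u - walk_mean p g N s u = (\<integral>\<omega>. f (?y \<omega>) - g (?y \<omega>) \<partial>path_measure p)"
    unfolding walk_mean_def
    by (rule Bochner_Integration.integral_diff[symmetric]) (rule walk_mean_integrable[OF f] walk_mean_integrable[OF g])+
  also have "\<bar>\<dots>\<bar> \<le> (\<integral>\<omega>. \<bar>f (?y \<omega>) - g (?y \<omega>)\<bar> \<partial>path_measure p)" by (rule integral_abs_bound)
  also have "\<dots> \<le> (\<integral>\<omega>. e \<partial>path_measure p)"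
    by (intro integral_mono integrable_abs Bochner_Integration.integrable_diff walk_mean_integrable[OF f] walk_mean_integrable[OF g] e) simp
  also have "\<dots> = e" by (simp add: prob_space)
  finally show ?thesis .
qed

text \<open>The angle splits into a deterministic part from the starting site and a multiple of the
  displacement, so only the latter is integrated. The minus sign in the frequency comes from running
  the walk backwards.\<close>

lemma walk_mean_cos:
  assumes "s \<ge> 0"
  shows "walk_mean p (\<lambda>x. cos (\<theta> \<bullet> x + b)) N s u =
    Re (cis (\<theta> \<bullet> macro_point N (floor_vec (real N *\<^sub>R u)) + b) * exp (s * (step_char p ((- 1 / real N) *\<^sub>R \<theta>) - 1)))"
proof -
  interpret prob_space "path_measure p" by (rule prob_space_path_measure)
  let ?y = "\<theta> \<bullet> macro_point N (floor_vec (real N *\<^sub>R u)) + b"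
  let ?c = "\<lambda>\<omega>. cis (((- 1 / real N) *\<^sub>R \<theta>) \<bullet> lat (displacement \<omega> s))"
  have "?c \<in> borel_measurable (path_measure p)"
    by (rule measurable_compose[OF measurable_displacement]) simp
  then have int: "integrable (path_measure p) ?c" by (rule integrable_const_bound[of _ 1, rotated]) simp
  have "cos (\<theta> \<bullet> macro_point N (floor_vec (real N *\<^sub>R u) - displacement \<omega> s) + b) = Re (cis ?y * ?c \<omega>)" for \<omega>
  proof -
    have "\<theta> \<bullet> macro_point N (floor_vec (real N *\<^sub>R u) - displacement \<omega> s) + b = ?y + ((- 1 / real N) *\<^sub>R \<theta>) \<bullet> lat (displacement \<omega> s)"
      by (simp add: macro_point_eq lat_diff scaleR_diff_right inner_diff_right divide_inverse)
    then show ?thesis by (simp only: cis_mult) simp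
  qed
  then have "walk_mean p (\<lambda>x. cos (\<theta> \<bullet> x + b)) N s u = (\<integral>\<omega>. Re (cis ?y * ?c \<omega>) \<partial>path_measure p)"
    by (simp only: walk_mean_def)
  also have "\<dots> = Re (\<integral>\<omega>. cis ?y * ?c \<omega> \<partial>path_measure p)"
    by (rule integral_Re) (intro integrable_mult_right int)
  also have "(\<integral>\<omega>. cis ?y * ?c \<omega> \<partial>path_measure p) = cis ?y * exp (s * (step_char p ((- 1 / real N) *\<^sub>R \<theta>) - 1))"
    by (simp only: integral_mult_right_zero integral_displacement_char[OF assms])
  finally show ?thesis .
qed

lemma macro_floor_tendsto: "(\<lambda>N. macro_point N (floor_vec (real N *\<^sub>R u))) \<longlonglongrightarrow> u"
proof (rule vec_tendstoI)
  fix i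
  have "(\<lambda>N. of_int \<lfloor>real N * u $ i\<rfloor> / real N) \<longlonglongrightarrow> u $ i"
  proof (rule real_tendsto_sandwich)
    show "\<forall>\<^sub>F N in sequentially. u $ i - 1 / real N \<le> of_int \<lfloor>real N * u $ i\<rfloor> / real N"
      using eventually_gt_at_top[of 0]
    proof eventually_elim
      case (elim N)
      have "real N * u $ i - 1 \<le> of_int \<lfloor>real N * u $ i\<rfloor>" by linarith
      then have "(real N * u $ i - 1) / real N \<le> of_int \<lfloor>real N * u $ i\<rfloor> / real N"
        by (rule divide_right_mono) simp
      then show ?case using elim by (simp add: diff_divide_distrib)
    qed
    show "\<forall>\<^sub>F N in sequentially. of_int \<lfloor>real N * u $ i\<rfloor> / real N \<le> u $ i"
      using eventually_gt_at_top[of 0]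
      by eventually_elim (simp add: divide_le_eq mult.commute)
    show "(\<lambda>N. u $ i - 1 / real N) \<longlonglongrightarrow> u $ i" by real_asymp
  qed simp
  then show "(\<lambda>N. macro_point N (floor_vec (real N *\<^sub>R u)) $ i) \<longlonglongrightarrow> u $ i"
    by (simp add: macro_point_def floor_vec_def)
qed

text \<open>With \<open>v\<close> and \<open>L\<close> left open the same statement covers both
  scalings.\<close>

lemma walk_mean_cos_tendsto:
  assumes "\<And>N. v N \<ge> 0" "t \<ge> 0"
    and lim: "(\<lambda>N. of_real (v N) * (step_char p ((- 1 / real N) *\<^sub>R \<theta>) - 1)) \<longlonglongrightarrow> L"
  shows "(\<lambda>N. walk_mean p (\<lambda>x. cos (\<theta> \<bullet> x + b)) N (v N * t) u) \<longlonglongrightarrow> Re (cis (\<theta> \<bullet> u + b) * exp (of_real t * L))"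
proof -
  have "(\<lambda>N. Re (cis (\<theta> \<bullet> macro_point N (floor_vec (real N *\<^sub>R u)) + b) *
      exp (of_real t * (of_real (v N) * (step_char p ((- 1 / real N) *\<^sub>R \<theta>) - 1)))))
     \<longlonglongrightarrow> Re (cis (\<theta> \<bullet> u + b) * exp (of_real t * L))"
    unfolding cis_conv_exp by (intro tendsto_intros macro_floor_tendsto lim)
  moreover have "walk_mean p (\<lambda>x. cos (\<theta> \<bullet> x + b)) N (v N * t) u = Re (cis (\<theta> \<bullet> macro_point N (floor_vec (real N *\<^sub>R u)) + b) *
      exp (of_real t * (of_real (v N) * (step_char p ((- 1 / real N) *\<^sub>R \<theta>) - 1))))" for N
    using walk_mean_cos[of "v N * t" p \<theta> b N u] assms(1)[of N] assms(2) by (simp add: mult_ac)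
  ultimately show ?thesis by simp
qed

text \<open>By density of trigonometric polynomials it is enough to check the convergence on characters,
  where both sides are explicit.\<close>

lemma walk_mean_tendsto:
  fixes p :: "(int^'d) pmf"
  assumes per: "torus_fun f" and cont: "continuous_on UNIV f" and bd: "\<And>x. \<bar>f x\<bar> \<le> B"
    and L: "\<And>k b. (\<lambda>N. walk_mean p (\<lambda>x. cos ((2 * pi) *\<^sub>R lat k \<bullet> x + b)) N (s N) u) \<longlonglongrightarrow> L (\<lambda>x. cos ((2 * pi) *\<^sub>R lat k \<bullet> x + b))"
    and add: "\<And>g h. trig_poly g \<Longrightarrow> trig_poly h \<Longrightarrow> L (\<lambda>x. g x + h x) = L g + L h"
    and scale: "\<And>c g. trig_poly g \<Longrightarrow> L (\<lambda>x. c * g x) = c * L g"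
    and close: "\<And>g e. trig_poly g \<Longrightarrow> (\<And>x. \<bar>f x - g x\<bar> \<le> e) \<Longrightarrow> \<bar>L f - L g\<bar> \<le> e"
  shows "(\<lambda>N. walk_mean p f N (s N) u) \<longlonglongrightarrow> L f"
proof -
  have trig: "(\<lambda>N. walk_mean p g N (s N) u) \<longlonglongrightarrow> L g" if "trig_poly g" for g
    using that
  proof induction
    case (trig_cos k b)
    show ?case by (rule L)
  next
    case (trig_add g h)
    obtain B where B: "\<And>x. \<bar>g x\<bar> \<le> B" using trig_poly_bounded[OF trig_add.hyps(1)] by blast
    obtain B' where B': "\<And>x. \<bar>h x\<bar> \<le> B'" using trig_poly_bounded[OF trig_add.hyps(2)] by blast
    have "walk_mean p (\<lambda>x. g x + h x) N (s N) u = walk_mean p g N (s N) u + walk_mean p h N (s N) u" for N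
      unfolding walk_mean_def by (rule Bochner_Integration.integral_add) (rule walk_mean_integrable[OF B] walk_mean_integrable[OF B'])+
    then show ?case using tendsto_add[OF trig_add.IH] by (simp add: add trig_add.hyps)
  next
    case (trig_scale g c)
    then show ?case by (simp add: scale walk_mean_def tendsto_mult_left)
  qed
  show ?thesis
  proof (rule LIMSEQ_I)
    fix r :: real assume r: "r > 0"
    \<comment> \<open>Three errors of size \<open>r / 3\<close>: replacing \<open>f\<close> by
      \<open>g\<close> along the walk, the convergence for \<open>g\<close>, and replacing
      \<open>g\<close> by \<open>f\<close> in the limit. Only the middle one depends on
      \<open>N\<close>.\<close>
    obtain g where g: "trig_poly g" "\<And>x. \<bar>f x - g x\<bar> < r / 3"
      using trig_poly_dense[OF per cont, of "r / 3"] r by (metis divide_pos_pos zero_less_numeral)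
    obtain B' where B': "\<And>x. \<bar>g x\<bar> \<le> B'" using trig_poly_bounded[OF g(1)] by blast
    have Lfg: "\<bar>L f - L g\<bar> \<le> r / 3" by (rule close[OF g(1)]) (rule less_imp_le[OF g(2)])
    have w: "\<bar>walk_mean p f N (s N) u - walk_mean p g N (s N) u\<bar> \<le> r / 3" for N
      by (rule walk_mean_close[OF bd B']) (rule less_imp_le[OF g(2)])
    obtain n where n: "\<And>N. N \<ge> n \<Longrightarrow> \<bar>walk_mean p g N (s N) u - L g\<bar> < r / 3"
      using LIMSEQ_D[OF trig[OF g(1)], of "r / 3"] r by auto
    have "\<bar>walk_mean p f N (s N) u - L f\<bar> < r" if "N \<ge> n" for N
      using n[OF that] w[of N] Lfg by linarith
    then show "\<exists>no. \<forall>n\<ge>no. norm (walk_mean p f n (s n) u - L f) < r" by auto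
  qed
qed

lemma torus_fun_bounded:
  fixes f :: "real^'d \<Rightarrow> real"
  assumes per: "torus_fun f" and cont: "continuous_on UNIV f"
  obtains B where "\<And>x. \<bar>f x\<bar> \<le> B"
proof -
  have "compact (f ` cbox 0 1)" by (intro compact_continuous_image continuous_on_subset[OF cont]) auto
  then obtain B where B: "\<forall>y\<in>f ` cbox 0 1. \<bar>y\<bar> \<le> B"
    using compact_imp_bounded bounded_iff by (metis real_norm_def)
  have "\<bar>f x\<bar> \<le> B" for x
    using B diff_floor_vec_in_cbox[of x] torus_fun_lat_diff[OF per, of x "floor_vec x"] by (metis image_eqI)
  then show ?thesis by (rule that)
qed

theorem theorem1p2p4:
  fixes p :: "(int^'d) pmf" and \<rho>\<^sub>0 :: "real^'d \<Rightarrow> real"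
  assumes "finite_range_jump p" and "irreducible_jump p"
    and "torus_fun \<rho>\<^sub>0" and "continuous_on UNIV \<rho>\<^sub>0" and "\<And>u. \<rho>\<^sub>0 u \<ge> 0"
  shows "\<exists>\<rho> :: real \<Rightarrow> real^'d \<Rightarrow> real.
    (\<forall>t\<ge>0. \<forall>u. (\<lambda>N. mean_occupation p \<rho>\<^sub>0 N (time_scale p N * t) (micro_site N u))
       \<longlonglongrightarrow> \<rho> t u) \<and>
    (jump_mean p \<noteq> 0 \<longrightarrow>
       transport_weak (jump_mean p) \<rho>\<^sub>0 \<rho> \<and>
       ((\<forall>u. \<rho>\<^sub>0 differentiable (at u)) \<longrightarrow> transport_classical (jump_mean p) \<rho>\<^sub>0 \<rho>) \<and>
       (\<forall>t\<ge>0. \<forall>u. \<rho> t u = \<rho>\<^sub>0 (u - t *\<^sub>R jump_mean p))) \<and>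
    (jump_mean p = 0 \<longrightarrow>
       heat_solution (jump_cov p) \<rho>\<^sub>0 \<rho> \<and>
       (\<forall>t>0. \<forall>u. \<rho> t u =
          (\<integral>x. \<rho>\<^sub>0 x * gaussian_density (t *\<^sub>R jump_cov p) (u - x) \<partial>lborel)))"
proof -
  obtain B where B: "\<And>x. \<bar>\<rho>\<^sub>0 x\<bar> \<le> B" using torus_fun_bounded[OF assms(3,4)] by blast
  \<comment> \<open>The walk representation needs a nonempty torus, that is \<open>N > 0\<close>,
    which holds eventually.\<close>
  have occ: "(\<lambda>N. mean_occupation p \<rho>\<^sub>0 N (s N) (micro_site N u)) \<longlonglongrightarrow> l"
    if "(\<lambda>N. walk_mean p \<rho>\<^sub>0 N (s N) u) \<longlonglongrightarrow> l" for s u l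
  proof (rule Lim_transform_eventually[OF that])
    show "\<forall>\<^sub>F N in sequentially. walk_mean p \<rho>\<^sub>0 N (s N) u = mean_occupation p \<rho>\<^sub>0 N (s N) (micro_site N u)"
      using eventually_gt_at_top[of 0]
      by eventually_elim (simp add: mean_occupation_eq_walk_mean[OF assms(3,5)])
  qed
  show ?thesis
  proof (cases "jump_mean p = 0")
    case False
    let ?m = "jump_mean p"
    \<comment> \<open>The limiting functional is evaluation at \<open>u - t *\<^sub>R ?m\<close>,
      linear and contractive at sight, so only the phase of a character has to be computed.\<close>
    have "(\<lambda>N. walk_mean p \<rho>\<^sub>0 N (real N * t) u) \<longlonglongrightarrow> \<rho>\<^sub>0 (u - t *\<^sub>R ?m)" if t: "t \<ge> 0" for t u
    proof (rule walk_mean_tendsto[OF assms(3,4) B, where L="\<lambda>f. f (u - t *\<^sub>R ?m)"])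
      fix k :: "int^'d" and b
      let ?\<theta> = "(2 * pi) *\<^sub>R lat k"
      have "exp (of_real t * (- \<i> * of_real (?\<theta> \<bullet> ?m))) = cis (- (t * (?\<theta> \<bullet> ?m)))"
        by (simp add: cis_conv_exp mult_ac)
      then have "cis (?\<theta> \<bullet> u + b) * exp (of_real t * (- \<i> * of_real (?\<theta> \<bullet> ?m))) = cis (?\<theta> \<bullet> (u - t *\<^sub>R ?m) + b)"
        by (simp add: cis_mult inner_diff_right algebra_simps)
      then show "(\<lambda>N. walk_mean p (\<lambda>x. cos (?\<theta> \<bullet> x + b)) N (real N * t) u) \<longlonglongrightarrow> cos (?\<theta> \<bullet> (u - t *\<^sub>R ?m) + b)"
        using walk_mean_cos_tendsto[OF _ t tendsto_scaled_char_ballistic[OF assms(1), of ?\<theta>], of b u] by simp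
    qed auto
    then have lim: "(\<lambda>N. mean_occupation p \<rho>\<^sub>0 N (time_scale p N * t) (micro_site N u)) \<longlonglongrightarrow> \<rho>\<^sub>0 (u - t *\<^sub>R ?m)"
      if "t \<ge> 0" for t u
      using that False by (intro occ) (simp add: time_scale_def)
    show ?thesis
      using lim False transport_weak_shift[OF assms(3,4)] transport_classical_shift[OF assms(3)]
      by (intro exI[of _ "\<lambda>t u. \<rho>\<^sub>0 (u - t *\<^sub>R ?m)"]) simp
  next
    case True
    let ?C = "jump_cov p"
    obtain A where A: "det A \<noteq> 0" "?C = A ** transpose A"
      using positive_definite_factor[OF jump_cov_sym jump_cov_pos[OF assms(1,2)]] by blast
    have "(\<lambda>N. walk_mean p \<rho>\<^sub>0 N ((real N)\<^sup>2 * t) u) \<longlonglongrightarrow> heat_flow ?C \<rho>\<^sub>0 t u" if t: "t \<ge> 0" for t u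
    proof (rule walk_mean_tendsto[OF assms(3,4) B, where L="\<lambda>f. heat_flow ?C f t u"])
      fix k :: "int^'d" and b
      let ?\<theta> = "(2 * pi) *\<^sub>R lat k" and ?L = "- ((2 * pi) *\<^sub>R lat k \<bullet> (?C *v ((2 * pi) *\<^sub>R lat k))) / 2"
      \<comment> \<open>The decay rate of this character under the heat flow is the limit exponent
        of the walk; as it is real, it factors out of the real part.\<close>
      have "heat_flow ?C (\<lambda>x. cos (?\<theta> \<bullet> x + b)) t u = exp (t * ?L) * cos (?\<theta> \<bullet> u + b)"
        by (subst heat_flow_cos[OF A t]) (simp only: minus_mult_commute times_divide_eq_right)
      also have "\<dots> = Re (cis (?\<theta> \<bullet> u + b) * exp (of_real t * of_real ?L))"
        by (simp only: of_real_mult[symmetric] exp_of_real) simp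
      finally show "(\<lambda>N. walk_mean p (\<lambda>x. cos (?\<theta> \<bullet> x + b)) N ((real N)\<^sup>2 * t) u)
          \<longlonglongrightarrow> heat_flow ?C (\<lambda>x. cos (?\<theta> \<bullet> x + b)) t u"
        using walk_mean_cos_tendsto[OF _ t tendsto_scaled_char_diffusive[OF assms(1) True, of ?\<theta>], of b u]
        by (simp only: zero_le_power2)
    next
      fix g h :: "real^'d \<Rightarrow> real" assume gh: "trig_poly g" "trig_poly h"
      obtain B1 where B1: "\<And>x. \<bar>g x\<bar> \<le> B1" using trig_poly_bounded[OF gh(1)] by blast
      obtain B2 where B2: "\<And>x. \<bar>h x\<bar> \<le> B2" using trig_poly_bounded[OF gh(2)] by blast
      show "heat_flow ?C (\<lambda>x. g x + h x) t u = heat_flow ?C g t u + heat_flow ?C h t u"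
        by (rule heat_flow_add[OF A trig_poly_continuous[OF gh(1)] B1 trig_poly_continuous[OF gh(2)] B2])
    next
      fix g :: "real^'d \<Rightarrow> real" and e assume g: "trig_poly g" and e: "\<And>x. \<bar>\<rho>\<^sub>0 x - g x\<bar> \<le> e"
      obtain B1 where B1: "\<And>x. \<bar>g x\<bar> \<le> B1" using trig_poly_bounded[OF g] by blast
      show "\<bar>heat_flow ?C \<rho>\<^sub>0 t u - heat_flow ?C g t u\<bar> \<le> e"
        by (rule heat_flow_close[OF A assms(4) B trig_poly_continuous[OF g] B1 e])
    qed (rule heat_flow_scale[OF A])
    then have lim: "(\<lambda>N. mean_occupation p \<rho>\<^sub>0 N (time_scale p N * t) (micro_site N u)) \<longlonglongrightarrow> heat_flow ?C \<rho>\<^sub>0 t u"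
      if "t \<ge> 0" for t u
      using that True by (intro occ) (simp add: time_scale_def)
    show ?thesis
      using lim True heat_flow_solution[OF A assms(3,4) B]
      by (intro exI[of _ "heat_flow ?C \<rho>\<^sub>0"]) (simp add: heat_flow_def)
  qed
qed

end
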